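(* Let $\mathcal P$ be a nontrivial partial combinatory algebra. The category $\mathbf{HAsm}[\mathcal P]$ of Herbrand assemblies over $\mathcal P$ is a locally cartesian closed regular category with a natural numbers object and stable (finite) colimits.
   Context: Fix a standard coding of finite sequences of elements of $\mathcal P$ by elements of $\mathcal P$ (with length, projections, singletons, concatenation etc. represented by elements of $\mathcal P$). For a code $n$, $|n|$ is its length and $n_i$ its $i$th entry. For $A \subseteq \mathcal P$, $!A$ is the set of codes of finite sequences all of whose entries lie in $A$ (including the empty sequence), preordered by: $m \preceq n$ iff for every $i \le |m|$ there is $j \le |n|$ with $m_i = n_j$. A subset $U \subseteq {!A}$ is upwards closed in $!A$ if $m \in U$, $n \in {!A}$, $m \preceq n$ imply $n \in U$. A Herbrand assembly over $\mathcal P$ is a triple $(A, \mathcal A, \alpha)$ with $A$ a set, $\mathcal A \subseteq \mathcal P$, and $\alpha$ a function assigning to each $a \in A$ an inhabited subset $\alpha(a) \subseteq {!\mathcal A}$ that is upwards closed in $!\mathcal A$. A morphism $f : (B,\mathcal B,\beta) \to (A,\mathcal A,\alpha)$ is a function $f : B \to A$ for which there is $n \in \mathcal P$ (a tracking of $f$) such that for all $m \in {!\mathcal B}$, $n\cdot m$ is defined and lies in $!\mathcal A$, and for all $b \in B$, $m \in \beta(b)$ one has $n \cdot m \in \alpha(f(b))$. This defines the category $\mathbf{HAsm}[\mathcal P]$. Stable means stable under pullback. *)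

theory Defs
  imports Main "HOL-Library.FuncSet" "HOL-Library.Equipollence"
begin

section \<open>Categories\<close>

record ('o, 'm) cat =
  Obj :: "'o set"
  Arr :: "'m set"
  Src :: "'m \<Rightarrow> 'o"
  Tgt :: "'m \<Rightarrow> 'o"
  Ide :: "'o \<Rightarrow> 'm"
  Cmp :: "'m \<Rightarrow> 'm \<Rightarrow> 'm"  (infixl "\<cdot>\<index>" 70)

definition hom :: "('o, 'm) cat \<Rightarrow> 'o \<Rightarrow> 'o \<Rightarrow> 'm set" where
  "hom C X Y = {f \<in> Arr C. Src C f = X \<and> Tgt C f = Y}"

locale category =
  fixes C :: "('o, 'm) cat" (structure)
  assumes src_obj: "f \<in> Arr C \<Longrightarrow> Src C f \<in> Obj C"
    and tgt_obj: "f \<in> Arr C \<Longrightarrow> Tgt C f \<in> Obj C"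
    and ide_hom: "X \<in> Obj C \<Longrightarrow> Ide C X \<in> hom C X X"
    and cmp_hom: "\<lbrakk>f \<in> hom C X Y; g \<in> hom C Y Z\<rbrakk> \<Longrightarrow> g \<cdot> f \<in> hom C X Z"
    and ide_left: "f \<in> hom C X Y \<Longrightarrow> Ide C Y \<cdot> f = f"
    and ide_right: "f \<in> hom C X Y \<Longrightarrow> f \<cdot> Ide C X = f"
    and cmp_assoc: "\<lbrakk>f \<in> hom C W X; g \<in> hom C X Y; h \<in> hom C Y Z\<rbrakk>
                     \<Longrightarrow> h \<cdot> (g \<cdot> f) = (h \<cdot> g) \<cdot> f"

subsection \<open>Limits and colimits of finite diagrams\<close>

text \<open>A functor is given by its object part and its arrow part.\<close>

definition is_functor ::
  "('i, 'j) cat \<Rightarrow> ('o, 'm) cat \<Rightarrow> ('i \<Rightarrow> 'o) \<Rightarrow> ('j \<Rightarrow> 'm) \<Rightarrow> bool" where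
  "is_functor J C Fo Fa \<longleftrightarrow>
     category J \<and> category C \<and>
     (\<forall>i\<in>Obj J. Fo i \<in> Obj C) \<and>
     (\<forall>u\<in>Arr J. Fa u \<in> hom C (Fo (Src J u)) (Fo (Tgt J u))) \<and>
     (\<forall>i\<in>Obj J. Fa (Ide J i) = Ide C (Fo i)) \<and>
     (\<forall>u\<in>Arr J. \<forall>v\<in>Arr J. Tgt J u = Src J v \<longrightarrow>
        Fa (v \<cdot>\<^bsub>J\<^esub> u) = Fa v \<cdot>\<^bsub>C\<^esub> Fa u)"

definition is_nat_trans ::
  "('i, 'j) cat \<Rightarrow> ('o, 'm) cat \<Rightarrow> ('i \<Rightarrow> 'o) \<Rightarrow> ('j \<Rightarrow> 'm) \<Rightarrow>
   ('i \<Rightarrow> 'o) \<Rightarrow> ('j \<Rightarrow> 'm) \<Rightarrow> ('i \<Rightarrow> 'm) \<Rightarrow> bool" where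
  "is_nat_trans J C Fo Fa Go Ga \<phi> \<longleftrightarrow>
     (\<forall>i\<in>Obj J. \<phi> i \<in> hom C (Fo i) (Go i)) \<and>
     (\<forall>u\<in>Arr J. \<phi> (Tgt J u) \<cdot>\<^bsub>C\<^esub> Fa u = Ga u \<cdot>\<^bsub>C\<^esub> \<phi> (Src J u))"

definition is_cone ::
  "('i, 'j) cat \<Rightarrow> ('o, 'm) cat \<Rightarrow> ('i \<Rightarrow> 'o) \<Rightarrow> ('j \<Rightarrow> 'm) \<Rightarrow> 'o \<Rightarrow> ('i \<Rightarrow> 'm) \<Rightarrow> bool" where
  "is_cone J C Fo Fa L \<pi> \<longleftrightarrow>
     L \<in> Obj C \<and> (\<forall>i\<in>Obj J. \<pi> i \<in> hom C L (Fo i)) \<and>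
     (\<forall>u\<in>Arr J. Fa u \<cdot>\<^bsub>C\<^esub> \<pi> (Src J u) = \<pi> (Tgt J u))"

definition is_limit ::
  "('i, 'j) cat \<Rightarrow> ('o, 'm) cat \<Rightarrow> ('i \<Rightarrow> 'o) \<Rightarrow> ('j \<Rightarrow> 'm) \<Rightarrow> 'o \<Rightarrow> ('i \<Rightarrow> 'm) \<Rightarrow> bool" where
  "is_limit J C Fo Fa L \<pi> \<longleftrightarrow>
     is_cone J C Fo Fa L \<pi> \<and>
     (\<forall>X \<xi>. is_cone J C Fo Fa X \<xi> \<longrightarrow>
        (\<exists>!h. h \<in> hom C X L \<and> (\<forall>i\<in>Obj J. \<pi> i \<cdot>\<^bsub>C\<^esub> h = \<xi> i)))"

definition is_cocone ::
  "('i, 'j) cat \<Rightarrow> ('o, 'm) cat \<Rightarrow> ('i \<Rightarrow> 'o) \<Rightarrow> ('j \<Rightarrow> 'm) \<Rightarrow> 'o \<Rightarrow> ('i \<Rightarrow> 'm) \<Rightarrow> bool" where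
  "is_cocone J C Fo Fa L \<iota> \<longleftrightarrow>
     L \<in> Obj C \<and> (\<forall>i\<in>Obj J. \<iota> i \<in> hom C (Fo i) L) \<and>
     (\<forall>u\<in>Arr J. \<iota> (Tgt J u) \<cdot>\<^bsub>C\<^esub> Fa u = \<iota> (Src J u))"

definition is_colimit ::
  "('i, 'j) cat \<Rightarrow> ('o, 'm) cat \<Rightarrow> ('i \<Rightarrow> 'o) \<Rightarrow> ('j \<Rightarrow> 'm) \<Rightarrow> 'o \<Rightarrow> ('i \<Rightarrow> 'm) \<Rightarrow> bool" where
  "is_colimit J C Fo Fa L \<iota> \<longleftrightarrow>
     is_cocone J C Fo Fa L \<iota> \<and>
     (\<forall>X \<xi>. is_cocone J C Fo Fa X \<xi> \<longrightarrow>
        (\<exists>!h. h \<in> hom C L X \<and> (\<forall>i\<in>Obj J. h \<cdot>\<^bsub>C\<^esub> \<iota> i = \<xi> i)))"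

text \<open>Every finite category is isomorphic to one whose objects and arrows are natural numbers,
  so finite diagram shapes are taken among those.\<close>

definition finite_cat :: "(nat, nat) cat \<Rightarrow> bool" where
  "finite_cat J \<longleftrightarrow> category J \<and> finite (Obj J) \<and> finite (Arr J)"

definition has_finite_limits :: "('o, 'm) cat \<Rightarrow> bool" where
  "has_finite_limits C \<longleftrightarrow>
     (\<forall>J Fo Fa. finite_cat J \<and> is_functor J C Fo Fa \<longrightarrow> (\<exists>L \<pi>. is_limit J C Fo Fa L \<pi>))"

definition has_finite_colimits :: "('o, 'm) cat \<Rightarrow> bool" where
  "has_finite_colimits C \<longleftrightarrow>
     (\<forall>J Fo Fa. finite_cat J \<and> is_functor J C Fo Fa \<longrightarrow> (\<exists>L \<iota>. is_colimit J C Fo Fa L \<iota>))"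

definition is_terminal :: "('o, 'm) cat \<Rightarrow> 'o \<Rightarrow> bool" where
  "is_terminal C T \<longleftrightarrow> T \<in> Obj C \<and> (\<forall>X\<in>Obj C. \<exists>!f. f \<in> hom C X T)"

definition is_product :: "('o, 'm) cat \<Rightarrow> 'o \<Rightarrow> 'o \<Rightarrow> 'o \<Rightarrow> 'm \<Rightarrow> 'm \<Rightarrow> bool" where
  "is_product C X Y P p q \<longleftrightarrow>
     X \<in> Obj C \<and> Y \<in> Obj C \<and> P \<in> Obj C \<and> p \<in> hom C P X \<and> q \<in> hom C P Y \<and>
     (\<forall>Z f g. f \<in> hom C Z X \<and> g \<in> hom C Z Y \<longrightarrow>
        (\<exists>!h. h \<in> hom C Z P \<and> p \<cdot>\<^bsub>C\<^esub> h = f \<and> q \<cdot>\<^bsub>C\<^esub> h = g))"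

definition is_pullback :: "('o, 'm) cat \<Rightarrow> 'm \<Rightarrow> 'm \<Rightarrow> 'o \<Rightarrow> 'm \<Rightarrow> 'm \<Rightarrow> bool" where
  "is_pullback C f g P p q \<longleftrightarrow>
     f \<in> Arr C \<and> g \<in> Arr C \<and> Tgt C f = Tgt C g \<and>
     P \<in> Obj C \<and> p \<in> hom C P (Src C f) \<and> q \<in> hom C P (Src C g) \<and> f \<cdot>\<^bsub>C\<^esub> p = g \<cdot>\<^bsub>C\<^esub> q \<and>
     (\<forall>Z a b. a \<in> hom C Z (Src C f) \<and> b \<in> hom C Z (Src C g) \<and> f \<cdot>\<^bsub>C\<^esub> a = g \<cdot>\<^bsub>C\<^esub> b \<longrightarrow>
        (\<exists>!h. h \<in> hom C Z P \<and> p \<cdot>\<^bsub>C\<^esub> h = a \<and> q \<cdot>\<^bsub>C\<^esub> h = b))"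

text \<open>Colimits are stable when the pullback of a colimiting cocone along any \<open>f : Y \<rightarrow> L\<close> is again
  colimiting. The pulled back diagram \<open>G\<close> with its cocone \<open>\<kappa>\<close> into \<open>Y\<close> is given up to the choice
  of the pullbacks \<open>G i\<close> of \<open>\<iota> i\<close> along \<open>f\<close>; the property is required for every choice.\<close>

definition finite_colimits_stable :: "('o, 'm) cat \<Rightarrow> bool" where
  "finite_colimits_stable C \<longleftrightarrow>
     (\<forall>J Fo Fa L \<iota> Y f Go Ga \<kappa> \<phi>.
        finite_cat J \<and> is_functor J C Fo Fa \<and> is_colimit J C Fo Fa L \<iota> \<and>
        f \<in> hom C Y L \<and>
        is_functor J C Go Ga \<and> is_cocone J C Go Ga Y \<kappa> \<and>
        is_nat_trans J C Go Ga Fo Fa \<phi> \<and>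
        (\<forall>i\<in>Obj J. is_pullback C f (\<iota> i) (Go i) (\<kappa> i) (\<phi> i))
        \<longrightarrow> is_colimit J C Go Ga Y \<kappa>)"

definition has_stable_finite_colimits :: "('o, 'm) cat \<Rightarrow> bool" where
  "has_stable_finite_colimits C \<longleftrightarrow> has_finite_colimits C \<and> finite_colimits_stable C"

subsection \<open>Regular categories\<close>

definition is_coequalizer :: "('o, 'm) cat \<Rightarrow> 'm \<Rightarrow> 'm \<Rightarrow> 'm \<Rightarrow> bool" where
  "is_coequalizer C f g q \<longleftrightarrow>
     f \<in> Arr C \<and> g \<in> Arr C \<and> Src C f = Src C g \<and> Tgt C f = Tgt C g \<and>
     q \<in> Arr C \<and> Src C q = Tgt C f \<and> q \<cdot>\<^bsub>C\<^esub> f = q \<cdot>\<^bsub>C\<^esub> g \<and>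
     (\<forall>Z h. h \<in> hom C (Tgt C f) Z \<and> h \<cdot>\<^bsub>C\<^esub> f = h \<cdot>\<^bsub>C\<^esub> g \<longrightarrow>
        (\<exists>!u. u \<in> hom C (Tgt C q) Z \<and> u \<cdot>\<^bsub>C\<^esub> q = h))"

definition is_regular_epi :: "('o, 'm) cat \<Rightarrow> 'm \<Rightarrow> bool" where
  "is_regular_epi C e \<longleftrightarrow> (\<exists>f g. is_coequalizer C f g e)"

definition regular_category :: "('o, 'm) cat \<Rightarrow> bool" where
  "regular_category C \<longleftrightarrow>
     category C \<and> has_finite_limits C \<and>
     (\<forall>f P p q. is_pullback C f f P p q \<longrightarrow> (\<exists>e. is_coequalizer C p q e)) \<and>
     (\<forall>e f P p q. is_regular_epi C e \<and> is_pullback C f e P p q \<longrightarrow> is_regular_epi C p)"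

subsection \<open>Locally cartesian closed categories\<close>

text \<open>\<open>ev\<close> is the evaluation on a product \<open>P\<close> of \<open>E\<close> and \<open>X\<close>; the arrow \<open>u\<close> below
  is \<open>h \<times> id\<^sub>X\<close>.\<close>

definition is_exponential ::
  "('o, 'm) cat \<Rightarrow> 'o \<Rightarrow> 'o \<Rightarrow> 'o \<Rightarrow> 'o \<Rightarrow> 'm \<Rightarrow> 'm \<Rightarrow> 'm \<Rightarrow> bool" where
  "is_exponential C X Y E P p q ev \<longleftrightarrow>
     is_product C E X P p q \<and> ev \<in> hom C P Y \<and>
     (\<forall>Z Q a b g. is_product C Z X Q a b \<and> g \<in> hom C Q Y \<longrightarrow>
        (\<exists>!h. h \<in> hom C Z E \<and>
           (\<exists>u\<in>hom C Q P. p \<cdot>\<^bsub>C\<^esub> u = h \<cdot>\<^bsub>C\<^esub> a \<and> q \<cdot>\<^bsub>C\<^esub> u = b \<and> ev \<cdot>\<^bsub>C\<^esub> u = g)))"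

definition cartesian_closed :: "('o, 'm) cat \<Rightarrow> bool" where
  "cartesian_closed C \<longleftrightarrow>
     category C \<and> (\<exists>T. is_terminal C T) \<and>
     (\<forall>X\<in>Obj C. \<forall>Y\<in>Obj C. \<exists>P p q. is_product C X Y P p q) \<and>
     (\<forall>X\<in>Obj C. \<forall>Y\<in>Obj C. \<exists>E P p q ev. is_exponential C X Y E P p q ev)"

text \<open>An arrow of the slice from \<open>f\<close> to \<open>g\<close> is a triple \<open>(f, h, g)\<close> with \<open>g \<cdot> h = f\<close>.\<close>

definition slice :: "('o, 'm) cat \<Rightarrow> 'o \<Rightarrow> ('m, 'm \<times> 'm \<times> 'm) cat" where
  "slice C X =
     \<lparr>Obj = {f \<in> Arr C. Tgt C f = X},
      Arr = {(f, h, g). f \<in> Arr C \<and> Tgt C f = X \<and> g \<in> Arr C \<and> Tgt C g = X \<and>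
                        h \<in> hom C (Src C f) (Src C g) \<and> g \<cdot>\<^bsub>C\<^esub> h = f},
      Src = (\<lambda>(f, h, g). f),
      Tgt = (\<lambda>(f, h, g). g),
      Ide = (\<lambda>f. (f, Ide C (Src C f), f)),
      Cmp = (\<lambda>(_, h', g') (f, h, _). (f, h' \<cdot>\<^bsub>C\<^esub> h, g'))\<rparr>"

definition locally_cartesian_closed :: "('o, 'm) cat \<Rightarrow> bool" where
  "locally_cartesian_closed C \<longleftrightarrow> category C \<and> (\<forall>X\<in>Obj C. cartesian_closed (slice C X))"

subsection \<open>Natural numbers objects\<close>

definition is_nno :: "('o, 'm) cat \<Rightarrow> 'o \<Rightarrow> 'o \<Rightarrow> 'm \<Rightarrow> 'm \<Rightarrow> bool" where
  "is_nno C T N z s \<longleftrightarrow>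
     is_terminal C T \<and> z \<in> hom C T N \<and> s \<in> hom C N N \<and>
     (\<forall>X x f. x \<in> hom C T X \<and> f \<in> hom C X X \<longrightarrow>
        (\<exists>!h. h \<in> hom C N X \<and> h \<cdot>\<^bsub>C\<^esub> z = x \<and> h \<cdot>\<^bsub>C\<^esub> s = f \<cdot>\<^bsub>C\<^esub> h))"

definition has_nno :: "('o, 'm) cat \<Rightarrow> bool" where
  "has_nno C \<longleftrightarrow> (\<exists>T N z s. is_nno C T N z s)"


section \<open>Partial combinatory algebras and codes of sequences\<close>

text \<open>Application of partial terms is strict: \<open>None\<close> stands for an undefined term.\<close>

definition ap :: "('p \<Rightarrow> 'p \<Rightarrow> 'p option) \<Rightarrow> 'p option \<Rightarrow> 'p option \<Rightarrow> 'p option" where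
  "ap app t u = Option.bind t (\<lambda>x. Option.bind u (\<lambda>y. app x y))"

text \<open>The axiom for \<open>s\<close> only asks \<open>s x y z\<close> to be defined when \<open>x z (y z)\<close> is. Algebras with
  \<open>s x y z \<simeq> x z (y z)\<close> (Kleene equality) are the special case where the converse holds too.\<close>

locale pca =
  fixes app :: "'p \<Rightarrow> 'p \<Rightarrow> 'p option" and k s :: 'p
  assumes k_ax: "ap app (ap app (Some k) (Some x)) (Some y) = Some x"
    and s_def: "ap app (ap app (Some s) (Some x)) (Some y) \<noteq> None"
    and s_ax: "ap app (ap app (Some x) (Some z)) (ap app (Some y) (Some z)) = Some w \<Longrightarrow>
               ap app (ap app (ap app (Some s) (Some x)) (Some y)) (Some z) = Some w"

locale nontrivial_pca = pca app k s for app :: "'p \<Rightarrow> 'p \<Rightarrow> 'p option" and k s :: 'p +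
  assumes nontrivial: "\<exists>x y :: 'p. x \<noteq> y"

context pca
begin

definition comb_i :: 'p where
  "comb_i = the (ap app (ap app (Some s) (Some k)) (Some k))"

text \<open>\<open>pair x y = s (s i (k x)) (k y)\<close>, that is \<open>\<lambda>z. z x y\<close>.\<close>

definition pair :: "'p \<Rightarrow> 'p \<Rightarrow> 'p" where
  "pair x y =
     the (ap app
           (ap app (Some s) (ap app (ap app (Some s) (Some comb_i)) (ap app (Some k) (Some x))))
           (ap app (Some k) (Some y)))"

text \<open>The Curry numerals, with \<open>k i\<close> as the second truth value.\<close>

primrec num :: "nat \<Rightarrow> 'p" where
  "num 0 = comb_i"
| "num (Suc n) = pair (the (app k comb_i)) (num n)"

end

text \<open>Any coding of finite sequences will do in which length, projections, singletons and
  concatenation are represented. Entries are indexed from \<open>0\<close>.\<close>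

locale pca_coding = pca app k s for app :: "'p \<Rightarrow> 'p \<Rightarrow> 'p option" and k s :: 'p +
  fixes code :: "'p list \<Rightarrow> 'p"
  assumes code_inj: "inj code"
    and code_length: "\<exists>l. \<forall>xs. app l (code xs) = Some (num (length xs))"
    and code_nth: "\<exists>p. \<forall>xs. \<forall>i<length xs.
                     ap app (ap app (Some p) (Some (code xs))) (Some (num i)) = Some (xs ! i)"
    and code_singleton: "\<exists>e. \<forall>x. app e x = Some (code [x])"
    and code_append: "\<exists>c. \<forall>xs ys.
                        ap app (ap app (Some c) (Some (code xs))) (Some (code ys))
                          = Some (code (xs @ ys))"

definition code_len :: "('p list \<Rightarrow> 'p) \<Rightarrow> 'p \<Rightarrow> nat" where
  "code_len code n = length (inv code n)"

definition code_entry :: "('p list \<Rightarrow> 'p) \<Rightarrow> 'p \<Rightarrow> nat \<Rightarrow> 'p" where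
  "code_entry code n i = inv code n ! i"

definition bang :: "('p list \<Rightarrow> 'p) \<Rightarrow> 'p set \<Rightarrow> 'p set" where
  "bang code A = code ` lists A"

definition code_le :: "('p list \<Rightarrow> 'p) \<Rightarrow> 'p \<Rightarrow> 'p \<Rightarrow> bool" where
  "code_le code m n \<longleftrightarrow>
     (\<forall>i<code_len code m. \<exists>j<code_len code n. code_entry code m i = code_entry code n j)"

definition upwards_closed :: "('p list \<Rightarrow> 'p) \<Rightarrow> 'p set \<Rightarrow> 'p set \<Rightarrow> bool" where
  "upwards_closed code A U \<longleftrightarrow>
     (\<forall>m n. m \<in> U \<and> n \<in> bang code A \<and> code_le code m n \<longrightarrow> n \<in> U)"


section \<open>Herbrand assemblies\<close>

text \<open>The sets that may underlie an assembly form a family \<open>U\<close> of sets over one type \<open>'u\<close>,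
  which plays the role of the universe of (small) sets. It is only required to be closed
  under subsets and, up to bijection, under binary products and power sets, and to contain an
  infinite set;
  in particular any Grothendieck universe with an infinite member is an instance.\<close>

definition set_universe :: "'u set set \<Rightarrow> bool" where
  "set_universe U \<longleftrightarrow>
     (\<forall>A\<in>U. \<forall>B. B \<subseteq> A \<longrightarrow> B \<in> U) \<and>
     (\<forall>A\<in>U. \<forall>B\<in>U. \<exists>D\<in>U. D \<approx> A \<times> B) \<and>
     (\<forall>A\<in>U. \<exists>D\<in>U. D \<approx> Pow A) \<and>
     (\<exists>A\<in>U. infinite A)"

record ('u, 'p) hasm =
  Under :: "'u set"
  Base :: "'p set"
  Real :: "'u \<Rightarrow> 'p set"

text \<open>\<open>Real X\<close> is a function on \<open>Under X\<close>, hence fixed arbitrarily outside of it.\<close>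

definition herbrand_assembly :: "('p list \<Rightarrow> 'p) \<Rightarrow> ('u, 'p) hasm \<Rightarrow> bool" where
  "herbrand_assembly code X \<longleftrightarrow>
     Real X \<in> extensional (Under X) \<and>
     (\<forall>a\<in>Under X. Real X a \<noteq> {} \<and> Real X a \<subseteq> bang code (Base X) \<and>
                   upwards_closed code (Base X) (Real X a))"

definition tracks ::
  "('p \<Rightarrow> 'p \<Rightarrow> 'p option) \<Rightarrow> ('p list \<Rightarrow> 'p) \<Rightarrow> ('u, 'p) hasm \<Rightarrow> ('u, 'p) hasm \<Rightarrow>
   'p \<Rightarrow> ('u \<Rightarrow> 'u) \<Rightarrow> bool" where
  "tracks app code Y X n f \<longleftrightarrow>
     (\<forall>m\<in>bang code (Base Y). \<exists>r\<in>bang code (Base X). app n m = Some r) \<and>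
     (\<forall>b\<in>Under Y. \<forall>m\<in>Real Y b. \<exists>r\<in>Real X (f b). app n m = Some r)"

text \<open>An arrow is a triple of its domain, its underlying function and its codomain.\<close>

definition HAsm ::
  "'u set set \<Rightarrow> ('p \<Rightarrow> 'p \<Rightarrow> 'p option) \<Rightarrow> ('p list \<Rightarrow> 'p) \<Rightarrow>
   (('u, 'p) hasm, ('u, 'p) hasm \<times> ('u \<Rightarrow> 'u) \<times> ('u, 'p) hasm) cat" where
  "HAsm U app code =
     \<lparr>Obj = {X. herbrand_assembly code X \<and> Under X \<in> U},
      Arr = {(Y, f, X). herbrand_assembly code Y \<and> Under Y \<in> U \<and>
                        herbrand_assembly code X \<and> Under X \<in> U \<and>
                        f \<in> Under Y \<rightarrow>\<^sub>E Under X \<and> (\<exists>n. tracks app code Y X n f)},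
      Src = (\<lambda>(Y, f, X). Y),
      Tgt = (\<lambda>(Y, f, X). X),
      Ide = (\<lambda>X. (X, (\<lambda>a\<in>Under X. a), X)),
      Cmp = (\<lambda>(_, g, X) (Z, f, _). (Z, compose (Under Z) g f, X))\<rparr>"

end

theory Submission imports Defs begin

text \<open>
  By upward closure, a realizer matters only through the finite set of its entries, and a tracking
  may run several programs and concatenate their outputs. A realizer of an element of a coproduct
  therefore need not reveal the summand: both branches are run. A realizer of an element of a
  quotient is a realizer of any representative, and one of a natural number is a list
  containing its numeral. An element of an exponential over \<open>S\<close> is a point \<open>s\<close> with a function between the
  fibres over \<open>s\<close>; its realizers combine one of \<open>s\<close> with a list of programs, each total on all coded
  sequences, whose outputs together realize the value.

  Stability of colimits follows from local exponentials: a cocone under the pullback of a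
  diagram along \<open>f : Y \<rightarrow> L\<close> with vertex \<open>X\<close> is transposed to a cocone under the diagram itself, with
  vertex the exponential of \<open>L \<times> X\<close> by \<open>f\<close> over \<open>L\<close>. Regularity needs only the case of coequalizers.
\<close>

section \<open>Combinatory completeness\<close>

datatype 'p tm = Var nat | Con 'p | Ap "'p tm" "'p tm"

context pca
begin

primrec ev :: "(nat \<Rightarrow> 'p) \<Rightarrow> 'p tm \<Rightarrow> 'p option" where
  "ev \<rho> (Var i) = Some (\<rho> i)"
| "ev \<rho> (Con c) = Some c"
| "ev \<rho> (Ap t u) = ap app (ev \<rho> t) (ev \<rho> u)"

text \<open>Bracket abstraction of \<open>Var 0\<close>, the other variables moving down by one.
  Even an application in which \<open>Var 0\<close> does not occur gets the clause with
  \<open>s\<close>: prefixing it with \<open>k\<close> would require its value, which may fail to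
  exist.\<close>

primrec lam :: "'p tm \<Rightarrow> 'p tm" where
  "lam (Var i) = (case i of 0 \<Rightarrow> Ap (Ap (Con s) (Con k)) (Con k) | Suc j \<Rightarrow> Ap (Con k) (Var j))"
| "lam (Con c) = Ap (Con k) (Con c)"
| "lam (Ap t u) = Ap (Ap (Con s) (lam t)) (lam u)"

lemma ap_Some [simp]: "ap app (Some x) (Some y) = app x y"
  by (simp add: ap_def)

lemma ap_None [simp]: "ap app None u = None" "ap app t None = None"
  by (cases t; simp add: ap_def)+

lemma k_total: "\<exists>v. app k x = Some v \<and> (\<forall>y. app v y = Some x)"
proof -
  have "ap app (ap app (Some k) (Some x)) (Some y) = Some x" for y
    by (rule k_ax)
  then show ?thesis
    by (cases "app k x") auto
qed

lemma s_total:
  obtains v where "ap app (app s x) (Some y) = Some v"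
    "\<And>z w. ap app (app x z) (app y z) = Some w \<Longrightarrow> app v z = Some w"
proof -
  obtain v where v: "ap app (app s x) (Some y) = Some v"
    using s_def[of x y] by auto
  have "app v z = Some w" if "ap app (app x z) (app y z) = Some w" for z w
    using s_ax[of x z y w] that v by simp
  with v show thesis
    using that by blast
qed

text \<open>An abstraction denotes even where its body does not, because \<open>k x\<close> and
  \<open>s x y\<close> are always defined. This is what later delays the evaluation of a branch. The
  behaviour on arguments is an implication, as \<open>s_ax\<close> transfers definedness in one
  direction.\<close>

lemma lam:
  obtains v where "ev \<rho> (lam t) = Some v"
    "\<And>x w. ev (case_nat x \<rho>) t = Some w \<Longrightarrow> app v x = Some w"
proof -
  have "\<exists>v. ev \<rho> (lam t) = Some v \<and> (\<forall>x w. ev (case_nat x \<rho>) t = Some w \<longrightarrow> app v x = Some w)"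
  proof (induction t)
    case (Var i)
    show ?case
    proof (cases i)
      case 0
      obtain v where v: "ap app (app s k) (Some k) = Some v"
        "\<And>z w. ap app (app k z) (app k z) = Some w \<Longrightarrow> app v z = Some w"
        using s_total by blast
      have "app v x = Some x" for x
        using k_total[of x] v(2)[of x x] by auto
      with 0 v(1) show ?thesis
        by simp
    next
      case (Suc j)
      then show ?thesis
        using k_total[of "\<rho> j"] by auto
    qed
  next
    case (Con c)
    then show ?case
      using k_total[of c] by auto
  next
    case (Ap t u)
    then obtain x y where x: "ev \<rho> (lam t) = Some x"
        "\<And>z w. ev (case_nat z \<rho>) t = Some w \<Longrightarrow> app x z = Some w"
      and y: "ev \<rho> (lam u) = Some y"
        "\<And>z w. ev (case_nat z \<rho>) u = Some w \<Longrightarrow> app y z = Some w"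
      by blast
    obtain v where v: "ap app (app s x) (Some y) = Some v"
      "\<And>z w. ap app (app x z) (app y z) = Some w \<Longrightarrow> app v z = Some w"
      using s_total by blast
    have "app v z = Some w" if "ev (case_nat z \<rho>) (Ap t u) = Some w" for z w
    proof (cases "ev (case_nat z \<rho>) t")
      case None
      with that show ?thesis by simp
    next
      case (Some a)
      show ?thesis
      proof (cases "ev (case_nat z \<rho>) u")
        case None
        with that show ?thesis by simp
      next
        case b: (Some b)
        show ?thesis
          using v(2)[of z w] x(2)[OF Some] y(2)[OF b] that Some b by simp
      qed
    qed
    with x(1) y(1) v(1) show ?case
      by simp
  qed
  then show thesis
    using that by blast
qed

section \<open>Abstraction over several arguments, and recursion\<close>

lemma comb1:
  obtains c where "\<And>x w. ev (case_nat x \<rho>) t = Some w \<Longrightarrow> app c x = Some w"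
  using lam by metis

text \<open>The partial application is named by a function \<open>g\<close> because it serves as an
  element in its own right, for instance as a fixed point or as a curried program. The last argument
  is \<open>Var 0\<close>, the one before it \<open>Var 1\<close>.\<close>

lemma comb2:
  obtains c g where "\<And>x. app c x = Some (g x)"
    "\<And>x y w. ev (case_nat y (case_nat x \<rho>)) t = Some w \<Longrightarrow> app (g x) y = Some w"
proof -
  obtain c where c: "\<And>x w. ev (case_nat x \<rho>) (lam t) = Some w \<Longrightarrow> app c x = Some w"
    using comb1 by blast
  have "\<exists>v. app c x = Some v \<and> (\<forall>y w. ev (case_nat y (case_nat x \<rho>)) t = Some w \<longrightarrow> app v y = Some w)" for x
    using lam[of "case_nat x \<rho>" t] c by metis
  then show thesis
    using that by metis
qed

lemma comb3:
  obtains c g h where "\<And>x. app c x = Some (g x)" "\<And>x y. app (g x) y = Some (h x y)"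
    "\<And>x y z w. ev (case_nat z (case_nat y (case_nat x \<rho>))) t = Some w \<Longrightarrow> app (h x y) z = Some w"
proof -
  obtain c g where c: "\<And>x. app c x = Some (g x)"
    "\<And>x y w. ev (case_nat y (case_nat x \<rho>)) (lam t) = Some w \<Longrightarrow> app (g x) y = Some w"
    using comb2 by blast
  have "\<exists>v. app (g x) y = Some v \<and>
      (\<forall>z w. ev (case_nat z (case_nat y (case_nat x \<rho>))) t = Some w \<longrightarrow> app v z = Some w)" for x y
    using lam[of "case_nat y (case_nat x \<rho>)" t] c(2) by metis
  then show thesis
    using that c(1) by metis
qed

lemma comb4:
  obtains c g h l where "\<And>x. app c x = Some (g x)" "\<And>x y. app (g x) y = Some (h x y)"
    "\<And>x y z. app (h x y) z = Some (l x y z)"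
    "\<And>x y z u w. ev (case_nat u (case_nat z (case_nat y (case_nat x \<rho>)))) t = Some w \<Longrightarrow>
       app (l x y z) u = Some w"
proof -
  obtain c g h where c: "\<And>x. app c x = Some (g x)" "\<And>x y. app (g x) y = Some (h x y)"
    "\<And>x y z w. ev (case_nat z (case_nat y (case_nat x \<rho>))) (lam t) = Some w \<Longrightarrow> app (h x y) z = Some w"
    using comb3 by blast
  have "\<exists>v. app (h x y) z = Some v \<and>
      (\<forall>u w. ev (case_nat u (case_nat z (case_nat y (case_nat x \<rho>)))) t = Some w \<longrightarrow> app v u = Some w)"
    for x y z
    using lam[of "case_nat z (case_nat y (case_nat x \<rho>))" t] c(3) by metis
  then show thesis
    using that c(1,2) by metis
qed

text \<open>Curry's fixed point in its strict form: \<open>c\<close> is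
  \<open>\<lambda>x y. f (x x) y\<close>, so that the self-application waits for the argument
  \<open>y\<close>. Since \<open>c c\<close> has the value \<open>g c\<close>, the element
  \<open>z = g c\<close> behaves like \<open>f z\<close> on arguments.\<close>

lemma fixpoint:
  obtains z where "\<And>x w. ap app (app f z) (Some x) = Some w \<Longrightarrow> app z x = Some w"
proof -
  obtain c g where c: "\<And>x. app c x = Some (g x)"
    "\<And>x y w. ev (case_nat y (case_nat x (\<lambda>_. k)))
       (Ap (Ap (Con f) (Ap (Var (Suc 0)) (Var (Suc 0)))) (Var 0)) = Some w \<Longrightarrow> app (g x) y = Some w"
    using comb2 by blast
  show thesis
    by (rule that[of "g c"], rule c(2)) (simp add: c(1))
qed

lemma comb_i [simp]: "app comb_i x = Some x"
proof -
  obtain v where v: "ap app (app s k) (Some k) = Some v"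
    "\<And>z w. ap app (app k z) (app k z) = Some w \<Longrightarrow> app v z = Some w"
    using s_total by blast
  have "app v x = Some x"
    using k_total[of x] v(2)[of x x] by auto
  with v(1) show ?thesis
    by (simp add: comb_i_def)
qed

section \<open>Case distinction on the Curry numerals\<close>

definition comb_ki :: 'p where
  "comb_ki = the (app k comb_i)"

lemma app_k_comb_i: "app k comb_i = Some comb_ki" "app comb_ki x = Some comb_i"
  using k_total[of comb_i] by (auto simp: comb_ki_def)

lemma app_pair:
  assumes "ap app (app z x) (Some y) = Some w"
  shows "app (pair x y) z = Some w"
proof -
  obtain kx where kx: "app k x = Some kx" "\<And>u. app kx u = Some x"
    using k_total by blast
  obtain ky where ky: "app k y = Some ky" "\<And>u. app ky u = Some y"
    using k_total by blast
  obtain v where v: "ap app (app s comb_i) (Some kx) = Some v"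
    "\<And>z w. ap app (app comb_i z) (app kx z) = Some w \<Longrightarrow> app v z = Some w"
    using s_total by blast
  obtain v' where v': "ap app (app s v) (Some ky) = Some v'"
    "\<And>z w. ap app (app v z) (app ky z) = Some w \<Longrightarrow> app v' z = Some w"
    using s_total by blast
  have p: "pair x y = v'"
    using kx ky v v' by (simp add: pair_def)
  obtain a where a: "app z x = Some a"
    using assms by (cases "app z x") auto
  have "app v z = Some a"
    using a by (intro v(2)) (simp add: kx)
  then show ?thesis
    using assms a unfolding p by (intro v'(2)) (simp add: ky)
qed

text \<open>\<open>num 0\<close> is the identity and so returns \<open>k\<close> itself, which
  selects the first of two arguments; a successor is a pair and returns its first component
  \<open>comb_ki\<close>, which selects the second. Applying a numeral to \<open>k\<close> thus
  turns it into a branching on zero.\<close>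

lemma num_select:
  "ap app (ap app (app (num 0) k) (Some x)) (Some y) = Some x"
  "ap app (ap app (app (num (Suc n)) k) (Some x)) (Some y) = Some y"
proof -
  show "ap app (ap app (app (num 0) k) (Some x)) (Some y) = Some x"
    using k_total[of x] by auto
  have "app (num (Suc n)) k = Some comb_ki"
    using k_total[of comb_ki] by (auto simp: comb_ki_def intro!: app_pair)
  then show "ap app (ap app (app (num (Suc n)) k) (Some x)) (Some y) = Some y"
    by (simp add: app_k_comb_i)
qed

lemma num_pred: "app (num (Suc n)) comb_ki = Some (num n)"
  using app_k_comb_i by (auto simp: comb_ki_def[symmetric] intro!: app_pair)

end

section \<open>Computable functions on lists\<close>

locale nontrivial_coding = nontrivial_pca app k s + pca_coding app k s code
  for app :: "'p \<Rightarrow> 'p \<Rightarrow> 'p option" and k s :: 'p and code :: "'p list \<Rightarrow> 'p"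
begin

text \<open>Programs act on codes, but \<open>F\<close> acts on lists, and the program itself is
  hidden behind the quantifier. Trackings can then be put together from closure properties of
  \<open>comp\<close>. Lists with an entry outside \<open>A\<close> are left unconstrained, so that
  \<open>F\<close> may use inverses and choices that are meaningful over \<open>A\<close>
  only.\<close>

definition comp :: "'p set \<Rightarrow> ('p list \<Rightarrow> 'p list) \<Rightarrow> bool" where
  "comp A F \<longleftrightarrow> (\<exists>n. \<forall>xs. set xs \<subseteq> A \<longrightarrow> app n (code xs) = Some (code (F xs)))"

lemma comp_id: "comp A (\<lambda>xs. xs)"
  unfolding comp_def by (rule exI[of _ comb_i]) simp

lemma comp_const: "comp A (\<lambda>_. c)"
  unfolding comp_def using k_total[of "code c"] by blast

lemma comp_comp:
  assumes "comp A F" "comp B G" "\<And>xs. set xs \<subseteq> A \<Longrightarrow> set (F xs) \<subseteq> B"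
  shows "comp A (\<lambda>xs. G (F xs))"
proof -
  obtain f where f: "\<And>xs. set xs \<subseteq> A \<Longrightarrow> app f (code xs) = Some (code (F xs))"
    using assms(1) comp_def by auto
  obtain g where g: "\<And>xs. set xs \<subseteq> B \<Longrightarrow> app g (code xs) = Some (code (G xs))"
    using assms(2) comp_def by auto
  obtain c where c: "\<And>x w. ev (case_nat x (\<lambda>_. k)) (Ap (Con g) (Ap (Con f) (Var 0))) = Some w
      \<Longrightarrow> app c x = Some w"
    using comb1 by blast
  show ?thesis
    unfolding comp_def by (rule exI[of _ c]) (auto simp: f g assms(3) intro!: c)
qed

lemma comp_append:
  assumes "comp A F" "comp A G"
  shows "comp A (\<lambda>xs. F xs @ G xs)"
proof -
  obtain f where f: "\<And>xs. set xs \<subseteq> A \<Longrightarrow> app f (code xs) = Some (code (F xs))"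
    using assms(1) comp_def by auto
  obtain g where g: "\<And>xs. set xs \<subseteq> A \<Longrightarrow> app g (code xs) = Some (code (G xs))"
    using assms(2) comp_def by auto
  obtain a where a: "\<And>xs ys. ap app (app a (code xs)) (Some (code ys)) = Some (code (xs @ ys))"
    using code_append by auto
  obtain c where c: "\<And>x w. ev (case_nat x (\<lambda>_. k))
      (Ap (Ap (Con a) (Ap (Con f) (Var 0))) (Ap (Con g) (Var 0))) = Some w \<Longrightarrow> app c x = Some w"
    using comb1 by blast
  show ?thesis
    unfolding comp_def by (rule exI[of _ c]) (auto simp: f g a intro!: c)
qed

text \<open>Recursion on a numeral \<open>i\<close>, computing the result for the first \<open>i\<close> entries. The branches \<open>zero\<close> and
  \<open>lam step\<close> are abstractions, so that the recursive call is evaluated only after the case distinction.\<close>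

lemma mapcat_combinator:
  assumes e: "\<And>x ys. x \<in> A \<Longrightarrow> set ys \<subseteq> B \<Longrightarrow> ap app (app e x) (Some (code ys)) = Some (code (f x ys))"
  obtains M where "\<And>xs ys. set xs \<subseteq> A \<Longrightarrow> set ys \<subseteq> B \<Longrightarrow>
    ap app (app M (code xs)) (Some (code ys)) = Some (code (concat (map (\<lambda>x. f x ys) xs)))"
proof -
  obtain l where l: "\<And>xs. app l (code xs) = Some (num (length xs))"
    using code_length by auto
  obtain p where p: "\<And>xs i. i < length xs \<Longrightarrow>
      ap app (app p (code xs)) (Some (num i)) = Some (xs ! i)"
    using code_nth by auto
  obtain a where a: "\<And>xs ys. ap app (app a (code xs)) (Some (code ys)) = Some (code (xs @ ys))"
    using code_append by auto
  define zero where "zero = lam (Con (code []))"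
  \<comment> \<open>Below the dummy variable \<open>Var 0\<close> stand \<open>Var 1\<close> for the
    parameter \<open>ys\<close>, \<open>Var 2\<close> for the list \<open>xs\<close>,
    \<open>Var 3\<close> for the numeral and \<open>Var 4\<close> for the function being defined.
    Applying a successor to \<open>comb_ki\<close> gives its predecessor \<open>i\<close>, which is
    at once the argument of the recursive call and, as entries are counted from \<open>0\<close>,
    the index of the entry to be added.\<close>
  define step where "step =
    Ap (Ap (Con a) (Ap (Ap (Ap (Var 4) (Ap (Var 3) (Con comb_ki))) (Var 2)) (Var 1)))
       (Ap (Ap (Con e) (Ap (Ap (Con p) (Var 2)) (Ap (Var 3) (Con comb_ki)))) (Var 1))"
  define body where "body = Ap (Ap (Ap (Ap (Var 2) (Con k)) zero) (lam step)) (Con k)"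
  obtain F g h t where F: "\<And>x. app F x = Some (g x)" "\<And>x y. app (g x) y = Some (h x y)"
    "\<And>x y z. app (h x y) z = Some (t x y z)"
    "\<And>x y z u w. ev (case_nat u (case_nat z (case_nat y (case_nat x (\<lambda>_. k))))) body = Some w \<Longrightarrow>
       app (t x y z) u = Some w"
    using comb4[where t = body and \<rho> = "\<lambda>_. k"] by blast
  obtain z where z: "\<And>x w. ap app (app F z) (Some x) = Some w \<Longrightarrow> app z x = Some w"
    using fixpoint by blast
  \<comment> \<open>\<open>F\<close> waits for two further arguments, so \<open>z n\<close> has a
    value whether or not the recursion behind it has been carried out.\<close>
  have z: "app z n = Some (h z n)" for n
    by (rule z) (simp add: F)
  have rec: "app (t z (num i) (code xs)) (code ys) = Some (code (concat (map (\<lambda>x. f x ys) (take i xs))))"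
    if "i \<le> length xs" "set xs \<subseteq> A" "set ys \<subseteq> B" for i xs ys
    using that(1)
  proof (induction i)
    case 0
    define \<rho> where "\<rho> = case_nat (code ys) (case_nat (code xs) (case_nat (num 0) (case_nat z (\<lambda>_. k))))"
    obtain v where v: "ev \<rho> zero = Some v" "\<And>x. app v x = Some (code [])"
      unfolding zero_def by (rule lam[of \<rho> "Con (code [])"]) auto
    obtain v' where v': "ev \<rho> (lam step) = Some v'"
      by (rule lam)
    have "ev \<rho> body = Some (code [])"
      using num_select(1)[of v v'] v v' by (simp add: body_def \<rho>_def eval_nat_numeral)
    then show ?case
      unfolding \<rho>_def by (intro F(4)) simp
  next
    case (Suc i)
    define \<rho> where "\<rho> = case_nat (code ys) (case_nat (code xs) (case_nat (num (Suc i)) (case_nat z (\<lambda>_. k))))"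
    obtain v where v: "ev \<rho> zero = Some v"
      unfolding zero_def by (rule lam)
    obtain v' where v': "ev \<rho> (lam step) = Some v'"
        "\<And>x w. ev (case_nat x \<rho>) step = Some w \<Longrightarrow> app v' x = Some w"
      using lam[of \<rho> step] by metis
    have x: "xs ! i \<in> A"
      using Suc.prems that(2) nth_mem[of i xs] by auto
    have "app v' k = Some (code (concat (map (\<lambda>x. f x ys) (take (Suc i) xs))))"
      using Suc that x
      by (intro v'(2)) (simp add: step_def \<rho>_def eval_nat_numeral num_pred del: num.simps,
          simp add: z F p a e take_Suc_conv_app_nth)
    then have "ev \<rho> body = Some (code (concat (map (\<lambda>x. f x ys) (take (Suc i) xs))))"
      using num_select(2)[of i v v'] v v' by (simp add: body_def \<rho>_def eval_nat_numeral del: num.simps)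
    then show ?case
      unfolding \<rho>_def by (intro F(4)) simp
  qed
  obtain M g' where M: "\<And>x. app M x = Some (g' x)"
    "\<And>x y w. ev (case_nat y (case_nat x (\<lambda>_. k)))
      (Ap (Ap (Ap (Con z) (Ap (Con l) (Var 1))) (Var 1)) (Var 0)) = Some w \<Longrightarrow> app (g' x) y = Some w"
    using comb2 by blast
  show thesis
  proof (rule that)
    fix xs ys assume *: "set xs \<subseteq> A" "set ys \<subseteq> B"
    show "ap app (app M (code xs)) (Some (code ys)) = Some (code (concat (map (\<lambda>x. f x ys) xs)))"
      using rec[of "length xs" xs ys] * by (simp add: M(1) l z F, intro M(2)) (simp add: l z F)
  qed
qed

text \<open>All entries of \<open>H m\<close> are treated with one common parameter
  \<open>G m\<close>. The parameter is there so that entries can themselves be programs that are run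
  on the same argument, as in \<open>comp_run\<close>.\<close>

lemma comp_mapcat:
  assumes e: "\<And>x ys. x \<in> A \<Longrightarrow> set ys \<subseteq> B \<Longrightarrow> ap app (app e x) (Some (code ys)) = Some (code (f x ys))"
    and G: "comp D G" "\<And>m. set m \<subseteq> D \<Longrightarrow> set (G m) \<subseteq> B"
    and H: "comp D H" "\<And>m. set m \<subseteq> D \<Longrightarrow> set (H m) \<subseteq> A"
  shows "comp D (\<lambda>m. concat (map (\<lambda>x. f x (G m)) (H m)))"
proof -
  obtain M where M: "\<And>xs ys. set xs \<subseteq> A \<Longrightarrow> set ys \<subseteq> B \<Longrightarrow>
    ap app (app M (code xs)) (Some (code ys)) = Some (code (concat (map (\<lambda>x. f x ys) xs)))"
    using mapcat_combinator[OF e] by blast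
  obtain g where g: "\<And>m. set m \<subseteq> D \<Longrightarrow> app g (code m) = Some (code (G m))"
    using G comp_def by auto
  obtain h where h: "\<And>m. set m \<subseteq> D \<Longrightarrow> app h (code m) = Some (code (H m))"
    using H comp_def by auto
  obtain c where c: "\<And>x w. ev (case_nat x (\<lambda>_. k))
      (Ap (Ap (Con M) (Ap (Con h) (Var 0))) (Ap (Con g) (Var 0))) = Some w \<Longrightarrow> app c x = Some w"
    using comb1 by blast
  show ?thesis
    unfolding comp_def by (rule exI[of _ c]) (auto simp: g h M G H intro!: c)
qed

text \<open>Tags \<open>\<lambda>f g. f x\<close> and \<open>\<lambda>f g. g x\<close>: applied to two continuations, a tagged element selects one.\<close>

definition inl :: "'p \<Rightarrow> 'p" where
  "inl = (SOME i. (\<exists>c. \<forall>x. app c x = Some (i x)) \<and>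
     (\<forall>x f g w. app f x = Some w \<longrightarrow> ap app (app (i x) f) (Some g) = Some w))"

definition inr :: "'p \<Rightarrow> 'p" where
  "inr = (SOME i. (\<exists>c. \<forall>x. app c x = Some (i x)) \<and>
     (\<forall>x f g w. app g x = Some w \<longrightarrow> ap app (app (i x) f) (Some g) = Some w))"

lemma inl: "\<exists>c. \<forall>x. app c x = Some (inl x)"
  "app f x = Some w \<Longrightarrow> ap app (app (inl x) f) (Some g) = Some w"
proof -
  obtain c i h where "\<And>x. app c x = Some (i x)" "\<And>x y. app (i x) y = Some (h x y)"
    "\<And>x y z w. ev (case_nat z (case_nat y (case_nat x (\<lambda>_. k)))) (Ap (Var 1) (Var 2)) = Some w
      \<Longrightarrow> app (h x y) z = Some w"
    using comb3[where t = "Ap (Var 1) (Var 2)" and \<rho> = "\<lambda>_. k"] by blast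
  then have "\<exists>i. (\<exists>c. \<forall>x. app c x = Some (i x)) \<and>
     (\<forall>x f g w. app f x = Some w \<longrightarrow> ap app (app (i x) f) (Some g) = Some w)"
    by (intro exI[of _ i]) (auto simp: eval_nat_numeral)
  from someI_ex[OF this, folded inl_def]
  show "\<exists>c. \<forall>x. app c x = Some (inl x)"
    "app f x = Some w \<Longrightarrow> ap app (app (inl x) f) (Some g) = Some w"
    by blast+
qed

lemma inr: "\<exists>c. \<forall>x. app c x = Some (inr x)"
  "app g x = Some w \<Longrightarrow> ap app (app (inr x) f) (Some g) = Some w"
proof -
  obtain c i h where "\<And>x. app c x = Some (i x)" "\<And>x y. app (i x) y = Some (h x y)"
    "\<And>x y z w. ev (case_nat z (case_nat y (case_nat x (\<lambda>_. k)))) (Ap (Var 0) (Var 2)) = Some w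
      \<Longrightarrow> app (h x y) z = Some w"
    using comb3[where t = "Ap (Var 0) (Var 2)" and \<rho> = "\<lambda>_. k"] by blast
  then have "\<exists>i. (\<exists>c. \<forall>x. app c x = Some (i x)) \<and>
     (\<forall>x f g w. app g x = Some w \<longrightarrow> ap app (app (i x) f) (Some g) = Some w)"
    by (intro exI[of _ i]) (auto simp: eval_nat_numeral)
  from someI_ex[OF this, folded inr_def]
  show "\<exists>c. \<forall>x. app c x = Some (inr x)"
    "app g x = Some w \<Longrightarrow> ap app (app (inr x) f) (Some g) = Some w"
    by blast+
qed

section \<open>Tagged lists as pairs of lists\<close>

lemma inl_eq [simp]: "inl x = inl y \<longleftrightarrow> x = y"
  by (metis inl(2) comb_i option.inject)

lemma inr_eq [simp]: "inr x = inr y \<longleftrightarrow> x = y"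
  by (metis inr(2) comb_i option.inject)

text \<open>Given the constant functions with values \<open>a\<close> and \<open>b\<close> as
  continuations, in this order, a left tag returns \<open>a\<close> and a right tag returns
  \<open>b\<close>. Two distinct elements of the algebra therefore keep the tags apart.\<close>

lemma inl_neq_inr [simp]: "inl x \<noteq> inr y"
proof
  assume eq: "inl x = inr y"
  obtain a b :: 'p where ab: "a \<noteq> b"
    using nontrivial by auto
  obtain ka where ka: "\<And>u. app ka u = Some a"
    using k_total by blast
  obtain kb where kb: "\<And>u. app kb u = Some b"
    using k_total by blast
  show False
    using inl(2)[OF ka, of x kb] inr(2)[OF kb, of y ka] unfolding eq using ab by simp
qed

lemma inr_neq_inl [simp]: "inr y \<noteq> inl x"
  using inl_neq_inr by metis

text \<open>The base of products, coproducts and exponentials alike: a list over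
  \<open>tag A B\<close> carries a list over \<open>A\<close> and a list over \<open>B\<close>, and
  how the two are interleaved is forgotten by \<open>lefts\<close> and
  \<open>rights\<close>.\<close>

definition tag :: "'p set \<Rightarrow> 'p set \<Rightarrow> 'p set" where
  "tag A B = inl ` A \<union> inr ` B"

text \<open>Written as a concatenation of lists with at most one entry, which is the form that
  \<open>comp_concat_map\<close> can compute.\<close>

definition lefts :: "'p list \<Rightarrow> 'p list" where
  "lefts xs = concat (map (\<lambda>y. if y \<in> range inl then [inv inl y] else []) xs)"

definition rights :: "'p list \<Rightarrow> 'p list" where
  "rights xs = concat (map (\<lambda>y. if y \<in> range inr then [inv inr y] else []) xs)"

lemma inv_inl [simp]: "inv inl (inl x) = x"
  by (simp add: inj_def)

lemma inv_inr [simp]: "inv inr (inr x) = x"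
  by (simp add: inj_def)

lemma set_lefts: "set (lefts xs) = {x. inl x \<in> set xs}"
  by (induction xs) (auto simp: lefts_def)

lemma set_rights: "set (rights xs) = {x. inr x \<in> set xs}"
  by (induction xs) (auto simp: rights_def)

lemma lefts_append [simp]: "lefts (xs @ ys) = lefts xs @ lefts ys"
  by (simp add: lefts_def)

lemma rights_append [simp]: "rights (xs @ ys) = rights xs @ rights ys"
  by (simp add: rights_def)

lemma lefts_map [simp]: "lefts (map inl xs) = xs" "lefts (map inr xs) = []"
  by (induction xs) (auto simp: lefts_def)

lemma rights_map [simp]: "rights (map inr xs) = xs" "rights (map inl xs) = []"
  by (induction xs) (auto simp: rights_def)

lemma set_lefts_tag: "set xs \<subseteq> tag A B \<Longrightarrow> set (lefts xs) \<subseteq> A"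
  unfolding set_lefts tag_def by auto

lemma set_rights_tag: "set xs \<subseteq> tag A B \<Longrightarrow> set (rights xs) \<subseteq> B"
  unfolding set_rights tag_def by auto

lemma lefts_mono: "set xs \<subseteq> set ys \<Longrightarrow> set (lefts xs) \<subseteq> set (lefts ys)"
  by (auto simp: set_lefts)

lemma rights_mono: "set xs \<subseteq> set ys \<Longrightarrow> set (rights xs) \<subseteq> set (rights ys)"
  by (auto simp: set_rights)

lemma set_tag: "set xs \<subseteq> A \<Longrightarrow> set ys \<subseteq> B \<Longrightarrow> set (map inl xs @ map inr ys) \<subseteq> tag A B"
  by (auto simp: tag_def)

lemma comp_concat_map:
  assumes e: "\<And>x. x \<in> A \<Longrightarrow> app e x = Some (code (f x))"
    and H: "comp D H" "\<And>m. set m \<subseteq> D \<Longrightarrow> set (H m) \<subseteq> A"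
  shows "comp D (\<lambda>m. concat (map f (H m)))"
proof -
  obtain c g where c: "\<And>x. app c x = Some (g x)"
    "\<And>x y w. ev (case_nat y (case_nat x (\<lambda>_. k))) (Ap (Con e) (Var 1)) = Some w
      \<Longrightarrow> app (g x) y = Some w"
    using comb2[where t = "Ap (Con e) (Var 1)" and \<rho> = "\<lambda>_. k"] by blast
  have "ap app (app c x) (Some (code ys)) = Some (code (f x))" if "x \<in> A" for x ys
    using that by (auto simp: c(1) e intro!: c(2))
  from comp_mapcat[where f = "\<lambda>x _. f x", OF this comp_const _ H] show ?thesis
    by blast
qed

lemma comp_map:
  assumes g: "\<exists>c. \<forall>x. app c x = Some (g x)" and H: "comp D H"
  shows "comp D (\<lambda>m. map g (H m))"
proof -
  obtain c where c: "\<And>x. app c x = Some (g x)"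
    using g by blast
  obtain e where e: "\<And>x. app e x = Some (code [x])"
    using code_singleton by blast
  obtain d where d: "\<And>x w. ev (case_nat x (\<lambda>_. k)) (Ap (Con e) (Ap (Con c) (Var 0))) = Some w
      \<Longrightarrow> app d x = Some w"
    using comb1 by blast
  have "app d x = Some (code [g x])" for x
    by (rule d) (simp add: c e)
  from comp_concat_map[OF this H(1), of UNIV] show ?thesis
    by simp
qed

text \<open>A tagged entry makes the case distinction itself: it is applied to the singleton program
  and to the constant program with value the empty sequence. Its behaviour is known for tagged
  elements only, hence the base \<open>tag A B\<close>.\<close>

lemma comp_lefts: "comp (tag A B) lefts"
proof -
  obtain e where e: "\<And>x. app e x = Some (code [x])"
    using code_singleton by blast
  obtain n where n: "\<And>x. app n x = Some (code [])"
    using k_total by blast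
  obtain d where d: "\<And>x w. ev (case_nat x (\<lambda>_. k)) (Ap (Ap (Var 0) (Con e)) (Con n)) = Some w
      \<Longrightarrow> app d x = Some w"
    using comb1 by blast
  have "app d y = Some (code (if y \<in> range inl then [inv inl y] else []))" if "y \<in> tag A B" for y
    using that by (auto simp: tag_def inl(2)[OF e] inr(2)[OF n] intro!: d)
  from comp_concat_map[OF this comp_id, of "tag A B"] show ?thesis
    by (simp add: lefts_def[abs_def])
qed

lemma comp_rights: "comp (tag A B) rights"
proof -
  obtain e where e: "\<And>x. app e x = Some (code [x])"
    using code_singleton by blast
  obtain n where n: "\<And>x. app n x = Some (code [])"
    using k_total by blast
  obtain d where d: "\<And>x w. ev (case_nat x (\<lambda>_. k)) (Ap (Ap (Var 0) (Con n)) (Con e)) = Some w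
      \<Longrightarrow> app d x = Some w"
    using comb1 by blast
  have "app d y = Some (code (if y \<in> range inr then [inv inr y] else []))" if "y \<in> tag A B" for y
    using that by (auto simp: tag_def inl(2)[OF n] inr(2)[OF e] intro!: d)
  from comp_concat_map[OF this comp_id, of "tag A B"] show ?thesis
    by (simp add: rights_def[abs_def])
qed

lemma comp_tag:
  assumes "comp D F" "comp D G"
  shows "comp D (\<lambda>m. map inl (F m) @ map inr (G m))"
  using assms by (intro comp_append comp_map inl(1) inr(1))

text \<open>The value is arbitrary where \<open>n\<close> does not return the code of a list; for
  members of \<open>total A B\<close> and arguments over \<open>A\<close> this does not
  happen.\<close>

definition run :: "'p \<Rightarrow> 'p list \<Rightarrow> 'p list" where
  "run n ys = inv code (the (app n (code ys)))"

lemma run: "app n (code ys) = Some (code zs) \<Longrightarrow> run n ys = zs"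
  by (simp add: run_def code_inj)

text \<open>This is the totality clause of a tracking, without any condition on realizers.
  Membership is all that is asked of a program in a list of programs: it guarantees that the others
  in the list are not spoilt by it.\<close>

definition total :: "'p set \<Rightarrow> 'p set \<Rightarrow> 'p set" where
  "total A B = {n. \<forall>ys. set ys \<subseteq> A \<longrightarrow> (\<exists>zs. set zs \<subseteq> B \<and> app n (code ys) = Some (code zs))}"

lemma total_run:
  assumes "n \<in> total A B" "set ys \<subseteq> A"
  shows "set (run n ys) \<subseteq> B" "app n (code ys) = Some (code (run n ys))"
  using assms run by (fastforce simp: total_def)+

lemma comp_run:
  assumes G: "comp D G" "\<And>m. set m \<subseteq> D \<Longrightarrow> set (G m) \<subseteq> A"
    and H: "comp D H" "\<And>m. set m \<subseteq> D \<Longrightarrow> set (H m) \<subseteq> total A B"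
  shows "comp D (\<lambda>m. concat (map (\<lambda>n. run n (G m)) (H m)))"
proof (rule comp_mapcat[OF _ G H])
  fix n ys assume "n \<in> total A B" "set ys \<subseteq> A"
  \<comment> \<open>The identity is the entrywise operation here: an entry is the program to be
    applied.\<close>
  then show "ap app (app comb_i n) (Some (code ys)) = Some (code (run n ys))"
    using total_run(2) by simp
qed

text \<open>The s-m-n property for lists. The program \<open>c xs\<close> is a partial application
  of a fixed combinator to the code of \<open>xs\<close>, so forming it always halts, whatever
  \<open>F\<close> does. It is delivered as a singleton list in order to be the output of a
  computable function on lists.\<close>

lemma comp_curry:
  assumes F: "comp (tag A B) F"
  obtains c where "comp A (\<lambda>xs. [c xs])"
    "\<And>xs ys. set xs \<subseteq> A \<Longrightarrow> set ys \<subseteq> B \<Longrightarrow>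
      app (c xs) (code ys) = Some (code (F (map inl xs @ map inr ys)))"
proof -
  obtain f where f: "\<And>m. set m \<subseteq> tag A B \<Longrightarrow> app f (code m) = Some (code (F m))"
    using F comp_def by auto
  obtain l where l: "\<And>xs. app l (code xs) = Some (code (map inl xs))"
    using comp_map[OF inl(1) comp_id, of UNIV] by (auto simp: comp_def)
  obtain r where r: "\<And>xs. app r (code xs) = Some (code (map inr xs))"
    using comp_map[OF inr(1) comp_id, of UNIV] by (auto simp: comp_def)
  obtain a where a: "\<And>xs ys. ap app (app a (code xs)) (Some (code ys)) = Some (code (xs @ ys))"
    using code_append by auto
  obtain e where e: "\<And>x. app e x = Some (code [x])"
    using code_singleton by blast
  obtain c g where c: "\<And>x. app c x = Some (g x)"
    "\<And>x y w. ev (case_nat y (case_nat x (\<lambda>_. k)))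
        (Ap (Con f) (Ap (Ap (Con a) (Ap (Con l) (Var 1))) (Ap (Con r) (Var 0)))) = Some w
      \<Longrightarrow> app (g x) y = Some w"
    using comb2[where t = "Ap (Con f) (Ap (Ap (Con a) (Ap (Con l) (Var 1))) (Ap (Con r) (Var 0)))"
        and \<rho> = "\<lambda>_. k"] by blast
  obtain d where d: "\<And>x w. ev (case_nat x (\<lambda>_. k)) (Ap (Con e) (Ap (Con c) (Var 0))) = Some w
      \<Longrightarrow> app d x = Some w"
    using comb1 by blast
  show thesis
  proof (rule that[of "\<lambda>xs. g (code xs)"])
    show "comp A (\<lambda>xs. [g (code xs)])"
      unfolding comp_def by (rule exI[of _ d]) (auto simp: c e intro!: d)
    fix xs ys assume "set xs \<subseteq> A" "set ys \<subseteq> B"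
    then show "app (g (code xs)) (code ys) = Some (code (F (map inl xs @ map inr ys)))"
      using f[OF set_tag] by (intro c(2)) (simp add: l r a)
  qed
qed

text \<open>Church numerals, a second system beside \<open>num\<close>: a numeral performs its own
  recursion when it is given a program and a starting value. The choice fixes the sequence together
  with the existence of a successor program.\<close>

definition church :: "nat \<Rightarrow> 'p" where
  "church = (SOME c. (\<exists>t. \<forall>n. app t (c n) = Some (c (Suc n))) \<and>
     (\<forall>f x. ap app (app (c 0) f) (Some x) = Some x) \<and>
     (\<forall>n f x y w. ap app (app (c n) f) (Some x) = Some y \<and> app f y = Some w \<longrightarrow>
        ap app (app (c (Suc n)) f) (Some x) = Some w))"

lemma church: "\<exists>t. \<forall>n. app t (church n) = Some (church (Suc n))"
  "ap app (app (church 0) f) (Some x) = Some x"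
  "ap app (app (church n) f) (Some x) = Some y \<Longrightarrow> app f y = Some w \<Longrightarrow>
     ap app (app (church (Suc n)) f) (Some x) = Some w"
proof -
  obtain c0 g0 where c0: "\<And>x. app c0 x = Some (g0 x)" "\<And>x y. app (g0 x) y = Some y"
    using comb2[where t = "Var 0" and \<rho> = "\<lambda>_. k"] by (metis ev.simps(1) old.nat.simps(4))
  obtain t g h where t: "\<And>c. app t c = Some (g c)" "\<And>c f. app (g c) f = Some (h c f)"
    "\<And>c f x w. ev (case_nat x (case_nat f (case_nat c (\<lambda>_. k))))
        (Ap (Var 1) (Ap (Ap (Var 2) (Var 1)) (Var 0))) = Some w
      \<Longrightarrow> app (h c f) x = Some w"
    using comb3[where t = "Ap (Var 1) (Ap (Ap (Var 2) (Var 1)) (Var 0))" and \<rho> = "\<lambda>_. k"] by blast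
  define c where "c = rec_nat c0 (\<lambda>_. g)"
  have "ap app (app (c (Suc n)) f) (Some x) = Some w"
    if "ap app (app (c n) f) (Some x) = Some y" "app f y = Some w" for n f x y w
  proof -
    have "app (h (c n) f) x = Some w"
      by (rule t(3)) (use that in \<open>simp add: eval_nat_numeral\<close>)
    then show ?thesis
      by (simp add: c_def t)
  qed
  moreover have "\<forall>n. app t (c n) = Some (c (Suc n))"
    by (simp add: c_def t)
  moreover have "\<forall>f x. ap app (app (c 0) f) (Some x) = Some x"
    by (simp add: c_def c0)
  ultimately have "\<exists>c. (\<exists>t. \<forall>n. app t (c n) = Some (c (Suc n))) \<and>
     (\<forall>f x. ap app (app (c 0) f) (Some x) = Some x) \<and>
     (\<forall>n f x y w. ap app (app (c n) f) (Some x) = Some y \<and> app f y = Some w \<longrightarrow>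
        ap app (app (c (Suc n)) f) (Some x) = Some w)"
    by blast
  from someI_ex[OF this, folded church_def]
  show "\<exists>t. \<forall>n. app t (church n) = Some (church (Suc n))"
    "ap app (app (church 0) f) (Some x) = Some x"
    "ap app (app (church n) f) (Some x) = Some y \<Longrightarrow> app f y = Some w \<Longrightarrow>
     ap app (app (church (Suc n)) f) (Some x) = Some w"
    by blast+
qed

text \<open>A numeral is applied to a program for \<open>F\<close> and to the code of
  \<open>x\<close>; the iterates stay over \<open>A\<close>, so every call is defined. Reading
  \<open>it\<close> off from this run, and not from the number, makes it a function of the numeral
  itself.\<close>

lemma comp_iterate:
  assumes F: "comp A F" "\<And>xs. set xs \<subseteq> A \<Longrightarrow> set (F xs) \<subseteq> A" and x: "set x \<subseteq> A"
  obtains it where "comp (range church) (\<lambda>m. concat (map it m))" "\<And>n. it (church n) = (F ^^ n) x"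
proof -
  obtain f where f: "\<And>m. set m \<subseteq> A \<Longrightarrow> app f (code m) = Some (code (F m))"
    using F comp_def by auto
  have sub: "set ((F ^^ n) x) \<subseteq> A" for n
    by (induction n) (auto simp: x dest!: F(2))
  have iter: "ap app (app (church n) f) (Some (code x)) = Some (code ((F ^^ n) x))" for n
  proof (induction n)
    case 0
    show ?case by (simp add: church)
  next
    case (Suc n)
    show ?case
      using church(3)[OF Suc f[OF sub]] by simp
  qed
  define it where "it c = inv code (the (ap app (app c f) (Some (code x))))" for c
  have it: "it (church n) = (F ^^ n) x" for n
    by (simp add: it_def iter code_inj)
  obtain d where d: "\<And>y w. ev (case_nat y (\<lambda>_. k)) (Ap (Ap (Var 0) (Con f)) (Con (code x))) = Some w
      \<Longrightarrow> app d y = Some w"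
    using comb1 by blast
  have "app d c = Some (code (it c))" if "c \<in> range church" for c
    using that by (auto simp: it iter intro!: d)
  then have "comp (range church) (\<lambda>m. concat (map it m))"
    using comp_concat_map[OF _ comp_id] by blast
  then show thesis
    using that it by blast
qed

end

section \<open>Limits and stable colimits of finite graphs\<close>

text \<open>Cones only involve the sources and targets of the arrows of the shape, never its
  identities and composites. With a bare graph as the shape, edges can be added one at a time, and
  parallel pairs need not be completed to a category.\<close>

definition graph_cone where
  "graph_cone C I E s t Fo Fa L \<pi> \<longleftrightarrow> L \<in> Obj C \<and> (\<forall>i\<in>I. \<pi> i \<in> hom C L (Fo i)) \<and>
     (\<forall>u\<in>E. Cmp C (Fa u) (\<pi> (s u)) = \<pi> (t u))"

definition graph_limit where
  "graph_limit C I E s t Fo Fa L \<pi> \<longleftrightarrow> graph_cone C I E s t Fo Fa L \<pi> \<and>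
     (\<forall>X \<xi>. graph_cone C I E s t Fo Fa X \<xi> \<longrightarrow>
        (\<exists>!h. h \<in> hom C X L \<and> (\<forall>i\<in>I. Cmp C (\<pi> i) h = \<xi> i)))"

definition opp :: "('o, 'm) cat \<Rightarrow> ('o, 'm) cat" where
  "opp C = C\<lparr>Src := Tgt C, Tgt := Src C, Cmp := (\<lambda>g f. Cmp C f g)\<rparr>"

definition has_products :: "('o, 'm) cat \<Rightarrow> bool" where
  "has_products C \<longleftrightarrow> (\<forall>X\<in>Obj C. \<forall>Y\<in>Obj C. \<exists>P p q. is_product C X Y P p q)"

definition has_equalizers :: "('o, 'm) cat \<Rightarrow> bool" where
  "has_equalizers C \<longleftrightarrow> (\<forall>X Y. \<forall>f\<in>hom C X Y. \<forall>g\<in>hom C X Y.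
     \<exists>E. \<exists>e\<in>hom C E X. Cmp C f e = Cmp C g e \<and>
       (\<forall>Z. \<forall>h\<in>hom C Z X. Cmp C f h = Cmp C g h \<longrightarrow> (\<exists>!u. u \<in> hom C Z E \<and> Cmp C e u = h)))"

definition has_pullbacks :: "('o, 'm) cat \<Rightarrow> bool" where
  "has_pullbacks C \<longleftrightarrow> (\<forall>X Y S. \<forall>f\<in>hom C X S. \<forall>g\<in>hom C Y S. \<exists>P p q. is_pullback C f g P p q)"

text \<open>In the opposite category each edge runs backwards, hence \<open>t\<close> stands in the
  place of the source map.\<close>

abbreviation graph_colimit where
  "graph_colimit C I E s t \<equiv> graph_limit (opp C) I E t s"

abbreviation graph_cocone where
  "graph_cocone C I E s t \<equiv> graph_cone (opp C) I E t s"

lemma opp_simps [simp]: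
  "Obj (opp C) = Obj C" "Arr (opp C) = Arr C" "Src (opp C) = Tgt C" "Tgt (opp C) = Src C"
  "Ide (opp C) = Ide C" "Cmp (opp C) g f = Cmp C f g" "hom (opp C) X Y = hom C Y X"
  by (auto simp: opp_def hom_def)

lemma is_limit_graph_limit:
  "is_limit J C Fo Fa = graph_limit C (Obj J) (Arr J) (Src J) (Tgt J) Fo Fa"
  by (intro ext) (simp add: is_limit_def is_cone_def graph_limit_def graph_cone_def)

lemma is_colimit_graph_colimit:
  "is_colimit J C Fo Fa = graph_colimit C (Obj J) (Arr J) (Src J) (Tgt J) Fo Fa"
  by (intro ext) (simp add: is_colimit_def is_cocone_def graph_limit_def graph_cone_def)

lemma graph_limit_obtain:
  assumes "graph_limit C I E s t Fo Fa L \<pi>" "graph_cone C I E s t Fo Fa X \<xi>"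
  obtains h where "h \<in> hom C X L" "\<And>i. i \<in> I \<Longrightarrow> Cmp C (\<pi> i) h = \<xi> i"
    "\<And>h'. h' \<in> hom C X L \<Longrightarrow> (\<And>i. i \<in> I \<Longrightarrow> Cmp C (\<pi> i) h' = \<xi> i) \<Longrightarrow> h' = h"
proof -
  have "\<exists>!h. h \<in> hom C X L \<and> (\<forall>i\<in>I. Cmp C (\<pi> i) h = \<xi> i)"
    using assms by (simp add: graph_limit_def)
  then show thesis
    using that by (elim ex1E) blast
qed

lemma graph_limitD:
  assumes "graph_limit C I E s t Fo Fa L \<pi>"
  shows "L \<in> Obj C" "i \<in> I \<Longrightarrow> \<pi> i \<in> hom C L (Fo i)" "u \<in> E \<Longrightarrow> Cmp C (Fa u) (\<pi> (s u)) = \<pi> (t u)"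
    "graph_cone C I E s t Fo Fa L \<pi>"
  using assms by (simp_all add: graph_limit_def graph_cone_def)

lemma graph_limitI:
  assumes "graph_cone C I E s t Fo Fa L \<pi>"
    "\<And>X \<xi>. graph_cone C I E s t Fo Fa X \<xi> \<Longrightarrow> \<exists>!h. h \<in> hom C X L \<and> (\<forall>i\<in>I. Cmp C (\<pi> i) h = \<xi> i)"
  shows "graph_limit C I E s t Fo Fa L \<pi>"
  unfolding graph_limit_def using assms by (intro conjI allI impI)

lemma is_product_obtain:
  assumes "is_product C X Y P p q" "f \<in> hom C Z X" "g \<in> hom C Z Y"
  obtains h where "h \<in> hom C Z P" "Cmp C p h = f" "Cmp C q h = g"
    "\<And>h'. h' \<in> hom C Z P \<Longrightarrow> Cmp C p h' = f \<Longrightarrow> Cmp C q h' = g \<Longrightarrow> h' = h"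
proof -
  have "\<exists>!h. h \<in> hom C Z P \<and> Cmp C p h = f \<and> Cmp C q h = g"
    using assms by (simp add: is_product_def)
  then show thesis
    using that by (elim ex1E) blast
qed

lemma is_productD:
  assumes "is_product C X Y P p q"
  shows "X \<in> Obj C" "Y \<in> Obj C" "P \<in> Obj C" "p \<in> hom C P X" "q \<in> hom C P Y"
  using assms by (simp_all add: is_product_def)

lemma is_pullback_obtain:
  assumes "is_pullback C f g P p q" "f \<in> hom C X S" "g \<in> hom C Y S"
    "a \<in> hom C Z X" "b \<in> hom C Z Y" "Cmp C f a = Cmp C g b"
  obtains h where "h \<in> hom C Z P" "Cmp C p h = a" "Cmp C q h = b"
    "\<And>h'. h' \<in> hom C Z P \<Longrightarrow> Cmp C p h' = a \<Longrightarrow> Cmp C q h' = b \<Longrightarrow> h' = h"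
proof -
  have "Src C f = X" "Src C g = Y"
    using assms by (simp_all add: hom_def)
  then have "\<exists>!h. h \<in> hom C Z P \<and> Cmp C p h = a \<and> Cmp C q h = b"
    using assms(1,4,5,6) by (simp add: is_pullback_def)
  then show thesis
    using that by (elim ex1E) blast
qed

lemma is_pullbackD:
  assumes "is_pullback C f g P p q" "f \<in> hom C X S" "g \<in> hom C Y S'"
  shows "P \<in> Obj C" "p \<in> hom C P X" "q \<in> hom C P Y" "Cmp C f p = Cmp C g q" "S' = S"
  using assms by (auto simp: is_pullback_def hom_def)

lemma is_pullbackI:
  assumes "f \<in> hom C X S" "g \<in> hom C Y S" "P \<in> Obj C" "p \<in> hom C P X" "q \<in> hom C P Y"
    "Cmp C f p = Cmp C g q"
    "\<And>Z a b. a \<in> hom C Z X \<Longrightarrow> b \<in> hom C Z Y \<Longrightarrow> Cmp C f a = Cmp C g b \<Longrightarrow>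
       \<exists>h. h \<in> hom C Z P \<and> Cmp C p h = a \<and> Cmp C q h = b"
    "\<And>Z h h'. h \<in> hom C Z P \<Longrightarrow> h' \<in> hom C Z P \<Longrightarrow> Cmp C p h = Cmp C p h' \<Longrightarrow>
       Cmp C q h = Cmp C q h' \<Longrightarrow> h = h'"
  shows "is_pullback C f g P p q"
proof -
  have "\<exists>!h. h \<in> hom C Z P \<and> Cmp C p h = a \<and> Cmp C q h = b"
    if "a \<in> hom C Z X" "b \<in> hom C Z Y" "Cmp C f a = Cmp C g b" for Z a b
    using assms(7)[OF that] assms(8) by (metis (no_types, lifting))
  then show ?thesis
    using assms(1-6) unfolding is_pullback_def by (simp add: hom_def)
qed

lemma has_equalizers_obtain:
  assumes "has_equalizers C" "f \<in> hom C X Y" "g \<in> hom C X Y"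
  obtains E e where "e \<in> hom C E X" "Cmp C f e = Cmp C g e"
    "\<And>Z h. h \<in> hom C Z X \<Longrightarrow> Cmp C f h = Cmp C g h \<Longrightarrow> \<exists>!u. u \<in> hom C Z E \<and> Cmp C e u = h"
proof -
  obtain E where "\<exists>e\<in>hom C E X. Cmp C f e = Cmp C g e \<and>
       (\<forall>Z. \<forall>h\<in>hom C Z X. Cmp C f h = Cmp C g h \<longrightarrow> (\<exists>!u. u \<in> hom C Z E \<and> Cmp C e u = h))"
    using assms unfolding has_equalizers_def by force
  then show thesis
    by (elim bexE conjE) (rule that, assumption, assumption, simp)
qed

context category
begin

lemma hom_obj: "f \<in> hom C X Y \<Longrightarrow> X \<in> Obj C" "f \<in> hom C X Y \<Longrightarrow> Y \<in> Obj C"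
  by (auto simp: hom_def src_obj tgt_obj)

lemma category_opp: "category (opp C)"
  by unfold_locales
    (auto simp: src_obj tgt_obj ide_hom cmp_hom ide_left ide_right cmp_assoc)

section \<open>Finite limits from finite products and equalizers\<close>

lemma finite_graph_product:
  assumes "is_terminal C T" "has_products C" "finite I" "\<And>i. i \<in> I \<Longrightarrow> Fo i \<in> Obj C"
  shows "\<exists>L \<pi>. graph_limit C I {} s t Fo Fa L \<pi>"
  using assms(3,4)
proof (induction I)
  case empty
  have "graph_limit C {} {} s t Fo Fa T \<pi>" for \<pi>
    using assms(1) by (simp add: graph_limit_def graph_cone_def is_terminal_def)
  then show ?case
    by blast
next
  case (insert i I)
  then obtain L \<pi> where lim: "graph_limit C I {} s t Fo Fa L \<pi>"
    by auto
  note L = graph_limitD[OF lim]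
  obtain P p q where P: "is_product C L (Fo i) P p q"
    using assms(2) L(1) insert.prems unfolding has_products_def by blast
  note p = is_productD(3-5)[OF P]
  define \<pi>' where "\<pi>' j = (if j = i then q else \<pi> j \<cdot> p)" for j
  have \<pi>': "\<pi>' i = q" "\<And>j. j \<in> I \<Longrightarrow> \<pi>' j = \<pi> j \<cdot> p"
    using insert.hyps(2) by (auto simp: \<pi>'_def)
  have hom: "\<pi>' j \<in> hom C P (Fo j)" if "j \<in> insert i I" for j
    using that p L(2) cmp_hom by (auto simp: \<pi>'_def)
  have "\<exists>!h. h \<in> hom C X P \<and> (\<forall>j\<in>insert i I. \<pi>' j \<cdot> h = \<xi> j)"
    if "graph_cone C (insert i I) {} s t Fo Fa X \<xi>" for X \<xi>
  proof -
    have \<xi>: "\<xi> i \<in> hom C X (Fo i)" "graph_cone C I {} s t Fo Fa X \<xi>"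
      using that by (simp_all add: graph_cone_def)
    obtain h0 where h0: "h0 \<in> hom C X L" "\<And>j. j \<in> I \<Longrightarrow> \<pi> j \<cdot> h0 = \<xi> j"
      and h0_un: "\<And>h. h \<in> hom C X L \<Longrightarrow> (\<And>j. j \<in> I \<Longrightarrow> \<pi> j \<cdot> h = \<xi> j) \<Longrightarrow> h = h0"
      using graph_limit_obtain[OF lim \<xi>(2)] by blast
    obtain h where h: "h \<in> hom C X P" "p \<cdot> h = h0" "q \<cdot> h = \<xi> i"
      and h_un: "\<And>h'. h' \<in> hom C X P \<Longrightarrow> p \<cdot> h' = h0 \<Longrightarrow> q \<cdot> h' = \<xi> i \<Longrightarrow> h' = h"
      using is_product_obtain[OF P h0(1) \<xi>(1)] by blast
    have assoc: "\<pi>' j \<cdot> h' = \<pi> j \<cdot> (p \<cdot> h')" if "j \<in> I" "h' \<in> hom C X P" for j h'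
      using cmp_assoc[OF that(2) p(2) L(2)[OF that(1)]] \<pi>'(2)[OF that(1)] by simp
    show ?thesis
    proof (rule ex1I[of _ h])
      show "h \<in> hom C X P \<and> (\<forall>j\<in>insert i I. \<pi>' j \<cdot> h = \<xi> j)"
        using h h0 assoc \<pi>'(1) by auto
      fix h' assume h': "h' \<in> hom C X P \<and> (\<forall>j\<in>insert i I. \<pi>' j \<cdot> h' = \<xi> j)"
      have "p \<cdot> h' = h0"
      proof (rule h0_un)
        show "p \<cdot> h' \<in> hom C X L"
          using h' p(2) cmp_hom by blast
        show "\<pi> j \<cdot> (p \<cdot> h') = \<xi> j" if "j \<in> I" for j
          using h' assoc[OF that] that by auto
      qed
      then show "h' = h"
        using h' h_un \<pi>'(1) by auto
    qed
  qed
  then have "graph_limit C (insert i I) {} s t Fo Fa P \<pi>'"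
    using hom p(1) by (intro graph_limitI) (simp_all add: graph_cone_def)
  then show ?case
    by blast
qed

text \<open>An additional edge \<open>u\<close> imposes one more equation on cones. The new limit is
  therefore the equalizer, on the old limit, of \<open>Fa u \<cdot> \<pi> (s u)\<close> and
  \<open>\<pi> (t u)\<close>; the induction starts from the product of all vertices.\<close>

lemma finite_graph_limit:
  assumes "is_terminal C T" "has_products C" "has_equalizers C" "finite I" "finite E"
    "\<And>i. i \<in> I \<Longrightarrow> Fo i \<in> Obj C"
    "\<And>u. u \<in> E \<Longrightarrow> s u \<in> I \<and> t u \<in> I \<and> Fa u \<in> hom C (Fo (s u)) (Fo (t u))"
  shows "\<exists>L \<pi>. graph_limit C I E s t Fo Fa L \<pi>"
  using assms(5,7)
proof (induction E)
  case empty
  show ?case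
    by (rule finite_graph_product[OF assms(1,2,4,6)])
next
  case (insert u E)
  from insert.IH[OF insert.prems] obtain L \<pi> where lim: "graph_limit C I E s t Fo Fa L \<pi>"
    by blast
  note L = graph_limitD[OF lim]
  have u: "s u \<in> I" "t u \<in> I" "Fa u \<in> hom C (Fo (s u)) (Fo (t u))"
    using insert.prems[of u] by auto
  obtain M e where e: "e \<in> hom C M L" "Fa u \<cdot> \<pi> (s u) \<cdot> e = \<pi> (t u) \<cdot> e"
    "\<And>Z h. h \<in> hom C Z L \<Longrightarrow> Fa u \<cdot> \<pi> (s u) \<cdot> h = \<pi> (t u) \<cdot> h \<Longrightarrow> (\<exists>!w. w \<in> hom C Z M \<and> e \<cdot> w = h)"
    by (rule has_equalizers_obtain[OF assms(3) cmp_hom[OF L(2)[OF u(1)] u(3)] L(2)[OF u(2)]], rule that)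
  define \<pi>' where "\<pi>' j = \<pi> j \<cdot> e" for j
  have assoc: "\<pi>' j \<cdot> h = \<pi> j \<cdot> (e \<cdot> h)" if "j \<in> I" "h \<in> hom C X M" for j h X
    using cmp_assoc[OF that(2) e(1) L(2)[OF that(1)]] by (simp add: \<pi>'_def)
  have sv: "s v \<in> I" "Fa v \<in> hom C (Fo (s v)) (Fo (t v))" if "v \<in> insert u E" for v
    using insert.prems that by auto
  have "Fa v \<cdot> \<pi>' (s v) = \<pi>' (t v)" if "v \<in> insert u E" for v
    using cmp_assoc[OF e(1) L(2)[OF sv(1)[OF that]] sv(2)[OF that]] e(2) L(3) that
    by (auto simp: \<pi>'_def)
  then have cone: "graph_cone C I (insert u E) s t Fo Fa M \<pi>'"
    using hom_obj(1)[OF e(1)] L(2) cmp_hom[OF e(1)] by (auto simp: graph_cone_def \<pi>'_def)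
  have "\<exists>!h. h \<in> hom C X M \<and> (\<forall>j\<in>I. \<pi>' j \<cdot> h = \<xi> j)"
    if "graph_cone C I (insert u E) s t Fo Fa X \<xi>" for X \<xi>
  proof -
    have \<xi>: "graph_cone C I E s t Fo Fa X \<xi>" "Fa u \<cdot> \<xi> (s u) = \<xi> (t u)"
      using that by (auto simp: graph_cone_def)
    obtain h0 where h0: "h0 \<in> hom C X L" "\<And>j. j \<in> I \<Longrightarrow> \<pi> j \<cdot> h0 = \<xi> j"
      and h0_un: "\<And>h. h \<in> hom C X L \<Longrightarrow> (\<And>j. j \<in> I \<Longrightarrow> \<pi> j \<cdot> h = \<xi> j) \<Longrightarrow> h = h0"
      using graph_limit_obtain[OF lim \<xi>(1)] by blast
    have "Fa u \<cdot> \<pi> (s u) \<cdot> h0 = \<pi> (t u) \<cdot> h0"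
      using cmp_assoc[OF h0(1) L(2)[OF u(1)] u(3)] h0(2) u \<xi>(2) by simp
    from e(3)[OF h0(1) this] obtain h where h: "h \<in> hom C X M" "e \<cdot> h = h0"
      and h_un: "\<And>h'. h' \<in> hom C X M \<Longrightarrow> e \<cdot> h' = h0 \<Longrightarrow> h' = h"
      by blast
    show ?thesis
    proof (rule ex1I[of _ h])
      show "h \<in> hom C X M \<and> (\<forall>j\<in>I. \<pi>' j \<cdot> h = \<xi> j)"
        using h h0 assoc by auto
      fix h' assume h': "h' \<in> hom C X M \<and> (\<forall>j\<in>I. \<pi>' j \<cdot> h' = \<xi> j)"
      have "e \<cdot> h' = h0"
      proof (rule h0_un)
        show "e \<cdot> h' \<in> hom C X L"
          using h' e(1) cmp_hom by blast
        show "\<pi> j \<cdot> (e \<cdot> h') = \<xi> j" if "j \<in> I" for j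
          using h' assoc[OF that] that by auto
      qed
      then show "h' = h"
        using h' h_un by blast
    qed
  qed
  then have "graph_limit C I (insert u E) s t Fo Fa M \<pi>'"
    using cone by (rule graph_limitI[rotated])
  then show ?case
    by blast
qed

lemma has_finite_limitsI:
  assumes "is_terminal C T" "has_products C" "has_equalizers C"
  shows "has_finite_limits C"
  unfolding has_finite_limits_def is_limit_graph_limit
proof (intro allI impI)
  fix J Fo Fa assume J: "finite_cat J \<and> is_functor J C Fo Fa"
  then interpret J: category J
    by (simp add: finite_cat_def)
  show "\<exists>L. Ex (graph_limit C (Obj J) (Arr J) (Src J) (Tgt J) Fo Fa L)"
    by (rule finite_graph_limit[OF assms])
      (use J in \<open>auto simp: finite_cat_def is_functor_def J.src_obj J.tgt_obj\<close>)
qed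

lemma has_finite_colimitsI:
  assumes "is_terminal (opp C) T" "has_products (opp C)" "has_equalizers (opp C)"
  shows "has_finite_colimits C"
  unfolding has_finite_colimits_def is_colimit_graph_colimit
proof (intro allI impI)
  fix J Fo Fa assume J: "finite_cat J \<and> is_functor J C Fo Fa"
  then interpret J: category J
    by (simp add: finite_cat_def)
  show "\<exists>L. Ex (graph_colimit C (Obj J) (Arr J) (Src J) (Tgt J) Fo Fa L)"
    by (rule category.finite_graph_limit[OF category_opp assms])
      (use J in \<open>auto simp: finite_cat_def is_functor_def J.src_obj J.tgt_obj\<close>)
qed

lemma is_pullback_sym:
  assumes "is_pullback C f g P p q"
  shows "is_pullback C g f P q p"
proof -
  have hom: "f \<in> hom C (Src C f) (Tgt C f)" "g \<in> hom C (Src C g) (Tgt C f)"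
    using assms by (auto simp: is_pullback_def hom_def)
  note D = is_pullbackD[OF assms hom]
  show ?thesis
  proof (rule is_pullbackI[OF hom(2,1) D(1,3,2) D(4)[symmetric]])
    fix Z a b assume ab: "a \<in> hom C Z (Src C g)" "b \<in> hom C Z (Src C f)" "g \<cdot> a = f \<cdot> b"
    then show "\<exists>h. h \<in> hom C Z P \<and> q \<cdot> h = a \<and> p \<cdot> h = b"
      using is_pullback_obtain[OF assms hom ab(2,1)] by metis
  next
    fix Z h h' assume h: "h \<in> hom C Z P" "h' \<in> hom C Z P" "q \<cdot> h = q \<cdot> h'" "p \<cdot> h = p \<cdot> h'"
    have "f \<cdot> (p \<cdot> h) = g \<cdot> (q \<cdot> h)"
      using cmp_assoc[OF h(1) D(2) hom(1)] cmp_assoc[OF h(1) D(3) hom(2)] D(4) by simp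
    then show "h = h'"
      using is_pullback_obtain[OF assms hom cmp_hom[OF h(1) D(2)] cmp_hom[OF h(1) D(3)]] h by metis
  qed
qed

lemma cmp_cmp:
  "f \<in> hom C W X \<Longrightarrow> g \<in> hom C X Y \<Longrightarrow> h \<in> hom C Y Z \<Longrightarrow> h \<cdot> g \<cdot> f = h \<cdot> (g \<cdot> f)"
  by (simp add: cmp_assoc)

lemma is_pullback_unique:
  assumes "is_pullback C f g P p q" "h \<in> hom C Z P" "h' \<in> hom C Z P" "p \<cdot> h = p \<cdot> h'" "q \<cdot> h = q \<cdot> h'"
  shows "h = h'"
proof -
  have hom: "f \<in> hom C (Src C f) (Tgt C f)" "g \<in> hom C (Src C g) (Tgt C f)"
    using assms by (auto simp: is_pullback_def hom_def)
  note D = is_pullbackD[OF assms(1) hom]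
  have "f \<cdot> (p \<cdot> h) = g \<cdot> (q \<cdot> h)"
    using cmp_assoc[OF assms(2) D(2) hom(1)] cmp_assoc[OF assms(2) D(3) hom(2)] D(4) by simp
  then show ?thesis
    using is_pullback_obtain[OF assms(1) hom cmp_hom[OF assms(2) D(2)] cmp_hom[OF assms(2) D(3)]]
      assms by metis
qed

text \<open>It presents the source of \<open>f\<close> as the pullback of \<open>f\<close> along an
  identity. Arrows over \<open>S\<close> out of that source can then be transposed to sections of a
  local exponential.\<close>

lemma is_pullback_ide:
  assumes f: "f \<in> hom C X S"
  shows "is_pullback C (Ide C S) f X f (Ide C X)"
proof -
  note X = hom_obj[OF f]
  show ?thesis
  proof (rule is_pullbackI[OF ide_hom f X(1) f ide_hom])
    show "Ide C S \<cdot> f = f \<cdot> Ide C X"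
      using ide_left[OF f] ide_right[OF f] by simp
    fix Z a b assume "a \<in> hom C Z S" "b \<in> hom C Z X" "Ide C S \<cdot> a = f \<cdot> b"
    then show "\<exists>h. h \<in> hom C Z X \<and> f \<cdot> h = a \<and> Ide C X \<cdot> h = b"
      using ide_left by auto
  next
    fix Z h h' assume "h \<in> hom C Z X" "h' \<in> hom C Z X" "Ide C X \<cdot> h = Ide C X \<cdot> h'"
    then show "h = h'"
      using ide_left by metis
  qed (rule X)+
qed

end

text \<open>The arrow \<open>h\<close> over \<open>S\<close> is the transpose of \<open>c\<close>, where \<open>P\<close> and \<open>Q\<close> are pullbacks along the same arrow
  into \<open>S\<close>, and \<open>u\<close> is the arrow between them induced by \<open>h\<close>.\<close>

definition transposes where
  "transposes C E e P p q ev Z z Q a b c h \<longleftrightarrow> h \<in> hom C Z E \<and> Cmp C e h = z \<and>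
     (\<exists>u\<in>hom C Q P. Cmp C p u = Cmp C h a \<and> Cmp C q u = b \<and> Cmp C ev u = c)"

text \<open>The exponential of \<open>g\<close> by \<open>f\<close> in the slice over
  \<open>S\<close>, expressed by pullbacks in \<open>C\<close> itself, so that neither the stability
  argument nor the construction for assemblies has to handle the triples of a slice. The pullback
  \<open>Q\<close> is arbitrary, because a given diagram may come with its own choice of
  pullbacks.\<close>

definition is_local_exp where
  "is_local_exp C S f B g E e P p q ev \<longleftrightarrow>
     e \<in> hom C E S \<and> is_pullback C e f P p q \<and> ev \<in> hom C P B \<and> Cmp C g ev = Cmp C e p \<and>
     (\<forall>Z z Q a b c. z \<in> hom C Z S \<and> is_pullback C z f Q a b \<and> c \<in> hom C Q B \<and>
        Cmp C g c = Cmp C z a \<longrightarrow> (\<exists>!h. transposes C E e P p q ev Z z Q a b c h))"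

definition has_local_exps :: "('o, 'm) cat \<Rightarrow> bool" where
  "has_local_exps C \<longleftrightarrow> (\<forall>S A B. \<forall>f\<in>hom C A S. \<forall>g\<in>hom C B S.
     \<exists>E e P p q ev. is_local_exp C S f B g E e P p q ev)"

lemma is_local_exp_obtain:
  assumes "is_local_exp C S f B g E e P p q ev" "z \<in> hom C Z S" "is_pullback C z f Q a b"
    "c \<in> hom C Q B" "Cmp C g c = Cmp C z a"
  obtains h where "transposes C E e P p q ev Z z Q a b c h"
    "\<And>h'. transposes C E e P p q ev Z z Q a b c h' \<Longrightarrow> h' = h"
proof -
  have "\<exists>!h. transposes C E e P p q ev Z z Q a b c h"
    using assms by (simp add: is_local_exp_def)
  then show thesis
    using that by (elim ex1E) blast
qed

section \<open>Stability of colimits\<close>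

context category
begin

text \<open>Over \<open>L\<close>, the exponential \<open>E\<close> of \<open>L \<times> X\<close>
  by \<open>f\<close> is the dependent product along \<open>f\<close> of the constant family
  \<open>X\<close> over \<open>Y\<close>. As \<open>Go i\<close> is the pullback of
  \<open>\<iota> i\<close> along \<open>f\<close>, arrows from \<open>Go i\<close> to
  \<open>X\<close> amount to arrows over \<open>L\<close> from \<open>Fo i\<close> to
  \<open>E\<close>, and arrows from \<open>Y\<close> to \<open>X\<close> amount to sections of
  \<open>e\<close>.\<close>

lemma graph_colimit_stable:
  assumes exps: "has_local_exps C" and prods: "has_products C"
    and colim: "graph_colimit C I D s t Fo Fa L \<iota>"
    and f: "f \<in> hom C Y L"
    and cocone: "graph_cocone C I D s t Go Ga Y \<kappa>"
    and st: "\<And>u. u \<in> D \<Longrightarrow> s u \<in> I" "\<And>u. u \<in> D \<Longrightarrow> t u \<in> I"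
    and Fa: "\<And>u. u \<in> D \<Longrightarrow> Fa u \<in> hom C (Fo (s u)) (Fo (t u))"
    and Ga: "\<And>u. u \<in> D \<Longrightarrow> Ga u \<in> hom C (Go (s u)) (Go (t u))"
    and \<phi>: "\<And>i. i \<in> I \<Longrightarrow> \<phi> i \<in> hom C (Go i) (Fo i)"
    and nat: "\<And>u. u \<in> D \<Longrightarrow> \<phi> (t u) \<cdot> Ga u = Fa u \<cdot> \<phi> (s u)"
    and pb: "\<And>i. i \<in> I \<Longrightarrow> is_pullback C f (\<iota> i) (Go i) (\<kappa> i) (\<phi> i)"
  shows "graph_colimit C I D s t Go Ga Y \<kappa>"
proof (rule graph_limitI[OF cocone])
  fix X \<xi> assume \<xi>_cocone: "graph_cocone C I D s t Go Ga X \<xi>"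
  then have \<xi>: "X \<in> Obj C" "\<And>i. i \<in> I \<Longrightarrow> \<xi> i \<in> hom C (Go i) X"
    "\<And>u. u \<in> D \<Longrightarrow> \<xi> (t u) \<cdot> Ga u = \<xi> (s u)"
    by (simp_all add: graph_cone_def)
  have \<kappa>: "\<And>i. i \<in> I \<Longrightarrow> \<kappa> i \<in> hom C (Go i) Y" "\<And>u. u \<in> D \<Longrightarrow> \<kappa> (t u) \<cdot> Ga u = \<kappa> (s u)"
    using cocone by (simp_all add: graph_cone_def)
  have \<iota>: "L \<in> Obj C" "\<And>i. i \<in> I \<Longrightarrow> \<iota> i \<in> hom C (Fo i) L" "\<And>u. u \<in> D \<Longrightarrow> \<iota> (t u) \<cdot> Fa u = \<iota> (s u)"
    using graph_limitD[OF colim] by simp_all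
  \<comment> \<open>Lying over \<open>L\<close> by \<open>m1\<close>, the product \<open>M\<close>
    makes an arrow over \<open>L\<close> into it the same thing as an arrow into
    \<open>X\<close>.\<close>
  obtain M m1 m2 where M: "is_product C L X M m1 m2"
    using prods \<iota>(1) \<xi>(1) unfolding has_products_def by blast
  note m = is_productD(4,5)[OF M]
  obtain E e P p q ev where exp: "is_local_exp C L f M m1 E e P p q ev"
    using exps f m(1) unfolding has_local_exps_def by meson
  have e: "e \<in> hom C E L" and P: "is_pullback C e f P p q" and ev: "ev \<in> hom C P M" "m1 \<cdot> ev = e \<cdot> p"
    using exp by (simp_all add: is_local_exp_def)
  have pq: "p \<in> hom C P E" "q \<in> hom C P Y"
    using is_pullbackD[OF P e f] by auto
  have sq: "f \<cdot> \<kappa> i = \<iota> i \<cdot> \<phi> i" if "i \<in> I" for i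
    using is_pullbackD(4)[OF pb[OF that] f \<iota>(2)[OF that]] .
  have "\<exists>c. c \<in> hom C (Go i) M \<and> m1 \<cdot> c = \<iota> i \<cdot> \<phi> i \<and> m2 \<cdot> c = \<xi> i" if "i \<in> I" for i
    using is_product_obtain[OF M cmp_hom[OF \<phi>[OF that] \<iota>(2)[OF that]] \<xi>(2)[OF that]] by metis
  then obtain c where c: "\<And>i. i \<in> I \<Longrightarrow> c i \<in> hom C (Go i) M"
    "\<And>i. i \<in> I \<Longrightarrow> m1 \<cdot> c i = \<iota> i \<cdot> \<phi> i" "\<And>i. i \<in> I \<Longrightarrow> m2 \<cdot> c i = \<xi> i"
    by metis
  let ?tr = "\<lambda>i. transposes C E e P p q ev (Fo i) (\<iota> i) (Go i) (\<phi> i) (\<kappa> i) (c i)"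
  have "\<exists>h. ?tr i h \<and> (\<forall>h'. ?tr i h' \<longrightarrow> h' = h)" if "i \<in> I" for i
    using is_local_exp_obtain[OF exp \<iota>(2)[OF that] is_pullback_sym[OF pb[OF that]] c(1,2)[OF that]]
    by metis
  then obtain h where h: "\<And>i. i \<in> I \<Longrightarrow> ?tr i (h i)" "\<And>i h'. i \<in> I \<Longrightarrow> ?tr i h' \<Longrightarrow> h' = h i"
    by metis
  have "\<exists>u. u \<in> hom C (Go i) P \<and> p \<cdot> u = h i \<cdot> \<phi> i \<and> q \<cdot> u = \<kappa> i \<and> ev \<cdot> u = c i" if "i \<in> I" for i
    using h(1)[OF that] by (auto simp: transposes_def)
  then obtain u where u: "\<And>i. i \<in> I \<Longrightarrow> u i \<in> hom C (Go i) P" "\<And>i. i \<in> I \<Longrightarrow> p \<cdot> u i = h i \<cdot> \<phi> i"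
    "\<And>i. i \<in> I \<Longrightarrow> q \<cdot> u i = \<kappa> i" "\<And>i. i \<in> I \<Longrightarrow> ev \<cdot> u i = c i"
    by metis
  have h_hom: "h i \<in> hom C (Fo i) E" "e \<cdot> h i = \<iota> i" if "i \<in> I" for i
    using h(1)[OF that] by (auto simp: transposes_def)
  \<comment> \<open>Transposes are unique, and \<open>h (t v) \<cdot> Fa v\<close> is also one of
    \<open>c (s v)\<close>; the induced arrow between the pullbacks is
    \<open>u (t v) \<cdot> Ga v\<close>.\<close>
  have h_compat: "h (t v) \<cdot> Fa v = h (s v)" if v: "v \<in> D" for v
  proof (rule h(2)[OF st(1)[OF v]])
    note st' = st[OF v]
    note i = Fa[OF v] Ga[OF v] \<phi>[OF st'(1)] \<phi>[OF st'(2)] h_hom[OF st'(2)] u(1)[OF st'(2)] c(1)[OF st'(2)] c(1)[OF st'(1)]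
    have "c (t v) \<cdot> Ga v = c (s v)"
    proof -
      have "m1 \<cdot> (c (t v) \<cdot> Ga v) = \<iota> (t v) \<cdot> (\<phi> (t v) \<cdot> Ga v)"
        using cmp_assoc[OF i(2,8) m(1)] c(2)[OF st'(2)] cmp_cmp[OF i(2,4) \<iota>(2)[OF st'(2)]] by simp
      also have "\<dots> = \<iota> (s v) \<cdot> \<phi> (s v)"
        using nat[OF v] cmp_assoc[OF i(3,1) \<iota>(2)[OF st'(2)]] \<iota>(3)[OF v] by simp
      finally have 1: "m1 \<cdot> (c (t v) \<cdot> Ga v) = \<iota> (s v) \<cdot> \<phi> (s v)" .
      have 2: "m2 \<cdot> (c (t v) \<cdot> Ga v) = \<xi> (s v)"
        using cmp_assoc[OF i(2,8) m(2)] c(3)[OF st'(2)] \<xi>(3)[OF v] by simp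
      show ?thesis
        using is_product_obtain[OF M cmp_hom[OF i(3) \<iota>(2)[OF st'(1)]] \<xi>(2)[OF st'(1)]]
          1 2 cmp_hom[OF i(2,8)] i(9) c(2,3)[OF st'(1)] by metis
    qed
    then have "ev \<cdot> (u (t v) \<cdot> Ga v) = c (s v)"
      using cmp_assoc[OF i(2,7) ev(1)] u(4)[OF st'(2)] by simp
    moreover have "q \<cdot> (u (t v) \<cdot> Ga v) = \<kappa> (s v)"
      using cmp_assoc[OF i(2,7) pq(2)] u(3)[OF st'(2)] \<kappa>(2)[OF v] by simp
    moreover have "p \<cdot> (u (t v) \<cdot> Ga v) = h (t v) \<cdot> Fa v \<cdot> \<phi> (s v)"
      using cmp_assoc[OF i(2,7) pq(1)] u(2)[OF st'(2)] cmp_cmp[OF i(2,4,5)] nat[OF v]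
        cmp_assoc[OF i(3,1,5)] by simp
    moreover have "e \<cdot> (h (t v) \<cdot> Fa v) = \<iota> (s v)"
      using cmp_assoc[OF i(1,5) e] i(6) \<iota>(3)[OF v] by simp
    ultimately show "?tr (s v) (h (t v) \<cdot> Fa v)"
      unfolding transposes_def using cmp_hom[OF i(2,7)] cmp_hom[OF i(1,5)] by blast
  qed
  have "graph_cocone C I D s t Fo Fa E h"
    using h_hom(1) h_compat hom_obj(1)[OF e] by (simp add: graph_cone_def)
  from graph_limit_obtain[OF colim this] obtain H where H: "H \<in> hom C L E" "\<And>i. i \<in> I \<Longrightarrow> H \<cdot> \<iota> i = h i"
    and H_un: "\<And>H'. H' \<in> hom C L E \<Longrightarrow> (\<And>i. i \<in> I \<Longrightarrow> H' \<cdot> \<iota> i = h i) \<Longrightarrow> H' = H"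
    by auto
  \<comment> \<open>Both \<open>e \<cdot> H\<close> and the identity are mediating arrows from the
    colimiting cocone to itself, so \<open>H\<close> is a section of \<open>e\<close>.\<close>
  have eH: "e \<cdot> H = Ide C L"
  proof -
    obtain J where "J \<in> hom C L L" "\<And>i. i \<in> I \<Longrightarrow> J \<cdot> \<iota> i = \<iota> i"
      and J: "\<And>h'. h' \<in> hom C L L \<Longrightarrow> (\<And>i. i \<in> I \<Longrightarrow> h' \<cdot> \<iota> i = \<iota> i) \<Longrightarrow> h' = J"
      by (rule graph_limit_obtain[OF colim graph_limitD(4)[OF colim], unfolded opp_simps], rule that) blast+
    have "e \<cdot> H = J"
      using cmp_cmp[OF \<iota>(2) H(1) e] H(2) h_hom(2) by (intro J cmp_hom[OF H(1) e]) simp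
    moreover have "Ide C L = J"
      using \<iota>(1,2) by (intro J ide_hom ide_left)
    ultimately show ?thesis by simp
  qed
  have Y: "Ide C Y \<in> hom C Y Y"
    using hom_obj[OF f] ide_hom by blast
  have "e \<cdot> (H \<cdot> f) = f \<cdot> Ide C Y"
    using cmp_assoc[OF f H(1) e] eH ide_left[OF f] ide_right[OF f] by simp
  \<comment> \<open>\<open>W\<close> puts the section \<open>H\<close> and the identity of
    \<open>Y\<close> together; evaluating along it and projecting by \<open>m2\<close> turns the
    section back into an arrow from \<open>Y\<close> to \<open>X\<close>.\<close>
  from is_pullback_obtain[OF P e f cmp_hom[OF f H(1)] Y this] obtain W where
    W: "W \<in> hom C Y P" "p \<cdot> W = H \<cdot> f" "q \<cdot> W = Ide C Y"
    by blast
  show "\<exists>!k. k \<in> hom (opp C) X Y \<and> (\<forall>i\<in>I. Cmp (opp C) (\<kappa> i) k = \<xi> i)"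
    unfolding opp_simps
  proof (rule ex1I[of _ "m2 \<cdot> (ev \<cdot> W)"])
    have evW: "ev \<cdot> W \<in> hom C Y M"
      using W(1) ev(1) cmp_hom by blast
    have "m2 \<cdot> (ev \<cdot> W) \<cdot> \<kappa> i = \<xi> i" if i: "i \<in> I" for i
    proof -
      have "p \<cdot> (W \<cdot> \<kappa> i) = H \<cdot> (\<iota> i \<cdot> \<phi> i)"
        using cmp_assoc[OF \<kappa>(1)[OF i] W(1) pq(1)] W(2) cmp_cmp[OF \<kappa>(1)[OF i] f H(1)] sq[OF i] by simp
      also have "\<dots> = p \<cdot> u i"
        using cmp_assoc[OF \<phi>[OF i] \<iota>(2)[OF i] H(1)] H(2)[OF i] u(2)[OF i] by simp
      finally have 1: "p \<cdot> (W \<cdot> \<kappa> i) = p \<cdot> u i" .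
      have "q \<cdot> (W \<cdot> \<kappa> i) = q \<cdot> u i"
        using cmp_assoc[OF \<kappa>(1)[OF i] W(1) pq(2)] W(3) ide_left[OF \<kappa>(1)[OF i]] u(3)[OF i] by simp
      then have "W \<cdot> \<kappa> i = u i"
        using is_pullback_unique[OF P cmp_hom[OF \<kappa>(1)[OF i] W(1)] u(1)[OF i] 1] by blast
      then show ?thesis
        using cmp_cmp[OF \<kappa>(1)[OF i] evW m(2)] cmp_cmp[OF \<kappa>(1)[OF i] W(1) ev(1)] u(4)[OF i] c(3)[OF i] by simp
    qed
    then show "m2 \<cdot> (ev \<cdot> W) \<in> hom C Y X \<and> (\<forall>i\<in>I. m2 \<cdot> (ev \<cdot> W) \<cdot> \<kappa> i = \<xi> i)"
      using cmp_hom[OF evW m(2)] by blast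
  next
    fix k assume "k \<in> hom C Y X \<and> (\<forall>i\<in>I. k \<cdot> \<kappa> i = \<xi> i)"
    then have k: "k \<in> hom C Y X" "\<And>i. i \<in> I \<Longrightarrow> k \<cdot> \<kappa> i = \<xi> i"
      by auto
    \<comment> \<open>For uniqueness, a competing \<open>k\<close> is paired with \<open>f\<close>
      to an arrow over \<open>L\<close> and transposed to a section \<open>H'\<close>. This section
      restricts to the same cocone as \<open>H\<close>, and once the two agree, evaluation gives
      \<open>k\<close> back.\<close>
    obtain c' where c': "c' \<in> hom C Y M" "m1 \<cdot> c' = f" "m2 \<cdot> c' = k"
      using is_product_obtain[OF M f k(1)] by blast
    have "m1 \<cdot> c' = Ide C L \<cdot> f"
      using c'(2) ide_left[OF f] by simp
    from is_local_exp_obtain[OF exp ide_hom[OF \<iota>(1)] is_pullback_ide[OF f] c'(1) this]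
    obtain H' where "transposes C E e P p q ev L (Ide C L) Y f (Ide C Y) c' H'"
      by blast
    then obtain W' where H': "H' \<in> hom C L E" "e \<cdot> H' = Ide C L"
      and W': "W' \<in> hom C Y P" "p \<cdot> W' = H' \<cdot> f" "q \<cdot> W' = Ide C Y" "ev \<cdot> W' = c'"
      by (auto simp: transposes_def)
    have "H' = H"
    proof (rule H_un[OF H'(1)], rule h(2))
      fix i assume i: "i \<in> I"
      have "c' \<cdot> \<kappa> i = c i"
      proof -
        have 1: "m1 \<cdot> (c' \<cdot> \<kappa> i) = \<iota> i \<cdot> \<phi> i"
          using cmp_assoc[OF \<kappa>(1)[OF i] c'(1) m(1)] c'(2) sq[OF i] by simp
        have 2: "m2 \<cdot> (c' \<cdot> \<kappa> i) = \<xi> i"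
          using cmp_assoc[OF \<kappa>(1)[OF i] c'(1) m(2)] c'(3) k(2)[OF i] by simp
        show ?thesis
          using is_product_obtain[OF M cmp_hom[OF \<phi>[OF i] \<iota>(2)[OF i]] \<xi>(2)[OF i]]
            1 2 cmp_hom[OF \<kappa>(1)[OF i] c'(1)] c[OF i] by metis
      qed
      then have "ev \<cdot> (W' \<cdot> \<kappa> i) = c i"
        using cmp_assoc[OF \<kappa>(1)[OF i] W'(1) ev(1)] W'(4) by simp
      moreover have "q \<cdot> (W' \<cdot> \<kappa> i) = \<kappa> i"
        using cmp_assoc[OF \<kappa>(1)[OF i] W'(1) pq(2)] W'(3) ide_left[OF \<kappa>(1)[OF i]] by simp
      moreover have "p \<cdot> (W' \<cdot> \<kappa> i) = H' \<cdot> \<iota> i \<cdot> \<phi> i"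
        using cmp_assoc[OF \<kappa>(1)[OF i] W'(1) pq(1)] W'(2) cmp_cmp[OF \<kappa>(1)[OF i] f H'(1)] sq[OF i]
          cmp_assoc[OF \<phi>[OF i] \<iota>(2)[OF i] H'(1)] by simp
      moreover have "e \<cdot> (H' \<cdot> \<iota> i) = \<iota> i"
        using cmp_assoc[OF \<iota>(2)[OF i] H'(1) e] H'(2) ide_left[OF \<iota>(2)[OF i]] by simp
      ultimately show "?tr i (H' \<cdot> \<iota> i)"
        unfolding transposes_def
        using cmp_hom[OF \<kappa>(1)[OF i] W'(1)] cmp_hom[OF \<iota>(2)[OF i] H'(1)] by blast
    qed
    then have "W' = W"
      using is_pullback_unique[OF P W'(1) W(1)] W W' by simp
    then show "k = m2 \<cdot> (ev \<cdot> W)"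
      using W'(4) c'(3) by simp
  qed
qed

lemma finite_colimits_stableI:
  assumes "has_local_exps C" "has_products C"
  shows "finite_colimits_stable C"
  unfolding finite_colimits_stable_def is_colimit_graph_colimit
proof (intro allI impI, elim conjE)
  fix J Fo Fa L \<iota> Y f Go Ga \<kappa> \<phi>
  assume *: "finite_cat J" "is_functor J C Fo Fa"
    "graph_colimit C (Obj J) (Arr J) (Src J) (Tgt J) Fo Fa L \<iota>" "f \<in> hom C Y L"
    "is_functor J C Go Ga" "is_cocone J C Go Ga Y \<kappa>" "is_nat_trans J C Go Ga Fo Fa \<phi>"
    "\<forall>i\<in>Obj J. is_pullback C f (\<iota> i) (Go i) (\<kappa> i) (\<phi> i)"
  interpret J: category J
    using *(1) by (simp add: finite_cat_def)
  show "graph_colimit C (Obj J) (Arr J) (Src J) (Tgt J) Go Ga Y \<kappa>"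
    by (rule graph_colimit_stable[OF assms *(3,4), where \<phi> = \<phi>])
      (use *(2,5-8) in \<open>auto simp: is_functor_def is_cocone_def graph_cone_def is_nat_trans_def
         J.src_obj J.tgt_obj\<close>)
qed

end

section \<open>Slices and regularity\<close>

lemma hom_slice:
  "u \<in> hom (slice C S) f g \<longleftrightarrow> (\<exists>h. u = (f, h, g) \<and> f \<in> Arr C \<and> Tgt C f = S \<and> g \<in> Arr C \<and>
     Tgt C g = S \<and> h \<in> hom C (Src C f) (Src C g) \<and> Cmp C g h = f)"
  by (cases u) (auto simp: slice_def hom_def)

lemma slice_simps:
  "f \<in> Obj (slice C S) \<longleftrightarrow> f \<in> Arr C \<and> Tgt C f = S"
  "Cmp (slice C S) (f, h', g') (f', h, g) = (f', Cmp C h' h, g')"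
  "Ide (slice C S) f = (f, Ide C (Src C f), f)"
  by (simp_all add: slice_def)

lemma hom_sliceI:
  "f \<in> hom C X S \<Longrightarrow> g \<in> hom C Y S \<Longrightarrow> h \<in> hom C X Y \<Longrightarrow> Cmp C g h = f \<Longrightarrow>
    (f, h, g) \<in> hom (slice C S) f g"
  by (simp add: slice_def hom_def)

lemma hom_slice_obtain:
  assumes "u \<in> hom (slice C S) f g"
  obtains h where "u = (f, h, g)" "f \<in> hom C (Src C f) S" "g \<in> hom C (Src C g) S"
    "h \<in> hom C (Src C f) (Src C g)" "Cmp C g h = f"
  using assms that by (cases u) (simp add: slice_def hom_def)

context category
begin

section \<open>Terminal object, products and exponentials of a slice\<close>

lemma category_slice: "category (slice C S)"
proof
  fix u assume "u \<in> Arr (slice C S)"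
  then show "Src (slice C S) u \<in> Obj (slice C S)" "Tgt (slice C S) u \<in> Obj (slice C S)"
    by (auto simp: slice_def)
next
  fix x assume "x \<in> Obj (slice C S)"
  then have x: "x \<in> hom C (Src C x) S" "x \<in> Arr C" "Tgt C x = S"
    by (auto simp: slice_def hom_def)
  have "Ide C (Src C x) \<in> hom C (Src C x) (Src C x)" "x \<cdot> Ide C (Src C x) = x"
    by (rule ide_hom[OF hom_obj(1)[OF x(1)]], rule ide_right[OF x(1)])
  then show "Ide (slice C S) x \<in> hom (slice C S) x x"
    unfolding hom_slice slice_simps(3) using x(2,3) by blast
next
  fix u v x y z assume u: "u \<in> hom (slice C S) x y" and v: "v \<in> hom (slice C S) y z"
  obtain h where h: "u = (x, h, y)" "x \<in> hom C (Src C x) S" "h \<in> hom C (Src C x) (Src C y)" "y \<cdot> h = x"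
    using u by (rule hom_slice_obtain)
  obtain h' where h': "v = (y, h', z)" "z \<in> hom C (Src C z) S" "h' \<in> hom C (Src C y) (Src C z)" "z \<cdot> h' = y"
    using v by (rule hom_slice_obtain)
  show "v \<cdot>\<^bsub>slice C S\<^esub> u \<in> hom (slice C S) x z"
    unfolding h(1) h'(1) slice_simps
    by (rule hom_sliceI[OF h(2) h'(2) cmp_hom[OF h(3) h'(3)]]) (simp only: cmp_assoc[OF h(3) h'(3,2)] h h')
next
  fix u x y assume "u \<in> hom (slice C S) x y"
  then show "Ide (slice C S) y \<cdot>\<^bsub>slice C S\<^esub> u = u" "u \<cdot>\<^bsub>slice C S\<^esub> Ide (slice C S) x = u"
    by (auto elim!: hom_slice_obtain simp: slice_simps ide_left ide_right)
next
  fix u v w x y z t assume u: "u \<in> hom (slice C S) x y" and v: "v \<in> hom (slice C S) y z" and w: "w \<in> hom (slice C S) z t"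
  obtain h where h: "u = (x, h, y)" "h \<in> hom C (Src C x) (Src C y)"
    using u by (rule hom_slice_obtain)
  obtain h' where h': "v = (y, h', z)" "h' \<in> hom C (Src C y) (Src C z)"
    using v by (rule hom_slice_obtain)
  obtain h'' where h'': "w = (z, h'', t)" "h'' \<in> hom C (Src C z) (Src C t)"
    using w by (rule hom_slice_obtain)
  show "w \<cdot>\<^bsub>slice C S\<^esub> (v \<cdot>\<^bsub>slice C S\<^esub> u) = w \<cdot>\<^bsub>slice C S\<^esub> v \<cdot>\<^bsub>slice C S\<^esub> u"
    unfolding h(1) h'(1) h''(1) slice_simps by (simp add: cmp_assoc[OF h(2) h'(2) h''(2)])
qed

lemma slice_terminal:
  assumes "S \<in> Obj C"
  shows "is_terminal (slice C S) (Ide C S)"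
  unfolding is_terminal_def
proof (intro conjI ballI)
  have i: "Ide C S \<in> hom C S S"
    using ide_hom[OF assms] .
  then show "Ide C S \<in> Obj (slice C S)"
    by (simp add: slice_simps hom_def)
  fix f assume "f \<in> Obj (slice C S)"
  then have f: "f \<in> hom C (Src C f) S"
    by (simp add: slice_simps hom_def)
  show "\<exists>!u. u \<in> hom (slice C S) f (Ide C S)"
  proof (rule ex1I[of _ "(f, f, Ide C S)"])
    show "(f, f, Ide C S) \<in> hom (slice C S) f (Ide C S)"
      using i f ide_left[OF f] by (simp add: hom_slice) (simp add: hom_def)
    fix u assume "u \<in> hom (slice C S) f (Ide C S)"
    then obtain h where h: "u = (f, h, Ide C S)" "h \<in> hom C (Src C f) (Src C (Ide C S))" "Ide C S \<cdot> h = f"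
      by (auto simp: hom_slice)
    then have "h \<in> hom C (Src C f) S"
      using i by (simp add: hom_def)
    then show "u = (f, f, Ide C S)"
      using h ide_left by simp
  qed
qed

lemma slice_product_of_pullback:
  assumes x: "x \<in> hom C X S" and y: "y \<in> hom C Y S" and pb: "is_pullback C x y P p q"
  shows "is_product (slice C S) x y (x \<cdot> p) (x \<cdot> p, p, x) (x \<cdot> p, q, y)"
proof -
  note P = is_pullbackD[OF pb x y]
  have r: "x \<cdot> p \<in> hom C P S"
    by (rule cmp_hom[OF P(2) x])
  have s: "Src C x = X" "Src C y = Y" "Tgt C x = S" "Tgt C y = S" "Src C (x \<cdot> p) = P" "Tgt C (x \<cdot> p) = S"
    "x \<in> Arr C" "y \<in> Arr C" "x \<cdot> p \<in> Arr C"
    using x y r by (simp_all add: hom_def)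
  have "\<exists>!h. h \<in> hom (slice C S) z (x \<cdot> p) \<and> (x \<cdot> p, p, x) \<cdot>\<^bsub>slice C S\<^esub> h = u \<and> (x \<cdot> p, q, y) \<cdot>\<^bsub>slice C S\<^esub> h = v"
    if u: "u \<in> hom (slice C S) z x" and v: "v \<in> hom (slice C S) z y" for z u v
  proof -
    obtain a where "u = (z, a, x)" "a \<in> hom C (Src C z) (Src C x)" "x \<cdot> a = z" and z: "z \<in> Arr C" "Tgt C z = S"
      using u unfolding hom_slice by blast
    then have a: "u = (z, a, x)" "a \<in> hom C (Src C z) X" "x \<cdot> a = z"
      using s(1) by simp_all
    obtain b where "v = (z, b, y)" "b \<in> hom C (Src C z) (Src C y)" "y \<cdot> b = z"
      using v unfolding hom_slice by blast
    then have b: "v = (z, b, y)" "b \<in> hom C (Src C z) Y" "y \<cdot> b = z"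
      using s(2) by simp_all
    have eq: "x \<cdot> a = y \<cdot> b"
      using a(3) b(3) by simp
    obtain h where h: "h \<in> hom C (Src C z) P" "p \<cdot> h = a" "q \<cdot> h = b"
      and h_un: "\<And>h'. h' \<in> hom C (Src C z) P \<Longrightarrow> p \<cdot> h' = a \<Longrightarrow> q \<cdot> h' = b \<Longrightarrow> h' = h"
      using is_pullback_obtain[OF pb x y a(2) b(2) eq] by metis
    show ?thesis
    proof (rule ex1I[of _ "(z, h, x \<cdot> p)"])
      show "(z, h, x \<cdot> p) \<in> hom (slice C S) z (x \<cdot> p) \<and> (x \<cdot> p, p, x) \<cdot>\<^bsub>slice C S\<^esub> (z, h, x \<cdot> p) = u \<and>
         (x \<cdot> p, q, y) \<cdot>\<^bsub>slice C S\<^esub> (z, h, x \<cdot> p) = v"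
        using h a b z s cmp_cmp[OF h(1) P(2) x] by (simp add: hom_slice slice_simps)
      fix h' assume "h' \<in> hom (slice C S) z (x \<cdot> p) \<and> (x \<cdot> p, p, x) \<cdot>\<^bsub>slice C S\<^esub> h' = u \<and>
        (x \<cdot> p, q, y) \<cdot>\<^bsub>slice C S\<^esub> h' = v"
      then have h': "h' \<in> hom (slice C S) z (x \<cdot> p)" "(x \<cdot> p, p, x) \<cdot>\<^bsub>slice C S\<^esub> h' = u"
        "(x \<cdot> p, q, y) \<cdot>\<^bsub>slice C S\<^esub> h' = v"
        by simp_all
      then obtain h0 where h0: "h' = (z, h0, x \<cdot> p)" "h0 \<in> hom C (Src C z) (Src C (x \<cdot> p))"
        unfolding hom_slice by blast
      then have "p \<cdot> h0 = a" "q \<cdot> h0 = b" "h0 \<in> hom C (Src C z) P"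
        using h'(2,3) a(1) b(1) s(5) by (simp_all add: slice_simps)
      with h0(1) show "h' = (z, h, x \<cdot> p)"
        using h_un by blast
    qed
  qed
  moreover have "(x \<cdot> p, p, x) \<in> hom (slice C S) (x \<cdot> p) x"
    using P(2) s by (simp add: hom_slice)
  moreover have "(x \<cdot> p, q, y) \<in> hom (slice C S) (x \<cdot> p) y"
    using P(3,4) s by (simp add: hom_slice)
  ultimately show ?thesis
    using s unfolding is_product_def by (simp add: slice_simps)
qed

text \<open>The universal property in \<open>is_exponential\<close> ranges over every product in the
  slice, including those that were not built from a pullback. This converse makes the universal
  property of \<open>is_local_exp\<close> available for all of them.\<close>

lemma pullback_of_slice_product:
  assumes pr: "is_product (slice C S) x y r p q"
  obtains p' q' where "p = (r, p', x)" "q = (r, q', y)" "x \<in> hom C (Src C x) S" "y \<in> hom C (Src C y) S"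
    "r \<in> hom C (Src C r) S" "is_pullback C x y (Src C r) p' q'" "x \<cdot> p' = r"
proof -
  note D = is_productD[OF pr]
  obtain p' where p: "p = (r, p', x)" "p' \<in> hom C (Src C r) (Src C x)" "x \<cdot> p' = r"
    using D(4) by (auto simp: hom_slice)
  obtain q' where q: "q = (r, q', y)" "q' \<in> hom C (Src C r) (Src C y)" "y \<cdot> q' = r"
    using D(5) by (auto simp: hom_slice)
  have x: "x \<in> hom C (Src C x) S" and y: "y \<in> hom C (Src C y) S" and r: "r \<in> hom C (Src C r) S"
    using D(1,2,3) by (auto simp: slice_simps hom_def)
  have s: "Tgt C x = S" "Tgt C y = S" "Tgt C r = S" "x \<in> Arr C" "y \<in> Arr C" "r \<in> Arr C"
    using x y r by (simp_all add: hom_def)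
  have "is_pullback C x y (Src C r) p' q'"
  proof (rule is_pullbackI[OF x y hom_obj(1)[OF r] p(2) q(2)])
    show "x \<cdot> p' = y \<cdot> q'"
      using p q by simp
    fix Z a b assume a: "a \<in> hom C Z (Src C x)" and b: "b \<in> hom C Z (Src C y)" and eq: "x \<cdot> a = y \<cdot> b"
    have z: "x \<cdot> a \<in> hom C Z S"
      by (rule cmp_hom[OF a x])
    then have zs: "Src C (x \<cdot> a) = Z" "Tgt C (x \<cdot> a) = S" "x \<cdot> a \<in> Arr C"
      by (simp_all add: hom_def)
    have "(x \<cdot> a, a, x) \<in> hom (slice C S) (x \<cdot> a) x" "(x \<cdot> a, b, y) \<in> hom (slice C S) (x \<cdot> a) y"
      using a b zs s eq by (simp_all add: hom_slice)
    from is_product_obtain[OF pr this] obtain h where h: "h \<in> hom (slice C S) (x \<cdot> a) r"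
      "p \<cdot>\<^bsub>slice C S\<^esub> h = (x \<cdot> a, a, x)" "q \<cdot>\<^bsub>slice C S\<^esub> h = (x \<cdot> a, b, y)"
      by blast
    obtain h0 where h0: "h = (x \<cdot> a, h0, r)" "h0 \<in> hom C (Src C (x \<cdot> a)) (Src C r)"
      using h(1) by (rule hom_slice_obtain)
    have "p' \<cdot> h0 = a" "q' \<cdot> h0 = b"
      using h(2,3) unfolding h0(1) p(1) q(1) slice_simps by simp_all
    then show "\<exists>h. h \<in> hom C Z (Src C r) \<and> p' \<cdot> h = a \<and> q' \<cdot> h = b"
      using h0(2) zs(1) by auto
  next
    fix Z h h' assume h: "h \<in> hom C Z (Src C r)" "h' \<in> hom C Z (Src C r)" "p' \<cdot> h = p' \<cdot> h'" "q' \<cdot> h = q' \<cdot> h'"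
    have z: "r \<cdot> h \<in> hom C Z S"
      by (rule cmp_hom[OF h(1) r])
    then have zs: "Src C (r \<cdot> h) = Z" "Tgt C (r \<cdot> h) = S" "r \<cdot> h \<in> Arr C"
      by (simp_all add: hom_def)
    have rh: "r \<cdot> h' = r \<cdot> h"
      using cmp_assoc[OF h(1) p(2) x] cmp_assoc[OF h(2) p(2) x] p(3) h(3) by simp
    have m: "(r \<cdot> h, h, r) \<in> hom (slice C S) (r \<cdot> h) r" "(r \<cdot> h, h', r) \<in> hom (slice C S) (r \<cdot> h) r"
      using h(1,2) zs s rh by (simp_all add: hom_slice)
    interpret sl: category "slice C S"
      by (rule category_slice)
    have "(r \<cdot> h, h, r) = (r \<cdot> h, h', r)"
      using is_product_obtain[OF pr sl.cmp_hom[OF m(1) D(4)] sl.cmp_hom[OF m(1) D(5)]] m h(3,4) p(1) q(1)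
      by (metis slice_simps(2))
    then show "h = h'" by simp
  qed
  with p q x y r show thesis
    using that by blast
qed

lemma slice_exponential:
  assumes x: "x \<in> hom C A S" and y: "y \<in> hom C B S" and exp: "is_local_exp C S x B y E e P p q ev"
  shows "is_exponential (slice C S) x y e (e \<cdot> p) (e \<cdot> p, p, e) (e \<cdot> p, q, x) (e \<cdot> p, ev, y)"
proof -
  have e: "e \<in> hom C E S" and P: "is_pullback C e x P p q" and ev: "ev \<in> hom C P B" "y \<cdot> ev = e \<cdot> p"
    using exp by (simp_all add: is_local_exp_def)
  note pq = is_pullbackD(2,3,4)[OF P e x]
  have r: "e \<cdot> p \<in> hom C P S"
    by (rule cmp_hom[OF pq(1) e])
  have s: "Src C x = A" "Src C y = B" "Tgt C x = S" "Tgt C y = S" "Src C (e \<cdot> p) = P" "Tgt C (e \<cdot> p) = S"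
    "x \<in> Arr C" "y \<in> Arr C" "e \<cdot> p \<in> Arr C" "e \<in> Arr C" "Src C e = E" "Tgt C e = S"
    using x y r e by (simp_all add: hom_def)
  have "\<exists>!h. h \<in> hom (slice C S) z e \<and> (\<exists>u\<in>hom (slice C S) r (e \<cdot> p).
      (e \<cdot> p, p, e) \<cdot>\<^bsub>slice C S\<^esub> u = h \<cdot>\<^bsub>slice C S\<^esub> a \<and> (e \<cdot> p, q, x) \<cdot>\<^bsub>slice C S\<^esub> u = b \<and>
      (e \<cdot> p, ev, y) \<cdot>\<^bsub>slice C S\<^esub> u = g)"
    if pr: "is_product (slice C S) z x r a b" and g: "g \<in> hom (slice C S) r y" for z r a b g
  proof -
    obtain a' b' where ab: "a = (r, a', z)" "b = (r, b', x)"
      and z: "z \<in> hom C (Src C z) S" and r: "r \<in> hom C (Src C r) S" 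
      and Q: "is_pullback C z x (Src C r) a' b'" "z \<cdot> a' = r"
      using pullback_of_slice_product[OF pr] by metis
    obtain c where c: "g = (r, c, y)" "c \<in> hom C (Src C r) B" "y \<cdot> c = r"
      using g s by (auto simp: hom_slice)
    have zr: "z \<in> Arr C" "Tgt C z = S" "r \<in> Arr C" "Tgt C r = S"
      using z r by (simp_all add: hom_def)
    have a': "a' \<in> hom C (Src C r) (Src C z)"
      using is_pullbackD[OF Q(1) z x] by simp
    \<comment> \<open>The ends of a triple are prescribed, so only its middle component is free, and
      the conditions on that component are exactly those of a transpose. Unique existence can then
      be moved from \<open>C\<close> to the slice.\<close>
    have tr: "h \<in> hom (slice C S) z e \<and> (\<exists>u\<in>hom (slice C S) r (e \<cdot> p).
      (e \<cdot> p, p, e) \<cdot>\<^bsub>slice C S\<^esub> u = h \<cdot>\<^bsub>slice C S\<^esub> a \<and> (e \<cdot> p, q, x) \<cdot>\<^bsub>slice C S\<^esub> u = b \<and>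
      (e \<cdot> p, ev, y) \<cdot>\<^bsub>slice C S\<^esub> u = g) \<longleftrightarrow>
      (\<exists>h0. h = (z, h0, e) \<and> transposes C E e P p q ev (Src C z) z (Src C r) a' b' c h0)" for h
    proof
      assume "h \<in> hom (slice C S) z e \<and> (\<exists>u\<in>hom (slice C S) r (e \<cdot> p).
        (e \<cdot> p, p, e) \<cdot>\<^bsub>slice C S\<^esub> u = h \<cdot>\<^bsub>slice C S\<^esub> a \<and> (e \<cdot> p, q, x) \<cdot>\<^bsub>slice C S\<^esub> u = b \<and>
        (e \<cdot> p, ev, y) \<cdot>\<^bsub>slice C S\<^esub> u = g)"
      then obtain u where hu: "h \<in> hom (slice C S) z e" "u \<in> hom (slice C S) r (e \<cdot> p)"
        "(e \<cdot> p, p, e) \<cdot>\<^bsub>slice C S\<^esub> u = h \<cdot>\<^bsub>slice C S\<^esub> a" "(e \<cdot> p, q, x) \<cdot>\<^bsub>slice C S\<^esub> u = b"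
        "(e \<cdot> p, ev, y) \<cdot>\<^bsub>slice C S\<^esub> u = g"
        by blast
      obtain h0 where h0: "h = (z, h0, e)" "h0 \<in> hom C (Src C z) (Src C e)" "e \<cdot> h0 = z"
        using hu(1) unfolding hom_slice by blast
      obtain u0 where u0: "u = (r, u0, e \<cdot> p)" "u0 \<in> hom C (Src C r) (Src C (e \<cdot> p))"
        using hu(2) unfolding hom_slice by blast
      have "p \<cdot> u0 = h0 \<cdot> a'" "q \<cdot> u0 = b'" "ev \<cdot> u0 = c"
        using hu(3-5) ab c(1) h0(1) u0(1) by (simp_all add: slice_simps)
      then have "transposes C E e P p q ev (Src C z) z (Src C r) a' b' c h0"
        unfolding transposes_def using h0(2,3) u0(2) s(5,11) by auto
      with h0(1) show "\<exists>h0. h = (z, h0, e) \<and> transposes C E e P p q ev (Src C z) z (Src C r) a' b' c h0"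
        by blast
    next
      assume "\<exists>h0. h = (z, h0, e) \<and> transposes C E e P p q ev (Src C z) z (Src C r) a' b' c h0"
      then obtain h0 u where h0: "h = (z, h0, e)" "h0 \<in> hom C (Src C z) E" "e \<cdot> h0 = z"
        and u: "u \<in> hom C (Src C r) P" "p \<cdot> u = h0 \<cdot> a'" "q \<cdot> u = b'" "ev \<cdot> u = c"
        by (auto simp: transposes_def)
      have "e \<cdot> p \<cdot> u = r"
        using cmp_cmp[OF u(1) ev(1) y] ev(2) u(4) c(3) by simp
      then have "(r, u, e \<cdot> p) \<in> hom (slice C S) r (e \<cdot> p)"
        using u(1) s zr by (simp add: hom_slice)
      moreover have "h \<in> hom (slice C S) z e"
        using h0 s zr by (simp add: hom_slice)
      ultimately show "h \<in> hom (slice C S) z e \<and> (\<exists>u\<in>hom (slice C S) r (e \<cdot> p).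
        (e \<cdot> p, p, e) \<cdot>\<^bsub>slice C S\<^esub> u = h \<cdot>\<^bsub>slice C S\<^esub> a \<and> (e \<cdot> p, q, x) \<cdot>\<^bsub>slice C S\<^esub> u = b \<and>
        (e \<cdot> p, ev, y) \<cdot>\<^bsub>slice C S\<^esub> u = g)"
        using u h0 ab c(1) by (intro conjI bexI[of _ "(r, u, e \<cdot> p)"]) (simp_all add: slice_simps)
    qed
    obtain h where h: "transposes C E e P p q ev (Src C z) z (Src C r) a' b' c h"
      and h_un: "\<And>h'. transposes C E e P p q ev (Src C z) z (Src C r) a' b' c h' \<Longrightarrow> h' = h"
      using is_local_exp_obtain[OF exp z Q(1) c(2)] c(3) Q(2) by metis
    show ?thesis
      unfolding tr
    proof (rule ex1I[of _ "(z, h, e)"])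
      show "\<exists>h0. (z, h, e) = (z, h0, e) \<and> transposes C E e P p q ev (Src C z) z (Src C r) a' b' c h0"
        using h by (intro exI[of _ h] conjI refl)
      fix h' assume "\<exists>h0. h' = (z, h0, e) \<and> transposes C E e P p q ev (Src C z) z (Src C r) a' b' c h0"
      then obtain h0 where h0: "h' = (z, h0, e)" "transposes C E e P p q ev (Src C z) z (Src C r) a' b' c h0"
        by (elim exE conjE)
      show "h' = (z, h, e)"
        unfolding h0(1) h_un[OF h0(2)] ..
    qed
  qed
  moreover have "is_product (slice C S) e x (e \<cdot> p) (e \<cdot> p, p, e) (e \<cdot> p, q, x)"
    by (rule slice_product_of_pullback[OF e x P])
  moreover have "(e \<cdot> p, ev, y) \<in> hom (slice C S) (e \<cdot> p) y"
    using ev s by (simp add: hom_slice)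
  ultimately show ?thesis
    unfolding is_exponential_def by (intro conjI allI impI) blast+
qed

lemma locally_cartesian_closedI:
  assumes exps: "has_local_exps C" and pbs: "has_pullbacks C"
  shows "locally_cartesian_closed C"
  unfolding locally_cartesian_closed_def cartesian_closed_def
proof (intro conjI ballI)
  show "category C"
    by (rule category_axioms)
  fix S assume S: "S \<in> Obj C"
  show "category (slice C S)"
    by (rule category_slice)
  show "\<exists>T. is_terminal (slice C S) T"
    using slice_terminal[OF S] by blast
  fix x y assume "x \<in> Obj (slice C S)" "y \<in> Obj (slice C S)"
  then have x: "x \<in> hom C (Src C x) S" and y: "y \<in> hom C (Src C y) S"
    by (auto simp: slice_simps hom_def)
  obtain P p q where "is_pullback C x y P p q"
    using pbs x y unfolding has_pullbacks_def by metis
  then show "\<exists>P p q. is_product (slice C S) x y P p q"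
    using slice_product_of_pullback[OF x y] by metis
  obtain E e P p q ev where "is_local_exp C S x (Src C y) y E e P p q ev"
    using exps x y unfolding has_local_exps_def by metis
  then show "\<exists>E P p q ev. is_exponential (slice C S) x y E P p q ev"
    using slice_exponential[OF x y] by metis
qed

end

text \<open>It labels the shape with vertices \<open>0\<close> and \<open>1\<close> and two parallel
  edges, also named \<open>0\<close> and \<open>1\<close>: vertices with objects, edges with the
  parallel pair, and vertices with the legs of a cocone.\<close>

definition pair_graph :: "'a \<Rightarrow> 'a \<Rightarrow> nat \<Rightarrow> 'a" where
  "pair_graph a b i = (if i = 0 then a else b)"

lemma pair_graph_simps [simp]: "pair_graph a b 0 = a" "pair_graph a b (Suc n) = b"
  by (simp_all add: pair_graph_def)

section \<open>Coequalizers and regularity\<close>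

context category
begin

text \<open>The leg at vertex \<open>0\<close> is forced to be \<open>q \<cdot> f\<close>, so a
  cocone on the parallel pair is no more than its leg at vertex \<open>1\<close>. In this form
  coequalizers fall under \<open>graph_colimit_stable\<close>.\<close>

lemma coequalizer_graph_colimit:
  assumes f: "f \<in> hom C A B" and g: "g \<in> hom C A B" and q: "q \<in> hom C B Q"
  shows "is_coequalizer C f g q \<longleftrightarrow>
    graph_colimit C {0, Suc 0} {0, Suc 0} (\<lambda>_. 0) (\<lambda>_. Suc 0) (pair_graph A B) (pair_graph f g) Q (pair_graph (q \<cdot> f) q)"
    (is "_ \<longleftrightarrow> ?colim")
proof
  have s: "Src C f = A" "Src C g = A" "Tgt C f = B" "Tgt C g = B" "f \<in> Arr C" "g \<in> Arr C"
    "q \<in> Arr C" "Src C q = B" "Tgt C q = Q"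
    using f g q by (simp_all add: hom_def)
  note qf = cmp_hom[OF f q]
  {
    assume coeq: "is_coequalizer C f g q"
    then have eq: "q \<cdot> f = q \<cdot> g"
      by (simp add: is_coequalizer_def)
    show ?colim
    proof (rule graph_limitI)
      show "graph_cocone C {0, Suc 0} {0, Suc 0} (\<lambda>_. 0) (\<lambda>_. Suc 0) (pair_graph A B) (pair_graph f g) Q (pair_graph (q \<cdot> f) q)"
        using q qf eq hom_obj(2)[OF q] by (simp add: graph_cone_def)
      fix X \<xi> assume "graph_cocone C {0, Suc 0} {0, Suc 0} (\<lambda>_. 0) (\<lambda>_. Suc 0) (pair_graph A B) (pair_graph f g) X \<xi>"
      then have \<xi>: "\<xi> (Suc 0) \<in> hom C B X" "\<xi> (Suc 0) \<cdot> f = \<xi> 0" "\<xi> (Suc 0) \<cdot> g = \<xi> 0"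
        by (simp_all add: graph_cone_def)
      then have "\<exists>!u. u \<in> hom C Q X \<and> u \<cdot> q = \<xi> (Suc 0)"
        using coeq s by (simp add: is_coequalizer_def)
      moreover have "u \<cdot> (q \<cdot> f) = \<xi> 0" if "u \<in> hom C Q X" "u \<cdot> q = \<xi> (Suc 0)" for u
        using cmp_assoc[OF f q that(1)] that(2) \<xi>(2) by simp
      then have "u \<in> hom C Q X \<and> u \<cdot> q = \<xi> (Suc 0) \<longleftrightarrow> u \<in> hom (opp C) X Q \<and>
          (\<forall>i\<in>{0, Suc 0}. pair_graph (q \<cdot> f) q i \<cdot>\<^bsub>opp C\<^esub> u = \<xi> i)" for u
        by auto
      ultimately show "\<exists>!h. h \<in> hom (opp C) X Q \<and>
          (\<forall>i\<in>{0, Suc 0}. pair_graph (q \<cdot> f) q i \<cdot>\<^bsub>opp C\<^esub> h = \<xi> i)"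
        by (simp only:)
    qed
  next
    assume colim: ?colim
    have eq: "q \<cdot> f = q \<cdot> g"
      using graph_limitD(3)[OF colim, of "Suc 0"] by simp
    have "\<exists>!u. u \<in> hom C Q Z \<and> u \<cdot> q = h" if h: "h \<in> hom C B Z" "h \<cdot> f = h \<cdot> g" for Z h
    proof -
      have "graph_cocone C {0, Suc 0} {0, Suc 0} (\<lambda>_. 0) (\<lambda>_. Suc 0) (pair_graph A B) (pair_graph f g) Z (pair_graph (h \<cdot> f) h)"
        using h hom_obj(2)[OF h(1)] cmp_hom[OF f h(1)] by (simp add: graph_cone_def)
      from graph_limit_obtain[OF colim this] obtain u where u: "u \<in> hom C Q Z" "u \<cdot> q = h"
        and un: "\<And>u'. u' \<in> hom C Q Z \<Longrightarrow> (\<And>i. i \<in> {0, Suc 0} \<Longrightarrow> u' \<cdot> pair_graph (q \<cdot> f) q i = pair_graph (h \<cdot> f) h i) \<Longrightarrow> u' = u"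
        unfolding opp_simps by (metis insertCI pair_graph_simps(2))
      show ?thesis
      proof (rule ex1I[of _ u])
        show "u \<in> hom C Q Z \<and> u \<cdot> q = h"
          using u by simp
        fix u' assume u': "u' \<in> hom C Q Z \<and> u' \<cdot> q = h"
        then show "u' = u"
          using cmp_assoc[OF f q, of u' Z] by (intro un) auto
      qed
    qed
    then show "is_coequalizer C f g q"
      using eq s by (simp add: is_coequalizer_def)
  }
qed

lemma has_coequalizers:
  assumes "has_equalizers (opp C)" "f \<in> hom C A B" "g \<in> hom C A B"
  obtains q where "is_coequalizer C f g q"
proof -
  have fg: "f \<in> hom (opp C) B A" "g \<in> hom (opp C) B A"
    using assms by simp_all
  obtain q Q where q: "q \<in> hom C B Q" "q \<cdot> f = q \<cdot> g"
    "\<And>Z h. h \<in> hom C B Z \<Longrightarrow> h \<cdot> f = h \<cdot> g \<Longrightarrow> \<exists>!u. u \<in> hom C Q Z \<and> u \<cdot> q = h"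
    by (rule has_equalizers_obtain[OF assms(1) fg, unfolded opp_simps], rule that)
  have s: "Src C f = A" "Src C g = A" "Tgt C f = B" "Tgt C g = B" "f \<in> Arr C" "g \<in> Arr C"
    "q \<in> Arr C" "Src C q = B" "Tgt C q = Q"
    using assms q by (simp_all add: hom_def)
  show thesis
    by (rule that[of q]) (simp add: is_coequalizer_def s q)
qed

text \<open>Pulling back along \<open>f\<close> a parallel pair whose coequalizer is
  \<open>e\<close> yields, by stability of colimits, a parallel pair whose coequalizer is
  \<open>p\<close>. Hence regular epimorphisms are stable under pullback.\<close>

lemma regular_categoryI:
  assumes exps: "has_local_exps C" and prods: "has_products C" and pbs: "has_pullbacks C"
    and lim: "has_finite_limits C" and coeqs: "has_equalizers (opp C)"
  shows "regular_category C"
  unfolding regular_category_def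
proof (intro conjI allI impI)
  show "category C"
    by (rule category_axioms)
  show "has_finite_limits C"
    by (rule lim)
  fix f P p q assume "is_pullback C f f P p q"
  then have "p \<in> hom C P (Src C f)" "q \<in> hom C P (Src C f)"
    by (auto simp: is_pullback_def)
  then show "\<exists>e. is_coequalizer C p q e"
    using has_coequalizers[OF coeqs] by blast
next
  fix e f P p q assume "is_regular_epi C e \<and> is_pullback C f e P p q"
  then obtain f0 f1 where coeq: "is_coequalizer C f0 f1 e" and P: "is_pullback C f e P p q"
    by (auto simp: is_regular_epi_def)
  define A where "A = Src C f0"
  define B where "B = Tgt C f0"
  define Q where "Q = Tgt C e"
  define Y where "Y = Src C f"
  have f01: "f0 \<in> hom C A B" "f1 \<in> hom C A B" and e: "e \<in> hom C B Q" and eq: "e \<cdot> f0 = e \<cdot> f1"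
    using coeq by (auto simp: is_coequalizer_def hom_def A_def B_def Q_def)
  have f: "f \<in> hom C Y Q"
    using P by (auto simp: is_pullback_def hom_def Y_def Q_def)
  note pq = is_pullbackD[OF P f e]
  \<comment> \<open>The leg at vertex \<open>0\<close> is \<open>e \<cdot> f0\<close>, which equals
    \<open>e \<cdot> f1\<close>. A single pullback \<open>W\<close> therefore carries both edges,
    lifted to \<open>g0\<close> and \<open>g1\<close>.\<close>
  obtain W \<kappa> \<phi> where W: "is_pullback C f (e \<cdot> f0) W \<kappa> \<phi>"
    using pbs f cmp_hom[OF f01(1) e] unfolding has_pullbacks_def by meson
  note w = is_pullbackD[OF W f cmp_hom[OF f01(1) e]]
  have sq: "f \<cdot> \<kappa> = e \<cdot> (f0 \<cdot> \<phi>)" "f \<cdot> \<kappa> = e \<cdot> (f1 \<cdot> \<phi>)"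
    using w(4) cmp_cmp[OF w(3) f01(1) e] cmp_cmp[OF w(3) f01(2) e] eq by simp_all
  obtain g0 where g0: "g0 \<in> hom C W P" "p \<cdot> g0 = \<kappa>" "q \<cdot> g0 = f0 \<cdot> \<phi>"
    using is_pullback_obtain[OF P f e w(2) cmp_hom[OF w(3) f01(1)] sq(1)] by blast
  obtain g1 where g1: "g1 \<in> hom C W P" "p \<cdot> g1 = \<kappa>" "q \<cdot> g1 = f1 \<cdot> \<phi>"
    using is_pullback_obtain[OF P f e w(2) cmp_hom[OF w(3) f01(2)] sq(2)] by blast
  have "graph_colimit C {0, Suc 0} {0, Suc 0} (\<lambda>_. 0) (\<lambda>_. Suc 0) (pair_graph W P) (pair_graph g0 g1) Y (pair_graph \<kappa> p)"
  proof (rule graph_colimit_stable[OF exps prods _ f])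
    show "graph_colimit C {0, Suc 0} {0, Suc 0} (\<lambda>_. 0) (\<lambda>_. Suc 0) (pair_graph A B) (pair_graph f0 f1) Q (pair_graph (e \<cdot> f0) e)"
      using coeq coequalizer_graph_colimit[OF f01 e] by simp
    show "graph_cocone C {0, Suc 0} {0, Suc 0} (\<lambda>_. 0) (\<lambda>_. Suc 0) (pair_graph W P) (pair_graph g0 g1) Y (pair_graph \<kappa> p)"
      using hom_obj(1)[OF f] pq(2) w(2) g0 g1 by (simp add: graph_cone_def)
    show "is_pullback C f (pair_graph (e \<cdot> f0) e i) (pair_graph W P i) (pair_graph \<kappa> p i) (pair_graph \<phi> q i)"
      if "i \<in> {0, Suc 0}" for i
      using that P W by auto
  qed (use f01 g0 g1 w pq in auto)
  then have "is_coequalizer C g0 g1 p"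
    using coequalizer_graph_colimit[OF g0(1) g1(1) pq(2)] g0(2) by simp
  then show "is_regular_epi C p"
    by (auto simp: is_regular_epi_def)
qed

end

section \<open>Herbrand assemblies\<close>

definition fn :: "'a \<times> ('u \<Rightarrow> 'u) \<times> 'a \<Rightarrow> 'u \<Rightarrow> 'u" where
  "fn f = fst (snd f)"

lemma fn_triple [simp]: "fn (X, \<phi>, Y) = \<phi>"
  by (simp add: fn_def)

locale herbrand_universe = nontrivial_coding app k s code
  for app :: "'p \<Rightarrow> 'p \<Rightarrow> 'p option" and k s :: 'p and code :: "'p list \<Rightarrow> 'p" +
  fixes U :: "'u set set"
  assumes U: "set_universe U"
begin

section \<open>Sets that can be coded in the universe\<close>

lemma U_subset: "A \<in> U \<Longrightarrow> B \<subseteq> A \<Longrightarrow> B \<in> U"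
  and U_Times: "A \<in> U \<Longrightarrow> B \<in> U \<Longrightarrow> \<exists>D\<in>U. D \<approx> A \<times> B"
  and U_Pow: "A \<in> U \<Longrightarrow> \<exists>D\<in>U. D \<approx> Pow A"
  and U_infinite: "\<exists>A\<in>U. infinite A"
  using U by (simp_all add: set_universe_def)

text \<open>The sets that can be encoded by a member of the universe; \<open>enc\<close> and \<open>dec\<close> are meaningful only
  for these.\<close>

definition small :: "'w set \<Rightarrow> bool" where
  "small W \<longleftrightarrow> (\<exists>D\<in>U. \<exists>e :: 'w \<Rightarrow> 'u. inj_on e W \<and> e ` W \<subseteq> D)"

lemma small_member: "A \<in> U \<Longrightarrow> small A"
  unfolding small_def by (rule bexI[of _ A], rule exI[of _ "\<lambda>x. x"]) auto

lemma small_inj: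
  assumes "small W" "inj_on f V" "f ` V \<subseteq> W"
  shows "small V"
proof -
  obtain D e where D: "D \<in> U" "inj_on e W" "e ` W \<subseteq> D"
    using assms(1) unfolding small_def by blast
  have "inj_on (e \<circ> f) V"
    using assms(2,3) D(2) by (intro comp_inj_on) (auto intro: inj_on_subset)
  then show ?thesis
    unfolding small_def using D assms(3) by (intro bexI[of _ D] exI[of _ "e \<circ> f"]) auto
qed

lemma small_subset: "small W \<Longrightarrow> V \<subseteq> W \<Longrightarrow> small V"
  by (rule small_inj[where f = "\<lambda>x. x"]) auto

lemma small_Times:
  assumes "small V" "small W"
  shows "small (V \<times> W)"
proof -
  obtain D e where D: "D \<in> U" "inj_on e V" "e ` V \<subseteq> D"
    using assms(1) unfolding small_def by blast
  obtain D' e' where D': "D' \<in> U" "inj_on e' W" "e' ` W \<subseteq> D'"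
    using assms(2) unfolding small_def by blast
  obtain M where M: "M \<in> U" "M \<approx> D \<times> D'"
    using U_Times[OF D(1) D'(1)] by blast
  then obtain g where g: "bij_betw g (D \<times> D') M"
    using eqpoll_sym unfolding eqpoll_def by blast
  have "small (D \<times> D')"
    by (rule small_inj[OF small_member[OF M(1)], of g]) (use g in \<open>auto simp: bij_betw_def\<close>)
  then show ?thesis
    by (rule small_inj[where f = "map_prod e e'"]) (use D D' in \<open>auto simp: inj_on_def\<close>)
qed

lemma small_Pow:
  assumes "small W"
  shows "small (Pow W)"
proof -
  obtain D e where D: "D \<in> U" "inj_on e W" "e ` W \<subseteq> D"
    using assms(1) unfolding small_def by blast
  obtain M where M: "M \<in> U" "M \<approx> Pow D"
    using U_Pow[OF D(1)] by blast
  then obtain g where g: "bij_betw g (Pow D) M"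
    using eqpoll_sym unfolding eqpoll_def by blast
  have "small (Pow D)"
    by (rule small_inj[OF small_member[OF M(1)], of g]) (use g in \<open>auto simp: bij_betw_def\<close>)
  then show ?thesis
    by (rule small_inj[where f = "image e"])
      (use D in \<open>auto intro: inj_on_image_Pow\<close>)
qed

text \<open>Sums are obtained inside a product of power sets: an element goes to its singleton on
  its own side and to the empty set on the other.\<close>

lemma small_Plus:
  assumes "small V" "small W"
  shows "small (V <+> W)"
proof (rule small_inj[OF small_Times[OF small_Pow[OF assms(1)] small_Pow[OF assms(2)]]])
  let ?f = "case_sum (\<lambda>x. ({x}, {})) (\<lambda>y. ({}, {y}))"
  show "inj_on ?f (V <+> W)"
    by (auto simp: inj_on_def)
  show "?f ` (V <+> W) \<subseteq> Pow V \<times> Pow W"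
    by auto
qed

lemma small_nat: "small (UNIV :: nat set)"
proof -
  obtain A where A: "A \<in> U" "infinite A"
    using U_infinite by blast
  then obtain f :: "nat \<Rightarrow> 'u" where "inj f" "range f \<subseteq> A"
    using infinite_countable_subset by blast
  then show ?thesis
    by (intro small_inj[OF small_member[OF A(1)], of f])
qed

lemma small_unit: "small (V :: unit set)"
  by (rule small_inj[OF small_nat, of "\<lambda>_. 0"]) (auto simp: inj_on_def)

definition enc :: "'w set \<Rightarrow> 'w \<Rightarrow> 'u" where
  "enc W = (SOME e. inj_on e W \<and> e ` W \<in> U)"

definition dec :: "'w set \<Rightarrow> 'u \<Rightarrow> 'w" where
  "dec W = inv_into W (enc W)"

lemma enc:
  assumes "small W"
  shows "inj_on (enc W) W" "enc W ` W \<in> U"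
proof -
  have "\<exists>e. inj_on e W \<and> e ` W \<in> U"
    using assms U_subset unfolding small_def by blast
  from someI_ex[OF this, folded enc_def] show "inj_on (enc W) W" "enc W ` W \<in> U"
    by auto
qed

lemma dec_enc: "small W \<Longrightarrow> w \<in> W \<Longrightarrow> dec W (enc W w) = w"
  by (simp add: dec_def enc)

lemma enc_dec: "u \<in> enc W ` W \<Longrightarrow> enc W (dec W u) = u"
  by (simp add: dec_def f_inv_into_f)

lemma dec_in: "u \<in> enc W ` W \<Longrightarrow> dec W u \<in> W"
  by (simp add: dec_def inv_into_into)

section \<open>Realizers and trackings in terms of lists\<close>

definition upclosed :: "'p set \<Rightarrow> 'p list set \<Rightarrow> bool" where
  "upclosed B S \<longleftrightarrow> S \<noteq> {} \<and> (\<forall>xs\<in>S. set xs \<subseteq> B) \<and>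
     (\<forall>xs\<in>S. \<forall>ys. set ys \<subseteq> B \<and> set xs \<subseteq> set ys \<longrightarrow> ys \<in> S)"

definition RL :: "('u, 'p) hasm \<Rightarrow> 'u \<Rightarrow> 'p list set" where
  "RL X a = {xs. code xs \<in> Real X a}"

lemma inv_code [simp]: "inv code (code xs) = xs"
  using code_inj by simp

lemma code_eq [simp]: "code xs = code ys \<longleftrightarrow> xs = ys"
  using code_inj by (auto dest: injD)

lemma bang_eq: "bang code A = code ` {xs. set xs \<subseteq> A}"
  by (simp add: bang_def lists_eq_set)

lemma code_le_iff: "code_le code (code xs) (code ys) \<longleftrightarrow> set xs \<subseteq> set ys"
proof -
  have "set xs \<subseteq> set ys \<longleftrightarrow> (\<forall>i<length xs. xs ! i \<in> set ys)"
    by (simp add: subset_code(1) all_set_conv_all_nth)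
  also have "\<dots> \<longleftrightarrow> (\<forall>i<length xs. \<exists>j<length ys. xs ! i = ys ! j)"
    unfolding in_set_conv_nth by (simp add: eq_commute)
  finally show ?thesis
    by (simp add: code_le_def code_len_def code_entry_def)
qed

text \<open>The equation with the image under \<open>code\<close> says that nothing but codes of
  lists is a realizer, so \<open>RL X a\<close> loses no information. The preorder on codes is
  inclusion of the sets of entries, which turns the remaining conditions into
  \<open>upclosed\<close>.\<close>

lemma herbrand_assembly_iff:
  "herbrand_assembly code X \<longleftrightarrow> Real X \<in> extensional (Under X) \<and>
     (\<forall>a\<in>Under X. Real X a = code ` RL X a \<and> upclosed (Base X) (RL X a))"
proof -
  have "(Real X a \<noteq> {} \<and> Real X a \<subseteq> bang code (Base X) \<and> upwards_closed code (Base X) (Real X a)) \<longleftrightarrow>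
      Real X a = code ` RL X a \<and> upclosed (Base X) (RL X a)" (is "?l \<longleftrightarrow> ?r") for a
  proof
    assume l: ?l
    then have eq: "Real X a = code ` RL X a"
      unfolding RL_def bang_eq by blast
    have "ys \<in> RL X a" if "xs \<in> RL X a" "set ys \<subseteq> Base X" "set xs \<subseteq> set ys" for xs ys
    proof -
      have "code xs \<in> Real X a" "code ys \<in> bang code (Base X)" "code_le code (code xs) (code ys)"
        using that by (auto simp: RL_def bang_eq code_le_iff)
      then show ?thesis
        using l unfolding upwards_closed_def RL_def by blast
    qed
    moreover have "RL X a \<noteq> {}"
      using l eq by auto
    moreover have "set xs \<subseteq> Base X" if "xs \<in> RL X a" for xs
      using l that by (fastforce simp: RL_def bang_eq)
    ultimately show ?r
      using eq unfolding upclosed_def by blast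
  next
    assume r: ?r
    then have eq: "Real X a = code ` RL X a" ..
    have "upwards_closed code (Base X) (Real X a)"
      unfolding upwards_closed_def
    proof (intro allI impI, elim conjE)
      fix m n assume "m \<in> Real X a" "n \<in> bang code (Base X)" "code_le code m n"
      then obtain xs ys where "m = code xs" "xs \<in> RL X a" "n = code ys" "set ys \<subseteq> Base X" "set xs \<subseteq> set ys"
        using eq by (auto simp: bang_eq code_le_iff)
      then show "n \<in> Real X a"
        using r eq unfolding upclosed_def by blast
    qed
    moreover have "Real X a \<noteq> {}" "Real X a \<subseteq> bang code (Base X)"
      using r unfolding eq bang_eq upclosed_def by auto
    ultimately show ?l
      by blast
  qed
  then show ?thesis
    unfolding herbrand_assembly_def by simp
qed

definition tracked :: "('u, 'p) hasm \<Rightarrow> ('u, 'p) hasm \<Rightarrow> ('u \<Rightarrow> 'u) \<Rightarrow> bool" where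
  "tracked X Y f \<longleftrightarrow> (\<exists>F. comp (Base X) F \<and> (\<forall>xs. set xs \<subseteq> Base X \<longrightarrow> set (F xs) \<subseteq> Base Y) \<and>
     (\<forall>a\<in>Under X. \<forall>xs\<in>RL X a. F xs \<in> RL Y (f a)))"

text \<open>A tracking \<open>n\<close> induces the function \<open>run n\<close> on lists, well
  behaved on the whole base thanks to the totality clause; conversely the program behind
  \<open>comp\<close> is a tracking.\<close>

lemma tracks_iff_tracked:
  assumes X: "herbrand_assembly code X"
  shows "(\<exists>n. tracks app code X Y n f) \<longleftrightarrow> tracked X Y f"
proof
  assume "\<exists>n. tracks app code X Y n f"
  then obtain n where n: "tracks app code X Y n f" ..
  have tot: "app n (code xs) = Some (code (run n xs))" "set (run n xs) \<subseteq> Base Y"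
    if "set xs \<subseteq> Base X" for xs
  proof -
    have "code xs \<in> bang code (Base X)"
      using that by (simp add: bang_eq)
    then obtain r where r: "r \<in> bang code (Base Y)" "app n (code xs) = Some r"
      using n unfolding tracks_def by blast
    then obtain ys where ys: "r = code ys" "set ys \<subseteq> Base Y"
      by (auto simp: bang_eq)
    then have "run n xs = ys"
      using r by (simp add: run)
    then show "app n (code xs) = Some (code (run n xs))" "set (run n xs) \<subseteq> Base Y"
      using r ys by simp_all
  qed
  moreover have "run n xs \<in> RL Y (f a)" if a: "a \<in> Under X" and xs: "xs \<in> RL X a" for a xs
  proof -
    have "set xs \<subseteq> Base X"
      using X a xs unfolding herbrand_assembly_iff upclosed_def by blast
    moreover obtain r where "r \<in> Real Y (f a)" "app n (code xs) = Some r"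
      using n a xs unfolding tracks_def RL_def by blast
    ultimately show ?thesis
      using tot by (simp add: RL_def)
  qed
  ultimately show "tracked X Y f"
    unfolding tracked_def comp_def by (intro exI[of _ "run n"]) blast
next
  assume "tracked X Y f"
  then obtain F n where n: "\<And>xs. set xs \<subseteq> Base X \<Longrightarrow> app n (code xs) = Some (code (F xs))"
    "\<And>xs. set xs \<subseteq> Base X \<Longrightarrow> set (F xs) \<subseteq> Base Y" "\<And>a xs. a \<in> Under X \<Longrightarrow> xs \<in> RL X a \<Longrightarrow> F xs \<in> RL Y (f a)"
    unfolding tracked_def comp_def by blast
  have "tracks app code X Y n f"
    unfolding tracks_def
  proof (intro conjI ballI)
    fix m assume "m \<in> bang code (Base X)"
    then show "\<exists>r\<in>bang code (Base Y). app n m = Some r"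
      using n(1,2) by (auto simp: bang_eq)
  next
    fix a m assume a: "a \<in> Under X" and m: "m \<in> Real X a"
    then obtain xs where xs: "m = code xs" "xs \<in> RL X a" "set xs \<subseteq> Base X"
      using X unfolding herbrand_assembly_iff upclosed_def by blast
    then show "\<exists>r\<in>Real Y (f a). app n m = Some r"
      using n(1) n(3)[OF a xs(2)] by (auto simp: RL_def)
  qed
  then show "\<exists>n. tracks app code X Y n f" ..
qed

section \<open>The category, with arrows handled as functions\<close>

abbreviation H :: "(('u, 'p) hasm, ('u, 'p) hasm \<times> ('u \<Rightarrow> 'u) \<times> ('u, 'p) hasm) cat" where
  "H \<equiv> HAsm U app code"

lemma Obj_H: "X \<in> Obj H \<longleftrightarrow> herbrand_assembly code X \<and> Under X \<in> U"
  by (simp add: HAsm_def)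

lemma small_Under: "X \<in> Obj H \<Longrightarrow> small (Under X)"
  by (simp add: Obj_H small_member)

lemma RL_upclosed: "X \<in> Obj H \<Longrightarrow> a \<in> Under X \<Longrightarrow> upclosed (Base X) (RL X a)"
  by (simp add: Obj_H herbrand_assembly_iff)

lemma RL_Base: "X \<in> Obj H \<Longrightarrow> a \<in> Under X \<Longrightarrow> xs \<in> RL X a \<Longrightarrow> set xs \<subseteq> Base X"
  using RL_upclosed unfolding upclosed_def by blast

lemma RL_mono:
  "X \<in> Obj H \<Longrightarrow> a \<in> Under X \<Longrightarrow> xs \<in> RL X a \<Longrightarrow> set xs \<subseteq> set ys \<Longrightarrow> set ys \<subseteq> Base X \<Longrightarrow> ys \<in> RL X a"
  using RL_upclosed unfolding upclosed_def by blast

lemma RL_obtain: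
  assumes "X \<in> Obj H" "a \<in> Under X"
  obtains xs where "xs \<in> RL X a"
  using RL_upclosed[OF assms] unfolding upclosed_def by blast

lemma hom_H:
  "f \<in> hom H X Y \<longleftrightarrow> X \<in> Obj H \<and> Y \<in> Obj H \<and>
     (\<exists>\<phi>. f = (X, \<phi>, Y) \<and> \<phi> \<in> Under X \<rightarrow>\<^sub>E Under Y \<and> tracked X Y \<phi>)"
proof -
  obtain A \<phi> B where "f = (A, \<phi>, B)"
    by (cases f)
  then show ?thesis
    by (auto simp: hom_def HAsm_def tracks_iff_tracked[symmetric])
qed

lemma fn_in: "f \<in> hom H X Y \<Longrightarrow> x \<in> Under X \<Longrightarrow> fn f x \<in> Under Y"
  by (auto simp: hom_H fn_def)

lemma fn_tracked: "f \<in> hom H X Y \<Longrightarrow> tracked X Y (fn f)"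
  by (auto simp: hom_H fn_def)

lemma hom_H_obj: "f \<in> hom H X Y \<Longrightarrow> X \<in> Obj H" "f \<in> hom H X Y \<Longrightarrow> Y \<in> Obj H"
  by (auto simp: hom_H)

lemma Cmp_H: "Cmp H (B, g, X) (Z, f, A) = (Z, compose (Under Z) g f, X)"
  by (simp add: HAsm_def)

lemma fn_cmp:
  "f \<in> hom H X Y \<Longrightarrow> g \<in> hom H Y Z \<Longrightarrow> x \<in> Under X \<Longrightarrow> fn (Cmp H g f) x = fn g (fn f x)"
  by (auto simp: hom_H fn_def Cmp_H compose_def)

lemma hom_eqI:
  assumes "f \<in> hom H X Y" "g \<in> hom H X Y" "\<And>x. x \<in> Under X \<Longrightarrow> fn f x = fn g x"
  shows "f = g"
proof -
  obtain \<phi> \<psi> where "f = (X, \<phi>, Y)" "\<phi> \<in> Under X \<rightarrow>\<^sub>E Under Y" "g = (X, \<psi>, Y)" "\<psi> \<in> Under X \<rightarrow>\<^sub>E Under Y"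
    using assms(1,2) unfolding hom_H by blast
  then show ?thesis
    using assms(3) PiE_ext[of \<phi> "Under X" "\<lambda>_. Under Y" \<psi>] by (simp add: fn_def)
qed

definition arr :: "('u, 'p) hasm \<Rightarrow> ('u \<Rightarrow> 'u) \<Rightarrow> ('u, 'p) hasm \<Rightarrow> ('u, 'p) hasm \<times> ('u \<Rightarrow> 'u) \<times> ('u, 'p) hasm" where
  "arr X \<phi> Y = (X, restrict \<phi> (Under X), Y)"

lemma fn_arr [simp]: "x \<in> Under X \<Longrightarrow> fn (arr X \<phi> Y) x = \<phi> x"
  by (simp add: fn_def arr_def)

lemma arr_homI:
  assumes "X \<in> Obj H" "Y \<in> Obj H" "\<And>x. x \<in> Under X \<Longrightarrow> \<phi> x \<in> Under Y"
    "comp (Base X) F" "\<And>xs. set xs \<subseteq> Base X \<Longrightarrow> set (F xs) \<subseteq> Base Y"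
    "\<And>a xs. a \<in> Under X \<Longrightarrow> xs \<in> RL X a \<Longrightarrow> F xs \<in> RL Y (\<phi> a)"
  shows "arr X \<phi> Y \<in> hom H X Y"
proof -
  have "tracked X Y (restrict \<phi> (Under X))"
    unfolding tracked_def using assms(4-6) by (intro exI[of _ F]) auto
  then show ?thesis
    unfolding hom_H arr_def using assms(1-3) by auto
qed

lemma fn_tracking_obtain:
  assumes "f \<in> hom H X Y"
  obtains F where "comp (Base X) F" "\<And>xs. set xs \<subseteq> Base X \<Longrightarrow> set (F xs) \<subseteq> Base Y"
    "\<And>a xs. a \<in> Under X \<Longrightarrow> xs \<in> RL X a \<Longrightarrow> F xs \<in> RL Y (fn f a)"
  using fn_tracked[OF assms] unfolding tracked_def by blast

lemma Ide_H: "Ide H X = arr X (\<lambda>a. a) X"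
  by (simp add: HAsm_def arr_def)

lemma fn_Ide [simp]: "x \<in> Under X \<Longrightarrow> fn (Ide H X) x = x"
  by (simp add: Ide_H)

lemma cmp_H_hom:
  assumes f: "f \<in> hom H X Y" and g: "g \<in> hom H Y Z"
  shows "Cmp H g f \<in> hom H X Z"
proof -
  obtain F where F: "comp (Base X) F" "\<And>xs. set xs \<subseteq> Base X \<Longrightarrow> set (F xs) \<subseteq> Base Y"
    "\<And>a xs. a \<in> Under X \<Longrightarrow> xs \<in> RL X a \<Longrightarrow> F xs \<in> RL Y (fn f a)"
    using fn_tracking_obtain[OF f] by blast
  obtain G where G: "comp (Base Y) G" "\<And>xs. set xs \<subseteq> Base Y \<Longrightarrow> set (G xs) \<subseteq> Base Z"
    "\<And>a xs. a \<in> Under Y \<Longrightarrow> xs \<in> RL Y a \<Longrightarrow> G xs \<in> RL Z (fn g a)"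
    using fn_tracking_obtain[OF g] by blast
  have "Cmp H g f = arr X (\<lambda>x. fn g (fn f x)) Z"
    using f g by (auto simp: hom_H Cmp_H arr_def compose_def)
  also have "\<dots> \<in> hom H X Z"
    by (rule arr_homI[OF hom_H_obj(1)[OF f] hom_H_obj(2)[OF g] fn_in[OF g fn_in[OF f]]
          comp_comp[OF F(1) G(1) F(2)] G(2)[OF F(2)] G(3)[OF fn_in[OF f] F(3)]])
  finally show ?thesis .
qed

sublocale H: category H
proof
  fix f assume "f \<in> Arr H"
  then show "Src H f \<in> Obj H" "Tgt H f \<in> Obj H"
    by (auto simp: HAsm_def)
next
  fix X assume "X \<in> Obj H"
  then show "Ide H X \<in> hom H X X"
    unfolding Ide_H by (intro arr_homI[where F = "\<lambda>xs. xs"] comp_id)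
next
  fix f g X Y Z assume "f \<in> hom H X Y" "g \<in> hom H Y Z"
  then show "Cmp H g f \<in> hom H X Z"
    by (rule cmp_H_hom)
next
  fix f X Y assume f: "f \<in> hom H X Y"
  have X: "Ide H X \<in> hom H X X" "Ide H Y \<in> hom H Y Y"
    unfolding Ide_H by (intro arr_homI[where F = "\<lambda>xs. xs"] comp_id hom_H_obj[OF f], assumption+)+
  show "Cmp H (Ide H Y) f = f"
    by (rule hom_eqI[OF cmp_H_hom[OF f X(2)] f]) (simp add: fn_cmp[OF f X(2)] fn_in[OF f])
  show "Cmp H f (Ide H X) = f"
    by (rule hom_eqI[OF cmp_H_hom[OF X(1) f] f]) (simp add: fn_cmp[OF X(1) f])
next
  fix f g h W X Y Z assume f: "f \<in> hom H W X" and g: "g \<in> hom H X Y" and h: "h \<in> hom H Y Z"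
  show "Cmp H h (Cmp H g f) = Cmp H (Cmp H h g) f"
    by (rule hom_eqI[OF cmp_H_hom[OF cmp_H_hom[OF f g] h] cmp_H_hom[OF f cmp_H_hom[OF g h]]])
      (simp add: fn_cmp[OF cmp_H_hom[OF f g] h] fn_cmp[OF f cmp_H_hom[OF g h]] fn_cmp[OF f g]
        fn_cmp[OF g h] fn_in[OF f])
qed

lemma cmp_eqI:
  assumes "f \<in> hom H X Y" "g \<in> hom H Y Z" "h \<in> hom H X Z" "\<And>x. x \<in> Under X \<Longrightarrow> fn g (fn f x) = fn h x"
  shows "Cmp H g f = h"
  by (rule hom_eqI[OF cmp_H_hom[OF assms(1,2)] assms(3)]) (simp add: fn_cmp[OF assms(1,2)] assms(4))

lemma cmp_eqD:
  assumes "Cmp H g f = Cmp H g' f'" "f \<in> hom H X Y" "g \<in> hom H Y Z" "f' \<in> hom H X Y'" "g' \<in> hom H Y' Z"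
    "x \<in> Under X"
  shows "fn g (fn f x) = fn g' (fn f' x)"
  using fn_cmp[OF assms(2,3,6)] fn_cmp[OF assms(4,5,6)] assms(1) by simp

text \<open>An assembly on a small set \<open>W\<close> of any type, such as pairs, elements of a
  sum, classes, or points together with functions. The realizers are specified on \<open>W\<close>
  itself; only the underlying set is moved along \<open>enc\<close>.\<close>

definition mk :: "'w set \<Rightarrow> 'p set \<Rightarrow> ('w \<Rightarrow> 'p list set) \<Rightarrow> ('u, 'p) hasm" where
  "mk W B R = \<lparr>Under = enc W ` W, Base = B, Real = (\<lambda>a\<in>enc W ` W. code ` R (dec W a))\<rparr>"

lemma mk_simps [simp]: "Under (mk W B R) = enc W ` W" "Base (mk W B R) = B"
  by (simp_all add: mk_def)

lemma RL_mk: "u \<in> enc W ` W \<Longrightarrow> RL (mk W B R) u = R (dec W u)"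
  by (auto simp: RL_def mk_def)

lemma mk_obj:
  assumes "small W" "\<And>w. w \<in> W \<Longrightarrow> upclosed B (R w)"
  shows "mk W B R \<in> Obj H"
proof -
  have "Real (mk W B R) u = code ` RL (mk W B R) u \<and> upclosed B (RL (mk W B R) u)" if u: "u \<in> enc W ` W" for u
    using assms(2)[OF dec_in[OF u]] RL_mk[OF u] u by (simp add: mk_def)
  moreover have "Real (mk W B R) \<in> extensional (enc W ` W)"
    by (simp add: mk_def)
  ultimately show ?thesis
    by (simp add: Obj_H herbrand_assembly_iff enc(2)[OF assms(1)])
qed

section \<open>Finite limits of assemblies\<close>

lemma terminal_H:
  fixes T :: "('u, 'p) hasm"
  defines "T \<equiv> mk {()} {} (\<lambda>_. {[]})"
  shows "is_terminal H T"
  unfolding is_terminal_def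
proof (intro conjI ballI)
  show T: "T \<in> Obj H"
    unfolding T_def by (rule mk_obj[OF small_unit]) (auto simp: upclosed_def)
  fix X assume X: "X \<in> Obj H"
  show "\<exists>!f. f \<in> hom H X T"
  proof (rule ex1I)
    show "arr X (\<lambda>_. enc {()} ()) T \<in> hom H X T"
      by (rule arr_homI[OF X T _ comp_const[of _ "[]"]]) (auto simp: T_def RL_mk)
    fix f assume f: "f \<in> hom H X T"
    show "f = arr X (\<lambda>_. enc {()} ()) T"
      by (rule hom_eqI[OF f \<open>arr X (\<lambda>_. enc {()} ()) T \<in> hom H X T\<close>])
        (use fn_in[OF f] in \<open>auto simp: T_def\<close>)
  qed
qed

lemma subproduct:
  assumes X: "X \<in> Obj H" and Y: "Y \<in> Obj H" and W: "W \<subseteq> Under X \<times> Under Y"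
  obtains P p q pr where "P \<in> Obj H" "p \<in> hom H P X" "q \<in> hom H P Y" "Base P = tag (Base X) (Base Y)"
    "\<And>x y. (x, y) \<in> W \<Longrightarrow> pr x y \<in> Under P" "\<And>x y. (x, y) \<in> W \<Longrightarrow> fn p (pr x y) = x"
    "\<And>x y. (x, y) \<in> W \<Longrightarrow> fn q (pr x y) = y"
    "\<And>w. w \<in> Under P \<Longrightarrow> (fn p w, fn q w) \<in> W" "\<And>w. w \<in> Under P \<Longrightarrow> pr (fn p w) (fn q w) = w"
    "\<And>x y. (x, y) \<in> W \<Longrightarrow> RL P (pr x y) =
       {m. set m \<subseteq> tag (Base X) (Base Y) \<and> lefts m \<in> RL X x \<and> rights m \<in> RL Y y}"
    "\<And>Z f g. f \<in> hom H Z X \<Longrightarrow> g \<in> hom H Z Y \<Longrightarrow> \<forall>z\<in>Under Z. (fn f z, fn g z) \<in> W \<Longrightarrow>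
       \<exists>h. h \<in> hom H Z P \<and> Cmp H p h = f \<and> Cmp H q h = g"
    "\<And>Z h h'. h \<in> hom H Z P \<Longrightarrow> h' \<in> hom H Z P \<Longrightarrow> Cmp H p h = Cmp H p h' \<Longrightarrow>
       Cmp H q h = Cmp H q h' \<Longrightarrow> h = h'"
proof -
  define R where "R = (\<lambda>(x, y). {m. set m \<subseteq> tag (Base X) (Base Y) \<and> lefts m \<in> RL X x \<and> rights m \<in> RL Y y})"
  define P where "P = mk W (tag (Base X) (Base Y)) R"
  have sW: "small W"
    using small_subset[OF small_Times[OF small_Under[OF X] small_Under[OF Y]] W] .
  have "upclosed (tag (Base X) (Base Y)) (R w)" if w: "w \<in> W" for w
  proof -
    obtain x y where xy: "w = (x, y)" "x \<in> Under X" "y \<in> Under Y"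
      using w W by auto
    obtain xs where xs: "xs \<in> RL X x"
      using RL_obtain[OF X xy(2)] .
    obtain ys where ys: "ys \<in> RL Y y"
      using RL_obtain[OF Y xy(3)] .
    have "map inl xs @ map inr ys \<in> R w"
      using xs ys set_tag[OF RL_Base[OF X xy(2) xs] RL_Base[OF Y xy(3) ys]] by (simp add: R_def xy)
    moreover have "n \<in> R w" if "m \<in> R w" "set n \<subseteq> tag (Base X) (Base Y)" "set m \<subseteq> set n" for m n
      using that RL_mono[OF X xy(2) _ lefts_mono[OF that(3)] set_lefts_tag[OF that(2)]]
        RL_mono[OF Y xy(3) _ rights_mono[OF that(3)] set_rights_tag[OF that(2)]]
      by (simp add: R_def xy)
    moreover have "set m \<subseteq> tag (Base X) (Base Y)" if "m \<in> R w" for m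
      using that by (simp add: R_def xy)
    ultimately show ?thesis
      unfolding upclosed_def by blast
  qed
  then have P: "P \<in> Obj H"
    unfolding P_def by (rule mk_obj[OF sW])
  define p where "p = arr P (\<lambda>w. fst (dec W w)) X"
  define q where "q = arr P (\<lambda>w. snd (dec W w)) Y"
  have RLP: "RL P w = R (dec W w)" "dec W w \<in> W" "dec W w = (fst (dec W w), snd (dec W w))" if "w \<in> Under P" for w
    using that RL_mk[of w W] dec_in[of w W] by (simp_all add: P_def)
  have p: "p \<in> hom H P X"
    unfolding p_def
  proof (rule arr_homI[OF P X, where F = lefts])
    show "fst (dec W x) \<in> Under X" if "x \<in> Under P" for x
      using RLP(2)[OF that] W by auto
    show "comp (Base P) lefts"
      by (simp add: P_def comp_lefts)
    show "set (lefts xs) \<subseteq> Base X" if "set xs \<subseteq> Base P" for xs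
      using set_lefts_tag that by (simp add: P_def)
    show "lefts xs \<in> RL X (fst (dec W a))" if "a \<in> Under P" "xs \<in> RL P a" for a xs
      using that RLP(1)[OF that(1)] by (auto simp: R_def case_prod_unfold)
  qed
  have q: "q \<in> hom H P Y"
    unfolding q_def
  proof (rule arr_homI[OF P Y, where F = rights])
    show "snd (dec W x) \<in> Under Y" if "x \<in> Under P" for x
      using RLP(2)[OF that] W by auto
    show "comp (Base P) rights"
      by (simp add: P_def comp_rights)
    show "set (rights xs) \<subseteq> Base Y" if "set xs \<subseteq> Base P" for xs
      using set_rights_tag that by (simp add: P_def)
    show "rights xs \<in> RL Y (snd (dec W a))" if "a \<in> Under P" "xs \<in> RL P a" for a xs
      using that RLP(1)[OF that(1)] by (auto simp: R_def case_prod_unfold)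
  qed
  have pq: "fn p w = fst (dec W w)" "fn q w = snd (dec W w)" if "w \<in> Under P" for w
    using that by (simp_all add: p_def q_def)
  have inj: "w = w'" if "w \<in> Under P" "w' \<in> Under P" "fn p w = fn p w'" "fn q w = fn q w'" for w w'
  proof -
    have "dec W w = dec W w'"
      using that pq by (simp add: prod_eq_iff)
    then show ?thesis
      using enc_dec that(1,2) by (metis P_def mk_simps(1))
  qed
  have enc_in: "enc W (x, y) \<in> Under P" if "(x, y) \<in> W" for x y
    using that by (simp add: P_def)
  show thesis
  proof (rule that[of P p q "\<lambda>x y. enc W (x, y)", OF P p q])
    show "Base P = tag (Base X) (Base Y)"
      by (simp add: P_def)
    fix x y assume xy: "(x, y) \<in> W"
    show "enc W (x, y) \<in> Under P"
      by (rule enc_in[OF xy])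
    show "fn p (enc W (x, y)) = x" "fn q (enc W (x, y)) = y"
      using pq[OF enc_in[OF xy]] dec_enc[OF sW xy] by simp_all
    show "RL P (enc W (x, y)) = {m. set m \<subseteq> tag (Base X) (Base Y) \<and> lefts m \<in> RL X x \<and> rights m \<in> RL Y y}"
      using RLP(1)[OF enc_in[OF xy]] dec_enc[OF sW xy] by (simp add: R_def)
  next
    fix w assume w: "w \<in> Under P"
    show "(fn p w, fn q w) \<in> W"
      using RLP(2)[OF w] pq[OF w] by simp
    show "enc W (fn p w, fn q w) = w"
      using pq[OF w] enc_dec[of w W] w by (simp add: P_def)
  next
    fix Z f g assume f: "f \<in> hom H Z X" and g: "g \<in> hom H Z Y" and "\<forall>z\<in>Under Z. (fn f z, fn g z) \<in> W"
    then have fg: "(fn f z, fn g z) \<in> W" if "z \<in> Under Z" for z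
      using that by blast
    obtain F where F: "comp (Base Z) F" "\<And>xs. set xs \<subseteq> Base Z \<Longrightarrow> set (F xs) \<subseteq> Base X"
      "\<And>a xs. a \<in> Under Z \<Longrightarrow> xs \<in> RL Z a \<Longrightarrow> F xs \<in> RL X (fn f a)"
      using fn_tracking_obtain[OF f] by blast
    obtain G where G: "comp (Base Z) G" "\<And>xs. set xs \<subseteq> Base Z \<Longrightarrow> set (G xs) \<subseteq> Base Y"
      "\<And>a xs. a \<in> Under Z \<Longrightarrow> xs \<in> RL Z a \<Longrightarrow> G xs \<in> RL Y (fn g a)"
      using fn_tracking_obtain[OF g] by blast
    define h where "h = arr Z (\<lambda>z. enc W (fn f z, fn g z)) P"
    note Z = hom_H_obj(1)[OF f]
    have h: "h \<in> hom H Z P"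
      unfolding h_def
    proof (rule arr_homI[OF Z P, where F = "\<lambda>xs. map inl (F xs) @ map inr (G xs)"])
      show "enc W (fn f z, fn g z) \<in> Under P" if "z \<in> Under Z" for z
        by (rule enc_in[OF fg[OF that]])
      show "comp (Base Z) (\<lambda>xs. map inl (F xs) @ map inr (G xs))"
        by (rule comp_tag[OF F(1) G(1)])
      show "set (map inl (F xs) @ map inr (G xs)) \<subseteq> Base P" if "set xs \<subseteq> Base Z" for xs
        using set_tag[OF F(2)[OF that] G(2)[OF that]] by (simp add: P_def)
      show "map inl (F xs) @ map inr (G xs) \<in> RL P (enc W (fn f z, fn g z))" if "z \<in> Under Z" "xs \<in> RL Z z" for z xs
        using RLP(1)[OF enc_in[OF fg[OF that(1)]]] dec_enc[OF sW fg[OF that(1)]] F(3)[OF that] G(3)[OF that]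
          set_tag[OF F(2) G(2)] RL_Base[OF Z that] by (simp add: R_def)
    qed
    have "Cmp H p h = f"
      by (rule cmp_eqI[OF h p f]) (simp add: h_def pq enc_in fg dec_enc[OF sW])
    moreover have "Cmp H q h = g"
      by (rule cmp_eqI[OF h q g]) (simp add: h_def pq enc_in fg dec_enc[OF sW])
    ultimately show "\<exists>h. h \<in> hom H Z P \<and> Cmp H p h = f \<and> Cmp H q h = g"
      using h by blast
  next
    fix Z h h' assume h: "h \<in> hom H Z P" and h': "h' \<in> hom H Z P" and eq: "Cmp H p h = Cmp H p h'" "Cmp H q h = Cmp H q h'"
    show "h = h'"
      by (rule hom_eqI[OF h h'], rule inj)
        (use cmp_eqD[OF eq(1) h p h' p] cmp_eqD[OF eq(2) h q h' q] fn_in[OF h] fn_in[OF h'] in auto)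
  qed
qed

lemma has_products_H: "has_products H"
  unfolding has_products_def
proof (intro ballI)
  fix X Y assume X: "X \<in> Obj H" and Y: "Y \<in> Obj H"
  obtain P p q where P: "P \<in> Obj H" "p \<in> hom H P X" "q \<in> hom H P Y"
    and ex: "\<And>Z f g. f \<in> hom H Z X \<Longrightarrow> g \<in> hom H Z Y \<Longrightarrow> \<forall>z\<in>Under Z. (fn f z, fn g z) \<in> Under X \<times> Under Y \<Longrightarrow>
       \<exists>h. h \<in> hom H Z P \<and> Cmp H p h = f \<and> Cmp H q h = g"
    and un: "\<And>Z h h'. h \<in> hom H Z P \<Longrightarrow> h' \<in> hom H Z P \<Longrightarrow> Cmp H p h = Cmp H p h' \<Longrightarrow>
       Cmp H q h = Cmp H q h' \<Longrightarrow> h = h'"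
    by (rule subproduct[OF X Y subset_refl], rule that)
  have "\<exists>!h. h \<in> hom H Z P \<and> Cmp H p h = f \<and> Cmp H q h = g" if f: "f \<in> hom H Z X" and g: "g \<in> hom H Z Y" for Z f g
  proof -
    obtain h where h: "h \<in> hom H Z P" "Cmp H p h = f" "Cmp H q h = g"
      using ex[OF f g] fn_in[OF f] fn_in[OF g] by blast
    show ?thesis
    proof (rule ex1I[of _ h])
      show "h \<in> hom H Z P \<and> Cmp H p h = f \<and> Cmp H q h = g"
        using h by simp
      fix h' assume "h' \<in> hom H Z P \<and> Cmp H p h' = f \<and> Cmp H q h' = g"
      then show "h' = h"
        by (intro un[of h' Z h]) (simp_all add: h)
    qed
  qed
  then have "is_product H X Y P p q"
    using P X Y by (simp add: is_product_def)
  then show "\<exists>P p q. is_product H X Y P p q"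
    by blast
qed

text \<open>Besides its universal property, this pullback comes with explicit points and realizers.
  The exponentials are computed with it, and arbitrary pullbacks are compared to it.\<close>

lemma pullback_H:
  assumes f: "f \<in> hom H X S" and g: "g \<in> hom H Y S"
  obtains P p q pr where "is_pullback H f g P p q" "Base P = tag (Base X) (Base Y)"
    "\<And>x y. x \<in> Under X \<Longrightarrow> y \<in> Under Y \<Longrightarrow> fn f x = fn g y \<Longrightarrow>
      pr x y \<in> Under P \<and> fn p (pr x y) = x \<and> fn q (pr x y) = y \<and>
      RL P (pr x y) = {m. set m \<subseteq> tag (Base X) (Base Y) \<and> lefts m \<in> RL X x \<and> rights m \<in> RL Y y}"
    "\<And>w. w \<in> Under P \<Longrightarrow> pr (fn p w) (fn q w) = w"
proof -
  define W where "W = {(x, y). x \<in> Under X \<and> y \<in> Under Y \<and> fn f x = fn g y}"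
  have W: "W \<subseteq> Under X \<times> Under Y"
    by (auto simp: W_def)
  obtain P p q pr where P: "P \<in> Obj H" "p \<in> hom H P X" "q \<in> hom H P Y" "Base P = tag (Base X) (Base Y)"
    "\<And>x y. (x, y) \<in> W \<Longrightarrow> pr x y \<in> Under P" "\<And>x y. (x, y) \<in> W \<Longrightarrow> fn p (pr x y) = x"
    "\<And>x y. (x, y) \<in> W \<Longrightarrow> fn q (pr x y) = y"
    and Pw: "\<And>w. w \<in> Under P \<Longrightarrow> (fn p w, fn q w) \<in> W" "\<And>w. w \<in> Under P \<Longrightarrow> pr (fn p w) (fn q w) = w"
    and RLP: "\<And>x y. (x, y) \<in> W \<Longrightarrow> RL P (pr x y) =
       {m. set m \<subseteq> tag (Base X) (Base Y) \<and> lefts m \<in> RL X x \<and> rights m \<in> RL Y y}"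
    and ex: "\<And>Z f g. f \<in> hom H Z X \<Longrightarrow> g \<in> hom H Z Y \<Longrightarrow> \<forall>z\<in>Under Z. (fn f z, fn g z) \<in> W \<Longrightarrow>
       \<exists>h. h \<in> hom H Z P \<and> Cmp H p h = f \<and> Cmp H q h = g"
    and un: "\<And>Z h h'. h \<in> hom H Z P \<Longrightarrow> h' \<in> hom H Z P \<Longrightarrow> Cmp H p h = Cmp H p h' \<Longrightarrow>
       Cmp H q h = Cmp H q h' \<Longrightarrow> h = h'"
    by (rule subproduct[OF hom_H_obj(1)[OF f] hom_H_obj(1)[OF g] W], rule that)
  have "is_pullback H f g P p q"
  proof (rule is_pullbackI[OF f g P(1-3)])
    show "Cmp H f p = Cmp H g q"
      by (rule cmp_eqI[OF P(2) f cmp_H_hom[OF P(3) g]])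
        (use Pw(1) in \<open>auto simp: W_def fn_cmp[OF P(3) g]\<close>)
    fix Z a b assume a: "a \<in> hom H Z X" and b: "b \<in> hom H Z Y" and eq: "Cmp H f a = Cmp H g b"
    show "\<exists>h. h \<in> hom H Z P \<and> Cmp H p h = a \<and> Cmp H q h = b"
      by (rule ex[OF a b]) (simp add: W_def fn_in[OF a] fn_in[OF b] cmp_eqD[OF eq a f b g])
  qed (rule un)
  moreover have "(x, y) \<in> W" if "x \<in> Under X" "y \<in> Under Y" "fn f x = fn g y" for x y
    using that by (simp add: W_def)
  ultimately show thesis
    using P(4-7) Pw(2) RLP by (intro that[of P p q pr]) simp_all
qed

lemma has_pullbacks_H: "has_pullbacks H"
  unfolding has_pullbacks_def
proof (intro allI ballI)
  fix X Y S f g assume "f \<in> hom H X S" "g \<in> hom H Y S"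
  then obtain P p q where "is_pullback H f g P p q"
    by (rule pullback_H)
  then show "\<exists>P p q. is_pullback H f g P p q"
    by blast
qed

text \<open>Only the underlying set shrinks, while the base and the realizers are kept. The
  inclusion is tracked by the identity, and a factorization by any tracking of the given
  arrow.\<close>

lemma has_equalizers_H: "has_equalizers H"
  unfolding has_equalizers_def
proof (intro allI ballI)
  fix X Y f g assume f: "f \<in> hom H X Y" and g: "g \<in> hom H X Y"
  note X = hom_H_obj(1)[OF f]
  define W where "W = {x \<in> Under X. fn f x = fn g x}"
  define E where "E = mk W (Base X) (RL X)"
  have sW: "small W"
    by (rule small_subset[OF small_Under[OF X]]) (auto simp: W_def)
  have E: "E \<in> Obj H"
    unfolding E_def by (rule mk_obj[OF sW]) (auto simp: W_def RL_upclosed[OF X])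
  define e where "e = arr E (dec W) X"
  have decW: "dec W u \<in> Under X" "fn f (dec W u) = fn g (dec W u)" if "u \<in> Under E" for u
    using dec_in[of u W] that by (auto simp: E_def W_def)
  have e: "e \<in> hom H E X"
    unfolding e_def by (rule arr_homI[OF E X decW(1) comp_id]) (auto simp: E_def RL_mk)
  have "Cmp H f e = Cmp H g e"
    by (rule cmp_eqI[OF e f cmp_H_hom[OF e g]]) (simp add: fn_cmp[OF e g], simp add: e_def decW)
  moreover have "\<exists>!u. u \<in> hom H Z E \<and> Cmp H e u = h" if h: "h \<in> hom H Z X" and eq: "Cmp H f h = Cmp H g h" for Z h
  proof -
    have hW: "fn h z \<in> W" if "z \<in> Under Z" for z
      using fn_in[OF h that] cmp_eqD[OF eq h f h g that] by (simp add: W_def)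
    obtain F where F: "comp (Base Z) F" "\<And>xs. set xs \<subseteq> Base Z \<Longrightarrow> set (F xs) \<subseteq> Base X"
      "\<And>a xs. a \<in> Under Z \<Longrightarrow> xs \<in> RL Z a \<Longrightarrow> F xs \<in> RL X (fn h a)"
      using fn_tracking_obtain[OF h] by blast
    define u where "u = arr Z (\<lambda>z. enc W (fn h z)) E"
    have u: "u \<in> hom H Z E"
      unfolding u_def
      by (rule arr_homI[OF hom_H_obj(1)[OF h] E _ F(1)])
        (use F(2,3) in \<open>auto simp: E_def hW RL_mk dec_enc[OF sW hW]\<close>)
    show ?thesis
    proof (rule ex1I[of _ u])
      have "Cmp H e u = h"
        by (rule cmp_eqI[OF u e h]) (simp add: u_def e_def E_def hW dec_enc[OF sW])
      with u show "u \<in> hom H Z E \<and> Cmp H e u = h" ..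
      fix v assume v: "v \<in> hom H Z E \<and> Cmp H e v = h"
      then have vE: "fn v z \<in> Under E" if "z \<in> Under Z" for z
        using fn_in that by blast
      have "fn h z = dec W (fn v z)" if "z \<in> Under Z" for z
        using v fn_cmp[of v Z E e X z] e that vE[OF that] by (auto simp: e_def)
      then show "v = u"
        using v vE enc_dec[of _ W] by (intro hom_eqI[OF _ u]) (auto simp: u_def E_def)
    qed
  qed
  ultimately show "\<exists>E. \<exists>e\<in>hom H E X. Cmp H f e = Cmp H g e \<and>
       (\<forall>Z. \<forall>h\<in>hom H Z X. Cmp H f h = Cmp H g h \<longrightarrow> (\<exists>!u. u \<in> hom H Z E \<and> Cmp H e u = h))"
    using e by (intro exI[of _ E] bexI[of _ e]) simp_all
qed

section \<open>Colimits and the natural numbers object\<close>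

text \<open>Even with no elements to realize, the code of the empty sequence lies over the empty
  base and must have a value; the constant program takes care of it.\<close>

lemma initial_H:
  fixes I :: "('u, 'p) hasm"
  defines "I \<equiv> mk ({} :: unit set) {} (\<lambda>_. {[]})"
  shows "is_terminal (opp H) I"
  unfolding is_terminal_def opp_simps
proof (intro conjI ballI)
  show I: "I \<in> Obj H"
    unfolding I_def by (rule mk_obj[OF small_unit]) auto
  fix X assume X: "X \<in> Obj H"
  have i: "arr I (\<lambda>_. undefined) X \<in> hom H I X"
    by (rule arr_homI[OF I X _ comp_const[of _ "[]"]]) (auto simp: I_def)
  show "\<exists>!f. f \<in> hom H I X"
  proof (rule ex1I)
    show "arr I (\<lambda>_. undefined) X \<in> hom H I X"
      by (rule i)
    fix f assume f: "f \<in> hom H I X"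
    show "f = arr I (\<lambda>_. undefined) X"
      by (rule hom_eqI[OF f i]) (simp add: I_def)
  qed
qed

lemma has_coproducts_H: "has_products (opp H)"
  unfolding has_products_def
proof (intro ballI)
  fix X Y assume "X \<in> Obj (opp H)" "Y \<in> Obj (opp H)"
  then have X: "X \<in> Obj H" and Y: "Y \<in> Obj H"
    by simp_all
  define B where "B = tag (Base X) (Base Y)"
  \<comment> \<open>Right-tagged entries of a realizer of \<open>Inl x\<close> are arbitrary, and
    likewise on the other side, so elements of different summands may share realizers.\<close>
  define R where "R = case_sum (\<lambda>x. {m. set m \<subseteq> B \<and> lefts m \<in> RL X x}) (\<lambda>y. {m. set m \<subseteq> B \<and> rights m \<in> RL Y y})"
  define W where "W = Under X <+> Under Y"
  define P where "P = mk W B R"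
  have sW: "small W"
    unfolding W_def by (rule small_Plus[OF small_Under[OF X] small_Under[OF Y]])
  have mapB: "set (map inl xs) \<subseteq> B" if "set xs \<subseteq> Base X" for xs
    using set_tag[OF that, of "[]" "Base Y"] by (simp add: B_def)
  have mapB': "set (map inr ys) \<subseteq> B" if "set ys \<subseteq> Base Y" for ys
    using set_tag[OF _ that, of "[]" "Base X"] by (simp add: B_def)
  have "upclosed B (R w)" if "w \<in> W" for w
  proof -
    consider x where "w = Inl x" "x \<in> Under X" | y where "w = Inr y" "y \<in> Under Y"
      using \<open>w \<in> W\<close> by (auto simp: W_def)
    then show ?thesis
    proof cases
      case (1 x)
      obtain xs where xs: "xs \<in> RL X x"
        using RL_obtain[OF X 1(2)] .
      have "map inl xs \<in> R w"
        using xs mapB[OF RL_Base[OF X 1(2) xs]] by (simp add: R_def 1)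
      moreover have "n \<in> R w" if "m \<in> R w" "set n \<subseteq> B" "set m \<subseteq> set n" for m n
        using that RL_mono[OF X 1(2) _ lefts_mono[OF that(3)] set_lefts_tag[OF that(2)[unfolded B_def]]]
        by (simp add: R_def 1)
      moreover have "set m \<subseteq> B" if "m \<in> R w" for m
        using that by (simp add: R_def 1)
      ultimately show ?thesis
        unfolding upclosed_def by blast
    next
      case (2 y)
      obtain ys where ys: "ys \<in> RL Y y"
        using RL_obtain[OF Y 2(2)] .
      have "map inr ys \<in> R w"
        using ys mapB'[OF RL_Base[OF Y 2(2) ys]] by (simp add: R_def 2)
      moreover have "n \<in> R w" if "m \<in> R w" "set n \<subseteq> B" "set m \<subseteq> set n" for m n
        using that RL_mono[OF Y 2(2) _ rights_mono[OF that(3)] set_rights_tag[OF that(2)[unfolded B_def]]]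
        by (simp add: R_def 2)
      moreover have "set m \<subseteq> B" if "m \<in> R w" for m
        using that by (simp add: R_def 2)
      ultimately show ?thesis
        unfolding upclosed_def by blast
    qed
  qed
  then have P: "P \<in> Obj H"
    unfolding P_def by (rule mk_obj[OF sW])
  have UP: "enc W w \<in> Under P" "RL P (enc W w) = R w" if "w \<in> W" for w
    using that RL_mk[of "enc W w" W] dec_enc[OF sW that] by (simp_all add: P_def)
  have InlW: "Inl x \<in> W" if "x \<in> Under X" for x
    using that by (auto simp: W_def)
  have InrW: "Inr y \<in> W" if "y \<in> Under Y" for y
    using that by (auto simp: W_def)
  define i where "i = arr X (\<lambda>x. enc W (Inl x)) P"
  define j where "j = arr Y (\<lambda>y. enc W (Inr y)) P"
  have i: "i \<in> hom H X P"
    unfolding i_def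
  proof (rule arr_homI[OF X P UP(1)[OF InlW] comp_map[OF inl(1) comp_id]])
    show "set (map inl xs) \<subseteq> Base P" if "set xs \<subseteq> Base X" for xs
      using mapB[OF that] by (simp add: P_def)
    show "map inl xs \<in> RL P (enc W (Inl x))" if "x \<in> Under X" "xs \<in> RL X x" for x xs
      using UP(2)[OF InlW[OF that(1)]] that mapB[OF RL_Base[OF X that]] by (simp add: R_def)
  qed
  have j: "j \<in> hom H Y P"
    unfolding j_def
  proof (rule arr_homI[OF Y P UP(1)[OF InrW] comp_map[OF inr(1) comp_id]])
    show "set (map inr ys) \<subseteq> Base P" if "set ys \<subseteq> Base Y" for ys
      using mapB'[OF that] by (simp add: P_def)
    show "map inr ys \<in> RL P (enc W (Inr y))" if "y \<in> Under Y" "ys \<in> RL Y y" for y ys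
      using UP(2)[OF InrW[OF that(1)]] that mapB'[OF RL_Base[OF Y that]] by (simp add: R_def)
  qed
  have "\<exists>!h. h \<in> hom H P Z \<and> Cmp H h i = f \<and> Cmp H h j = g" if f: "f \<in> hom H X Z" and g: "g \<in> hom H Y Z" for Z f g
  proof -
    obtain F where F: "comp (Base X) F" "\<And>xs. set xs \<subseteq> Base X \<Longrightarrow> set (F xs) \<subseteq> Base Z"
      "\<And>a xs. a \<in> Under X \<Longrightarrow> xs \<in> RL X a \<Longrightarrow> F xs \<in> RL Z (fn f a)"
      using fn_tracking_obtain[OF f] by blast
    obtain G where G: "comp (Base Y) G" "\<And>xs. set xs \<subseteq> Base Y \<Longrightarrow> set (G xs) \<subseteq> Base Z"
      "\<And>a xs. a \<in> Under Y \<Longrightarrow> xs \<in> RL Y a \<Longrightarrow> G xs \<in> RL Z (fn g a)"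
      using fn_tracking_obtain[OF g] by blast
    note Z = hom_H_obj(2)[OF f]
    define \<phi> where "\<phi> u = case_sum (fn f) (fn g) (dec W u)" for u
    define h where "h = arr P \<phi> Z"
    have \<phi>: "\<phi> (enc W (Inl x)) = fn f x" if "x \<in> Under X" for x
      by (simp add: \<phi>_def dec_enc[OF sW InlW[OF that]])
    have \<phi>': "\<phi> (enc W (Inr y)) = fn g y" if "y \<in> Under Y" for y
      by (simp add: \<phi>_def dec_enc[OF sW InrW[OF that]])
    have Pcases: thesis if "u \<in> Under P" "\<And>x. u = enc W (Inl x) \<Longrightarrow> x \<in> Under X \<Longrightarrow> thesis"
      "\<And>y. u = enc W (Inr y) \<Longrightarrow> y \<in> Under Y \<Longrightarrow> thesis" for u thesis
      using that by (auto simp: P_def W_def)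
    have h: "h \<in> hom H P Z"
      unfolding h_def
    \<comment> \<open>One of the two branches receives entries that may realize nothing. Totality of
      \<open>F\<close> and \<open>G\<close> on their bases makes it halt with entries over
      \<open>Base Z\<close>, and the branch for the right summand then decides by upward
      closure.\<close>
    proof (rule arr_homI[OF P Z, where F = "\<lambda>m. F (lefts m) @ G (rights m)"])
      show "\<phi> u \<in> Under Z" if "u \<in> Under P" for u
        using that by (rule Pcases) (simp_all add: \<phi> \<phi>' fn_in[OF f] fn_in[OF g])
      show "comp (Base P) (\<lambda>m. F (lefts m) @ G (rights m))"
        unfolding P_def mk_simps B_def
        by (rule comp_append[OF comp_comp[OF comp_lefts F(1) set_lefts_tag] comp_comp[OF comp_rights G(1) set_rights_tag]])
      show sub: "set (F (lefts m) @ G (rights m)) \<subseteq> Base Z" if "set m \<subseteq> Base P" for m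
        using F(2)[OF set_lefts_tag] G(2)[OF set_rights_tag] that by (simp add: P_def B_def)
      fix u m assume u: "u \<in> Under P" and m: "m \<in> RL P u"
      have mB: "set m \<subseteq> Base P"
        by (rule RL_Base[OF P u m])
      show "F (lefts m) @ G (rights m) \<in> RL Z (\<phi> u)"
        using u
      proof (rule Pcases)
        fix x assume x: "u = enc W (Inl x)" "x \<in> Under X"
        then have FX: "F (lefts m) \<in> RL Z (fn f x)"
          using m UP(2)[OF InlW[OF x(2)]] by (intro F(3)) (simp_all add: R_def)
        show ?thesis
          unfolding x(1) \<phi>[OF x(2)] by (rule RL_mono[OF Z fn_in[OF f x(2)] FX _ sub[OF mB]]) simp
      next
        fix y assume y: "u = enc W (Inr y)" "y \<in> Under Y"
        then have GY: "G (rights m) \<in> RL Z (fn g y)"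
          using m UP(2)[OF InrW[OF y(2)]] by (intro G(3)) (simp_all add: R_def)
        show ?thesis
          unfolding y(1) \<phi>'[OF y(2)] by (rule RL_mono[OF Z fn_in[OF g y(2)] GY _ sub[OF mB]]) simp
      qed
    qed
    show ?thesis
    proof (rule ex1I[of _ h])
      have "Cmp H h i = f"
        by (rule cmp_eqI[OF i h f]) (simp add: h_def i_def UP(1) InlW \<phi>)
      moreover have "Cmp H h j = g"
        by (rule cmp_eqI[OF j h g]) (simp add: h_def j_def UP(1) InrW \<phi>')
      ultimately show "h \<in> hom H P Z \<and> Cmp H h i = f \<and> Cmp H h j = g"
        using h by simp
      fix h' assume h': "h' \<in> hom H P Z \<and> Cmp H h' i = f \<and> Cmp H h' j = g"
      then have h'_hom: "h' \<in> hom H P Z"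
        by simp
      have eq: "fn h' (enc W (Inl x)) = fn f x" if "x \<in> Under X" for x
        using fn_cmp[OF i h'_hom that] h' that by (simp add: i_def)
      have eq': "fn h' (enc W (Inr y)) = fn g y" if "y \<in> Under Y" for y
        using fn_cmp[OF j h'_hom that] h' that by (simp add: j_def)
      show "h' = h"
      proof (rule hom_eqI[OF h'_hom h])
        fix u assume u: "u \<in> Under P"
        then have "fn h' u = \<phi> u"
          by (rule Pcases) (simp_all add: eq eq' \<phi> \<phi>')
        with u show "fn h' u = fn h u"
          by (simp add: h_def)
      qed
    qed
  qed
  then have "is_product (opp H) X Y P i j"
    using X Y P i j by (simp add: is_product_def)
  then show "\<exists>P p q. is_product (opp H) X Y P p q"
    by blast
qed

text \<open>The class of \<open>x\<close> in the quotient by the equivalence relation that two arrows generate: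
  no set closed under that relation separates \<open>x\<close> from its members.\<close>

definition cls :: "('u, 'p) hasm \<Rightarrow> ('u, 'p) hasm \<Rightarrow> ('u \<Rightarrow> 'u) \<Rightarrow> ('u \<Rightarrow> 'u) \<Rightarrow> 'u \<Rightarrow> 'u set" where
  "cls A B f g x = {y \<in> Under B. \<forall>S. (\<forall>a\<in>Under A. f a \<in> S \<longleftrightarrow> g a \<in> S) \<longrightarrow> (x \<in> S \<longleftrightarrow> y \<in> S)}"

lemma cls_refl: "x \<in> Under B \<Longrightarrow> x \<in> cls A B f g x"
  by (simp add: cls_def)

lemma cls_eq: "y \<in> cls A B f g x \<Longrightarrow> cls A B f g y = cls A B f g x"
  unfolding cls_def by blast

lemma cls_glue:
  assumes "a \<in> Under A" "f a \<in> Under B" "g a \<in> Under B"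
  shows "cls A B f g (f a) = cls A B f g (g a)"
  using assms by (intro cls_eq[symmetric]) (simp add: cls_def)

text \<open>The fibre of \<open>h\<close> through \<open>x\<close> is closed under the relation,
  hence it does not separate \<open>x\<close> from \<open>y\<close>.\<close>

lemma cls_invariant:
  assumes "y \<in> cls A B f g x" "\<And>a. a \<in> Under A \<Longrightarrow> h (f a) = h (g a)"
  shows "h y = h x"
proof -
  have "\<forall>a\<in>Under A. f a \<in> {z. h z = h x} \<longleftrightarrow> g a \<in> {z. h z = h x}"
    using assms(2) by simp
  then have "x \<in> {z. h z = h x} \<longleftrightarrow> y \<in> {z. h z = h x}"
    using assms(1) unfolding cls_def by blast
  then show ?thesis by simp
qed

lemma has_coequalizers_H: "has_equalizers (opp H)"
  unfolding has_equalizers_def opp_simps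
proof (intro allI ballI)
  fix B A f g assume f: "f \<in> hom H A B" and g: "g \<in> hom H A B"
  note B = hom_H_obj(2)[OF f]
  define cl where "cl = cls A B (fn f) (fn g)"
  define W where "W = cl ` Under B"
  define R where "R c = (\<Union>x\<in>c. RL B x)" for c
  define Q where "Q = mk W (Base B) R"
  have sub: "c \<subseteq> Under B" if "c \<in> W" for c
    using that by (auto simp: W_def cl_def cls_def)
  have sW: "small W"
    by (rule small_subset[OF small_Pow[OF small_Under[OF B]]]) (use sub in blast)
  have "upclosed (Base B) (R c)" if c: "c \<in> W" for c
  proof -
    obtain x where x: "x \<in> c" "x \<in> Under B"
      using c cls_refl unfolding W_def cl_def by blast
    obtain xs where "xs \<in> RL B x"
      using RL_obtain[OF B x(2)] .
    then have "R c \<noteq> {}"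
      using x(1) by (auto simp: R_def)
    moreover have "set m \<subseteq> Base B" if "m \<in> R c" for m
      using that sub[OF c] RL_Base[OF B] unfolding R_def by blast
    moreover have "n \<in> R c" if "m \<in> R c" "set n \<subseteq> Base B" "set m \<subseteq> set n" for m n
      using that(1) sub[OF c] RL_mono[OF B _ _ that(3,2)] unfolding R_def by blast
    ultimately show ?thesis
      unfolding upclosed_def by blast
  qed
  then have Q: "Q \<in> Obj H"
    unfolding Q_def by (rule mk_obj[OF sW])
  define q where "q = arr B (\<lambda>x. enc W (cl x)) Q"
  have clW: "cl x \<in> W" if "x \<in> Under B" for x
    using that by (simp add: W_def)
  have q: "q \<in> hom H B Q"
    unfolding q_def
  proof (rule arr_homI[OF B Q _ comp_id])
    fix x assume x: "x \<in> Under B"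
    then show "enc W (cl x) \<in> Under Q"
      by (simp add: Q_def clW)
    fix xs assume "xs \<in> RL B x"
    then show "xs \<in> RL Q (enc W (cl x))"
      using clW[OF x] cls_refl[OF x] by (auto simp: Q_def RL_mk dec_enc[OF sW] R_def cl_def)
  qed (simp add: Q_def)
  have glue: "cl (fn f a) = cl (fn g a)" if "a \<in> Under A" for a
    unfolding cl_def using that fn_in[OF f that] fn_in[OF g that] by (rule cls_glue)
  have "Cmp H q f = Cmp H q g"
    by (rule cmp_eqI[OF f q cmp_H_hom[OF g q]])
      (simp add: fn_cmp[OF g q], simp add: q_def fn_in[OF f] fn_in[OF g] glue)
  moreover have "\<exists>!u. u \<in> hom H Q Z \<and> Cmp H u q = h" if h: "h \<in> hom H B Z" and eq: "Cmp H h f = Cmp H h g" for Z h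
  proof -
    have inv: "fn h y = fn h x" if "y \<in> cl x" for x y
      using that unfolding cl_def by (rule cls_invariant) (rule cmp_eqD[OF eq f h g h])
    \<comment> \<open>The choice of a representative is immaterial, as \<open>h\<close> is constant
      on classes by \<open>inv\<close>.\<close>
    define \<phi> where "\<phi> u = fn h (SOME x. x \<in> dec W u)" for u
    have \<phi>: "\<phi> u = fn h x" if "u \<in> Under Q" "x \<in> dec W u" for u x
    proof -
      have "dec W u \<in> W"
        using that(1) by (intro dec_in) (simp add: Q_def)
      then obtain z where z: "dec W u = cl z"
        unfolding W_def by blast
      have "(SOME x. x \<in> dec W u) \<in> dec W u"
        using that(2) by (rule someI)
      then show ?thesis
        using inv[of _ z] that(2) unfolding \<phi>_def z by metis
    qed
    have dq: "cl x = dec W (fn q x)" "fn q x \<in> Under Q" if "x \<in> Under B" for x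
      using that clW[OF that] dec_enc[OF sW clW[OF that]] by (simp_all add: q_def Q_def)
    have qsurj: "\<exists>x. x \<in> Under B \<and> u = fn q x" if u: "u \<in> Under Q" for u
    proof -
      obtain c where "u = enc W c" "c \<in> W"
        using u by (auto simp: Q_def)
      then obtain x where "x \<in> Under B" "u = enc W (cl x)"
        by (auto simp: W_def)
      then show ?thesis
        by (intro exI[of _ x]) (simp add: q_def)
    qed
    have \<phi>q: "\<phi> (fn q x) = fn h x" if "x \<in> Under B" for x
      using that by (intro \<phi> dq(2)) (simp_all add: dq(1)[symmetric] cls_refl cl_def)
    obtain F where F: "comp (Base B) F" "\<And>xs. set xs \<subseteq> Base B \<Longrightarrow> set (F xs) \<subseteq> Base Z"
      "\<And>a xs. a \<in> Under B \<Longrightarrow> xs \<in> RL B a \<Longrightarrow> F xs \<in> RL Z (fn h a)"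
      using fn_tracking_obtain[OF h] by blast
    define u where "u = arr Q \<phi> Z"
    have u: "u \<in> hom H Q Z"
      unfolding u_def
    \<comment> \<open>The tracking \<open>F\<close> of \<open>h\<close> serves unchanged: a realizer
      of a class is one of some member, and \<open>h\<close> sends this member to the value on the
      class.\<close>
    proof (rule arr_homI[OF Q hom_H_obj(2)[OF h], where F = F])
      show "comp (Base Q) F" "\<And>xs. set xs \<subseteq> Base Q \<Longrightarrow> set (F xs) \<subseteq> Base Z"
        using F by (simp_all add: Q_def)
      fix v assume v: "v \<in> Under Q"
      show "\<phi> v \<in> Under Z"
        using qsurj[OF v] \<phi>q fn_in[OF h] by auto
      fix m assume "m \<in> RL Q v"
      then have "m \<in> R (dec W v)"
        using v by (simp add: Q_def RL_mk)
      then obtain x where x: "x \<in> dec W v" "m \<in> RL B x"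
        by (auto simp: R_def)
      then have "x \<in> Under B"
        using sub[OF dec_in[of v W]] v by (auto simp: Q_def)
      then show "F m \<in> RL Z (\<phi> v)"
        unfolding \<phi>[OF v x(1)] using x(2) by (rule F(3))
    qed
    show ?thesis
    proof (rule ex1I[of _ u])
      have "Cmp H u q = h"
        by (rule cmp_eqI[OF q u h]) (simp add: u_def dq(2) \<phi>q)
      then show "u \<in> hom H Q Z \<and> Cmp H u q = h"
        using u by simp
      fix v assume "v \<in> hom H Q Z \<and> Cmp H v q = h"
      then have v: "v \<in> hom H Q Z" "Cmp H v q = h"
        by simp_all
      have "fn v (fn q x) = fn u (fn q x)" if "x \<in> Under B" for x
        using fn_cmp[OF q v(1) that] v(2) \<phi>q[OF that] dq(2)[OF that] by (simp add: u_def)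
      then show "v = u"
        using qsurj by (intro hom_eqI[OF v(1) u]) blast
    qed
  qed
  ultimately show "\<exists>E. \<exists>e\<in>hom H B E. Cmp H e f = Cmp H e g \<and>
       (\<forall>Z. \<forall>h\<in>hom H B Z. Cmp H h f = Cmp H h g \<longrightarrow> (\<exists>!u. u \<in> hom H E Z \<and> Cmp H u e = h))"
    using q by (intro exI[of _ Q] bexI[of _ q]) simp_all
qed

lemma has_nno_H: "has_nno H"
proof -
  define T where "T = (mk {()} {} (\<lambda>_. {[]}) :: ('u, 'p) hasm)"
  define R where "R n = {m. set m \<subseteq> range church \<and> church n \<in> set m}" for n
  define N where "N = mk (UNIV :: nat set) (range church) R"
  define nu where "nu = enc (UNIV :: nat set)"
  have T: "is_terminal H T"
    unfolding T_def by (rule terminal_H)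
  then have TObj: "T \<in> Obj H"
    by (simp add: is_terminal_def)
  have N: "N \<in> Obj H"
    unfolding N_def by (rule mk_obj[OF small_nat]) (auto simp: upclosed_def R_def intro!: exI[of _ "[church _]"])
  have UN: "Under N = range nu" and BN: "Base N = range church"
    by (simp_all add: N_def nu_def)
  have RLN: "RL N (nu n) = R n" for n
    by (simp add: N_def nu_def RL_mk dec_enc[OF small_nat])
  have dnu: "dec UNIV (nu n) = n" for n
    by (simp add: nu_def dec_enc[OF small_nat])
  define pt where "pt = enc {()} ()"
  have UT: "Under T = {pt}" "Base T = {}" "RL T pt = {[]}"
    by (simp_all add: T_def pt_def RL_mk)
  define z where "z = arr T (\<lambda>_. nu 0) N"
  define sc where "sc = arr N (\<lambda>u. nu (Suc (dec UNIV u))) N"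
  have z: "z \<in> hom H T N"
    unfolding z_def
    by (rule arr_homI[OF TObj N _ comp_const[of _ "[church 0]"]]) (auto simp: UN UT RLN R_def BN)
  obtain t where t: "\<And>n. app t (church n) = Some (church (Suc n))"
    using church(1) by blast
  \<comment> \<open>The successor is read off from the program \<open>t\<close>, so that it is a
    function of the numeral; off the numerals \<open>the\<close> may be arbitrary.\<close>
  define cs where "cs c = the (app t c)" for c
  have cs: "cs (church n) = church (Suc n)" for n
    by (simp add: cs_def t)
  obtain e where e: "\<And>x. app e x = Some (code [x])"
    using code_singleton by blast
  obtain d where d: "\<And>x w. ev (case_nat x (\<lambda>_. k)) (Ap (Con e) (Ap (Con t) (Var 0))) = Some w
      \<Longrightarrow> app d x = Some w"
    using comb1 by blast
  have "app d c = Some (code [cs c])" if "c \<in> range church" for c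
    using that by (auto simp: cs t e intro!: d)
  from comp_concat_map[OF this comp_id, of "range church"]
  have comp_cs: "comp (range church) (\<lambda>m. map cs m)"
    by simp
  have sc: "sc \<in> hom H N N"
    unfolding sc_def
  proof (rule arr_homI[OF N N, where F = "\<lambda>m. map cs m"])
    show "nu (Suc (dec UNIV u)) \<in> Under N" for u
      by (simp add: UN)
    show "comp (Base N) (\<lambda>m. map cs m)"
      unfolding BN by (rule comp_cs)
    show sub: "set (map cs m) \<subseteq> Base N" if "set m \<subseteq> Base N" for m
      using that cs by (fastforce simp: BN)
    fix u m assume u: "u \<in> Under N" and m: "m \<in> RL N u"
    obtain n where n: "u = nu n"
      using u by (auto simp: UN)
    have "church (Suc n) \<in> set (map cs m)"
      using m unfolding n RLN R_def set_map cs[symmetric] by blast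
    then show "map cs m \<in> RL N (nu (Suc (dec UNIV u)))"
      using sub[OF RL_Base[OF N u m]] by (simp add: n dnu RLN R_def BN)
  qed
  have "\<exists>!h. h \<in> hom H N X \<and> Cmp H h z = x \<and> Cmp H h sc = Cmp H f h"
    if x: "x \<in> hom H T X" and f: "f \<in> hom H X X" for X x f
  proof -
    note X = hom_H_obj(1)[OF f]
    define x0 where "x0 = fn x pt"
    have x0: "x0 \<in> Under X"
      using fn_in[OF x] by (simp add: UT x0_def)
    have it_in: "(fn f ^^ n) x0 \<in> Under X" for n
      by (induction n) (simp_all add: x0 fn_in[OF f])
    obtain xs where xs: "xs \<in> RL X x0"
      using RL_obtain[OF X x0] .
    obtain F where F: "comp (Base X) F" "\<And>xs. set xs \<subseteq> Base X \<Longrightarrow> set (F xs) \<subseteq> Base X"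
      "\<And>a xs. a \<in> Under X \<Longrightarrow> xs \<in> RL X a \<Longrightarrow> F xs \<in> RL X (fn f a)"
      using fn_tracking_obtain[OF f] by blast
    obtain it where it: "comp (range church) (\<lambda>m. concat (map it m))" "\<And>n. it (church n) = (F ^^ n) xs"
      using comp_iterate[OF F(1,2) RL_Base[OF X x0 xs]] by blast
    have it_RL: "(F ^^ n) xs \<in> RL X ((fn f ^^ n) x0)" for n
      by (induction n) (simp_all add: xs F(3) it_in)
    define h where "h = arr N (\<lambda>u. (fn f ^^ dec UNIV u) x0) X"
    have h: "h \<in> hom H N X"
      unfolding h_def
    \<comment> \<open>Every numeral in \<open>m\<close> is iterated. The results of the irrelevant
      ones stay over \<open>Base X\<close>, and the one belonging to the number in question
      contributes all the entries that are needed.\<close>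
    proof (rule arr_homI[OF N X it_in, where F = "\<lambda>m. concat (map it m)"])
      show "comp (Base N) (\<lambda>m. concat (map it m))"
        using it(1) by (simp add: N_def)
      show sub: "set (concat (map it m)) \<subseteq> Base X" if "set m \<subseteq> Base N" for m
      proof -
        have "set (it c) \<subseteq> Base X" if "c \<in> range church" for c
          using that RL_Base[OF X it_in it_RL] by (fastforce simp: it(2))
        then show ?thesis
          using that unfolding BN by fastforce
      qed
      fix u m assume u: "u \<in> Under N" and m: "m \<in> RL N u"
      obtain n where n: "u = nu n"
        using u by (auto simp: UN)
      have "church n \<in> set m"
        using m by (simp add: n RLN R_def)
      then have "set ((F ^^ n) xs) \<subseteq> set (concat (map it m))"
        using it(2)[of n] by auto
      then show "concat (map it m) \<in> RL X ((fn f ^^ dec UNIV u) x0)"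
        unfolding n dnu using sub[OF RL_Base[OF N u m]] by (rule RL_mono[OF X it_in it_RL])
    qed
    have hn: "fn h (nu n) = (fn f ^^ n) x0" for n
      by (simp add: h_def UN dnu)
    have zs: "fn z pt = nu 0" "fn sc (nu n) = nu (Suc n)" for n
      by (simp_all add: z_def sc_def UT UN dnu)
    show ?thesis
    proof (rule ex1I[of _ h])
      have "Cmp H h z = x"
        by (rule cmp_eqI[OF z h x]) (simp add: UT zs hn x0_def)
      moreover have "Cmp H h sc = Cmp H f h"
      proof (rule cmp_eqI[OF sc h cmp_H_hom[OF h f]])
        fix u assume u: "u \<in> Under N"
        then obtain n where n: "u = nu n"
          by (auto simp: UN)
        show "fn h (fn sc u) = fn (Cmp H f h) u"
          unfolding fn_cmp[OF h f u] unfolding n zs hn by simp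
      qed
      ultimately show "h \<in> hom H N X \<and> Cmp H h z = x \<and> Cmp H h sc = Cmp H f h"
        using h by simp
      fix h' assume "h' \<in> hom H N X \<and> Cmp H h' z = x \<and> Cmp H h' sc = Cmp H f h'"
      then have h': "h' \<in> hom H N X" "Cmp H h' z = x" "Cmp H h' sc = Cmp H f h'"
        by simp_all
      have "fn h' (nu n) = (fn f ^^ n) x0" for n
      proof (induction n)
        case 0
        show ?case
          using fn_cmp[OF z h'(1), of pt] h'(2) by (simp add: UT zs x0_def)
      next
        case (Suc n)
        show ?case
          using cmp_eqD[OF h'(3) sc h'(1) h'(1) f, of "nu n"] Suc by (simp add: UN zs)
      qed
      then show "h' = h"
        by (intro hom_eqI[OF h'(1) h]) (auto simp: UN hn)
    qed
  qed
  then have "is_nno H T N z sc"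
    using T z sc by (simp add: is_nno_def)
  then show ?thesis
    unfolding has_nno_def by blast
qed

section \<open>Exponentials in slices\<close>

lemma local_exp_H:
  assumes f: "f \<in> hom H A S" and g: "g \<in> hom H B S"
  obtains E e P p q eval where "is_local_exp H S f B g E e P p q eval"
proof -
  note A = hom_H_obj(1)[OF f] and B = hom_H_obj(1)[OF g] and S = hom_H_obj(2)[OF f]
  define fib where "fib s = {a \<in> Under A. fn f a = s}" for s
  define T where "T = total (Base A) (Base B)"
  define app_all where "app_all N xs = concat (map (\<lambda>n. run n xs) N)" for N xs
  \<comment> \<open>Only the concatenated output is judged: no single program in \<open>N\<close>
    has to track \<open>h\<close>, and different ones may be responsible for different
    arguments.\<close>
  define works where "works s h N \<longleftrightarrow> (\<forall>a\<in>fib s. \<forall>xs\<in>RL A a. app_all N xs \<in> RL B (h a))" for s and h :: "'u \<Rightarrow> 'u" and N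
  \<comment> \<open>Asking for some working list \<open>N\<close> makes the realizer sets of
    \<open>E\<close> inhabited.\<close>
  define W where "W = {(s, h). s \<in> Under S \<and> h \<in> fib s \<rightarrow>\<^sub>E {b \<in> Under B. fn g b = s} \<and>
    (\<exists>N. set N \<subseteq> T \<and> works s h N)}"
  define D where "D = tag (Base S) T"
  define R where "R = (\<lambda>(s, h). {m. set m \<subseteq> D \<and> lefts m \<in> RL S s \<and> works s h (rights m)})"
  define E where "E = mk W D R"
  have app_all_Base: "set (app_all N xs) \<subseteq> Base B" if "set N \<subseteq> T" "set xs \<subseteq> Base A" for N xs
    using total_run(1)[OF _ that(2), where B = "Base B"] that(1) unfolding app_all_def T_def by fastforce
  \<comment> \<open>Further programs only add entries to the output; membership in \<open>T\<close>
    keeps these over \<open>Base B\<close>, where upward closure absorbs them.\<close>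
  have works_mono: "works s h N'" if sh: "(s, h) \<in> W" and "works s h N" "set N \<subseteq> set N'" "set N' \<subseteq> T" for s h N N'
    unfolding works_def
  proof (intro ballI)
    fix a xs assume a: "a \<in> fib s" and xs: "xs \<in> RL A a"
    have h: "h a \<in> Under B"
      using sh a by (auto simp: W_def PiE_def Pi_def)
    have aA: "a \<in> Under A"
      using a by (simp add: fib_def)
    show "app_all N' xs \<in> RL B (h a)"
    proof (rule RL_mono[OF B h])
      show "app_all N xs \<in> RL B (h a)"
        using \<open>works s h N\<close> a xs by (simp add: works_def)
      show "set (app_all N xs) \<subseteq> set (app_all N' xs)"
        using \<open>set N \<subseteq> set N'\<close> by (auto simp: app_all_def)
      show "set (app_all N' xs) \<subseteq> Base B"
        by (rule app_all_Base[OF \<open>set N' \<subseteq> T\<close> RL_Base[OF A aA xs]])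
    qed
  qed
  \<comment> \<open>A pair in \<open>W\<close> is determined by the point and the graph of the
    function, because the function is extensional on the fibre.\<close>
  have sW: "small W"
  proof (rule small_inj[OF small_Times[OF small_Under[OF S]
          small_Pow[OF small_Times[OF small_Under[OF A] small_Under[OF B]]]]])
    let ?gr = "\<lambda>(s, h). (s, (\<lambda>a. (a, h a)) ` fib s)"
    show "?gr ` W \<subseteq> Under S \<times> Pow (Under A \<times> Under B)"
      by (auto simp: W_def fib_def PiE_def Pi_def)
    show "inj_on ?gr W"
    proof (rule inj_onI)
      fix v w assume v: "v \<in> W" and w: "w \<in> W" and eq: "?gr v = ?gr w"
      obtain s h h' where sh: "v = (s, h)" "w = (s, h')"
        using eq by (cases v; cases w) auto
      have gr: "(\<lambda>a. (a, h a)) ` fib s = (\<lambda>a. (a, h' a)) ` fib s"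
        using eq by (simp add: sh)
      have "h a = h' a" if "a \<in> fib s" for a
      proof -
        have "(a, h a) \<in> (\<lambda>a. (a, h' a)) ` fib s"
          using that unfolding gr[symmetric] by (rule imageI)
        then show ?thesis by auto
      qed
      moreover have "h \<in> extensional (fib s)" "h' \<in> extensional (fib s)"
        using v w by (auto simp: W_def sh PiE_def)
      ultimately show "v = w"
        unfolding sh using extensionalityI by blast
    qed
  qed
  have "upclosed D (R w)" if w: "w \<in> W" for w
  proof -
    obtain s h where sh: "w = (s, h)"
      by (cases w)
    obtain N where N: "set N \<subseteq> T" "works s h N" and s: "s \<in> Under S"
      using w by (auto simp: W_def sh)
    obtain xs where xs: "xs \<in> RL S s"
      using RL_obtain[OF S s] .
    have "map inl xs @ map inr N \<in> R w"
      using set_tag[OF RL_Base[OF S s xs] N(1)] xs N(2) by (simp add: R_def sh D_def)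
    moreover have "set m \<subseteq> D" if "m \<in> R w" for m
      using that by (simp add: R_def sh)
    moreover have "n \<in> R w" if m: "m \<in> R w" and n: "set n \<subseteq> D" "set m \<subseteq> set n" for m n
    proof -
      have "lefts n \<in> RL S s"
        using m by (intro RL_mono[OF S s _ lefts_mono[OF n(2)] set_lefts_tag[OF n(1)[unfolded D_def]]])
          (simp add: R_def sh)
      moreover have "works s h (rights n)"
        using m by (intro works_mono[OF w[unfolded sh] _ rights_mono[OF n(2)] set_rights_tag[OF n(1)[unfolded D_def]]])
          (simp add: R_def sh)
      ultimately show ?thesis
        using n by (simp add: R_def sh)
    qed
    ultimately show ?thesis
      unfolding upclosed_def by blast
  qed
  then have E: "E \<in> Obj H"
    unfolding E_def by (rule mk_obj[OF sW])
  define st where "st u = fst (dec W u)" for u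
  define fu where "fu u = snd (dec W u)" for u
  have stfu: "st u \<in> Under S" "fu u \<in> fib (st u) \<rightarrow>\<^sub>E {b \<in> Under B. fn g b = st u}"
    "RL E u = {m. set m \<subseteq> D \<and> lefts m \<in> RL S (st u) \<and> works (st u) (fu u) (rights m)}"
    if "u \<in> Under E" for u
  proof -
    have u: "u \<in> enc W ` W"
      using that by (simp add: E_def)
    have "(st u, fu u) \<in> W"
      using dec_in[OF u] by (simp add: st_def fu_def)
    then show "st u \<in> Under S" "fu u \<in> fib (st u) \<rightarrow>\<^sub>E {b \<in> Under B. fn g b = st u}"
      by (auto simp: W_def)
    show "RL E u = {m. set m \<subseteq> D \<and> lefts m \<in> RL S (st u) \<and> works (st u) (fu u) (rights m)}"
      unfolding E_def RL_mk[OF u] by (simp add: R_def st_def fu_def case_prod_unfold)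
  qed
  have E_eqI: "u = v" if "u \<in> Under E" "v \<in> Under E" "st u = st v" "fu u = fu v" for u v
  proof -
    have "dec W u = dec W v"
      using that by (simp add: st_def fu_def prod_eq_iff)
    moreover have "u \<in> enc W ` W" "v \<in> enc W ` W"
      using that(1,2) by (simp_all add: E_def)
    ultimately show ?thesis
      using enc_dec by metis
  qed
  define e where "e = arr E st S"
  have e: "e \<in> hom H E S"
    unfolding e_def
  proof (rule arr_homI[OF E S, where F = lefts])
    show "st u \<in> Under S" if "u \<in> Under E" for u
      by (rule stfu(1)[OF that])
    show "comp (Base E) lefts"
      by (simp add: E_def D_def comp_lefts)
    show "set (lefts m) \<subseteq> Base S" if "set m \<subseteq> Base E" for m
      using set_lefts_tag that by (simp add: E_def D_def)
    show "lefts m \<in> RL S (st u)" if "u \<in> Under E" "m \<in> RL E u" for u m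
      using stfu(3)[OF that(1)] that(2) by simp
  qed
  have fn_e: "fn e u = st u" if "u \<in> Under E" for u
    using that by (simp add: e_def)
  obtain P p q pr where pb: "is_pullback H e f P p q" and BP: "Base P = tag (Base E) (Base A)"
    and pr: "\<And>u a. u \<in> Under E \<Longrightarrow> a \<in> Under A \<Longrightarrow> fn e u = fn f a \<Longrightarrow>
      pr u a \<in> Under P \<and> fn p (pr u a) = u \<and> fn q (pr u a) = a \<and>
      RL P (pr u a) = {m. set m \<subseteq> tag (Base E) (Base A) \<and> lefts m \<in> RL E u \<and> rights m \<in> RL A a}"
    and pr_inv: "\<And>w. w \<in> Under P \<Longrightarrow> pr (fn p w) (fn q w) = w"
    by (rule pullback_H[OF e f], rule that)
  note P = is_pullbackD(1-4)[OF pb e f]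
  have fibP: "fn p w \<in> Under E" "fn q w \<in> Under A" "fn q w \<in> fib (st (fn p w))" "fn e (fn p w) = fn f (fn q w)"
    if "w \<in> Under P" for w
  proof -
    show pE: "fn p w \<in> Under E" and qA: "fn q w \<in> Under A"
      using fn_in[OF P(2) that] fn_in[OF P(3) that] .
    show eq: "fn e (fn p w) = fn f (fn q w)"
      by (rule cmp_eqD[OF P(4) P(2) e P(3) f that])
    show "fn q w \<in> fib (st (fn p w))"
      using eq qA fn_e[OF pE] by (simp add: fib_def)
  qed
  define eval where "eval = arr P (\<lambda>w. fu (fn p w) (fn q w)) B"
  have fu_in: "fu (fn p w) (fn q w) \<in> Under B" "fn g (fu (fn p w) (fn q w)) = st (fn p w)" if "w \<in> Under P" for w
    using PiE_mem[OF stfu(2)[OF fibP(1)[OF that]] fibP(3)[OF that]] by auto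
  have eval: "eval \<in> hom H P B"
    unfolding eval_def
  \<comment> \<open>Tags are nested: \<open>rights (lefts m)\<close> are the programs contained in
    the realizer of the function, and \<open>rights m\<close> is the realizer of the
    argument.\<close>
  proof (rule arr_homI[OF P(1) B, where F = "\<lambda>m. app_all (rights (lefts m)) (rights m)"])
    show "fu (fn p w) (fn q w) \<in> Under B" if "w \<in> Under P" for w
      by (rule fu_in(1)[OF that])
    have BE: "Base P = tag (tag (Base S) T) (Base A)"
      by (simp add: BP E_def D_def)
    show "comp (Base P) (\<lambda>m. app_all (rights (lefts m)) (rights m))"
      unfolding app_all_def BE
    proof (rule comp_run[where A = "Base A" and B = "Base B"])
      show "comp (tag (tag (Base S) T) (Base A)) rights"
        by (rule comp_rights)
      show "comp (tag (tag (Base S) T) (Base A)) (\<lambda>m. rights (lefts m))"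
        by (rule comp_comp[OF comp_lefts comp_rights set_lefts_tag])
      show "set (rights m) \<subseteq> Base A" if "set m \<subseteq> tag (tag (Base S) T) (Base A)" for m
        by (rule set_rights_tag[OF that])
      show "set (rights (lefts m)) \<subseteq> total (Base A) (Base B)" if "set m \<subseteq> tag (tag (Base S) T) (Base A)" for m
        using set_rights_tag[OF set_lefts_tag[OF that]] by (simp add: T_def)
    qed
    show "set (app_all (rights (lefts m)) (rights m)) \<subseteq> Base B" if "set m \<subseteq> Base P" for m
      using that unfolding BE
      by (intro app_all_Base[OF set_rights_tag[OF set_lefts_tag] set_rights_tag])
    show "app_all (rights (lefts m)) (rights m) \<in> RL B (fu (fn p w) (fn q w))" if w: "w \<in> Under P" and m: "m \<in> RL P w" for w m
    proof -
      have "RL P w = {m. set m \<subseteq> tag (Base E) (Base A) \<and> lefts m \<in> RL E (fn p w) \<and> rights m \<in> RL A (fn q w)}"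
        using pr[OF fibP(1,2,4)[OF w]] pr_inv[OF w] by simp
      then have "lefts m \<in> RL E (fn p w)" "rights m \<in> RL A (fn q w)"
        using m by auto
      then show ?thesis
        using stfu(3)[OF fibP(1)[OF w]] fibP(3)[OF w] by (simp add: works_def)
    qed
  qed
  have "Cmp H g eval = Cmp H e p"
  proof (rule cmp_eqI[OF eval g cmp_H_hom[OF P(2) e]])
    fix w assume w: "w \<in> Under P"
    show "fn g (fn eval w) = fn (Cmp H e p) w"
      using w fu_in(2)[OF w] fn_e[OF fibP(1)[OF w]] fn_cmp[OF P(2) e w] by (simp add: eval_def)
  qed
  moreover have "\<exists>!h. transposes H E e P p q eval Z z Q a b c h"
    if z: "z \<in> hom H Z S" and Q: "is_pullback H z f Q a b" and c: "c \<in> hom H Q B"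
      and gc: "Cmp H g c = Cmp H z a" for Z z Q a b c
  proof -
    note ab = is_pullbackD(2-4)[OF Q z f] and Z = hom_H_obj(1)[OF z]
    \<comment> \<open>Of the given pullback \<open>Q\<close> only the universal property is known.
      The comparison arrows \<open>i\<close> and \<open>j\<close> with the explicit pullback
      \<open>Q0\<close> give access to its points and to realizers of them.\<close>
    obtain Q0 a0 b0 pr0 where Q0: "is_pullback H z f Q0 a0 b0" "Base Q0 = tag (Base Z) (Base A)"
      and pr0: "\<And>x y. x \<in> Under Z \<Longrightarrow> y \<in> Under A \<Longrightarrow> fn z x = fn f y \<Longrightarrow>
      pr0 x y \<in> Under Q0 \<and> fn a0 (pr0 x y) = x \<and> fn b0 (pr0 x y) = y \<and>
      RL Q0 (pr0 x y) = {m. set m \<subseteq> tag (Base Z) (Base A) \<and> lefts m \<in> RL Z x \<and> rights m \<in> RL A y}"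
      and pr0_inv: "\<And>w. w \<in> Under Q0 \<Longrightarrow> pr0 (fn a0 w) (fn b0 w) = w"
      by (rule pullback_H[OF z f], rule that)
    note ab0 = is_pullbackD(2-4)[OF Q0(1) z f]
    obtain j where j: "j \<in> hom H Q0 Q" "Cmp H a j = a0" "Cmp H b j = b0"
      using is_pullback_obtain[OF Q z f ab0] by metis
    obtain i where i: "i \<in> hom H Q Q0" "Cmp H a0 i = a" "Cmp H b0 i = b"
      using is_pullback_obtain[OF Q0(1) z f ab] by metis
    have ji: "Cmp H j i = Ide H Q"
    proof (rule H.is_pullback_unique[OF Q cmp_H_hom[OF i(1) j(1)]])
      show "Ide H Q \<in> hom H Q Q"
        by (rule H.ide_hom[OF hom_H_obj(1)[OF ab(1)]])
      show "Cmp H a (Cmp H j i) = Cmp H a (Ide H Q)"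
        using H.cmp_assoc[OF i(1) j(1) ab(1)] i(2) j(2) H.ide_right[OF ab(1)] by simp
      show "Cmp H b (Cmp H j i) = Cmp H b (Ide H Q)"
        using H.cmp_assoc[OF i(1) j(1) ab(2)] i(3) j(3) H.ide_right[OF ab(2)] by simp
    qed
    have pt: "fn j (pr0 x y) \<in> Under Q" "fn a (fn j (pr0 x y)) = x" "fn b (fn j (pr0 x y)) = y"
      if "x \<in> Under Z" "y \<in> fib (fn z x)" for x y
    proof -
      have xy: "pr0 x y \<in> Under Q0" "fn a0 (pr0 x y) = x" "fn b0 (pr0 x y) = y"
        using pr0[of x y] that by (auto simp: fib_def)
      show "fn j (pr0 x y) \<in> Under Q"
        by (rule fn_in[OF j(1) xy(1)])
      show "fn a (fn j (pr0 x y)) = x" "fn b (fn j (pr0 x y)) = y"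
        using fn_cmp[OF j(1) ab(1) xy(1)] fn_cmp[OF j(1) ab(2) xy(1)] j(2,3) xy(2,3) by simp_all
    qed
    have pt_inv: "fn j (pr0 (fn a t) (fn b t)) = t" if t: "t \<in> Under Q" for t
    proof -
      have it: "fn i t \<in> Under Q0"
        by (rule fn_in[OF i(1) t])
      have "pr0 (fn a t) (fn b t) = fn i t"
        using pr0_inv[OF it] fn_cmp[OF i(1) ab0(1) t] fn_cmp[OF i(1) ab0(2) t] i(2,3) by simp
      then show ?thesis
        using fn_cmp[OF i(1) j(1) t] ji t by simp
    qed
    have Qfib: "fn a t \<in> Under Z" "fn b t \<in> fib (fn z (fn a t))" if "t \<in> Under Q" for t
      using fn_in[OF ab(1) that] fn_in[OF ab(2) that] cmp_eqD[OF ab(3) ab(1) z ab(2) f that]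
      by (simp_all add: fib_def)
    \<comment> \<open>\<open>fn j (pr0 x y)\<close> is the point of \<open>Q\<close> over
      \<open>x\<close> and \<open>y\<close>.\<close>
    define tr where "tr x = (\<lambda>y\<in>fib (fn z x). fn c (fn j (pr0 x y)))" for x
    define c0 where "c0 = Cmp H c j"
    have c0: "c0 \<in> hom H Q0 B"
      unfolding c0_def by (rule cmp_H_hom[OF j(1) c])
    obtain F where F: "comp (Base Q0) F" "\<And>xs. set xs \<subseteq> Base Q0 \<Longrightarrow> set (F xs) \<subseteq> Base B"
      "\<And>a xs. a \<in> Under Q0 \<Longrightarrow> xs \<in> RL Q0 a \<Longrightarrow> F xs \<in> RL B (fn c0 a)"
      using fn_tracking_obtain[OF c0] by blast
    obtain G where G: "comp (Base Z) G" "\<And>xs. set xs \<subseteq> Base Z \<Longrightarrow> set (G xs) \<subseteq> Base S"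
      "\<And>a xs. a \<in> Under Z \<Longrightarrow> xs \<in> RL Z a \<Longrightarrow> G xs \<in> RL S (fn z a)"
      using fn_tracking_obtain[OF z] by blast
    \<comment> \<open>A realizer of \<open>x\<close> is absorbed into the tracking \<open>F\<close>
      of \<open>c0\<close>; the resulting program awaits a realizer of a point of the fibre. Here a
      list with a single program is enough.\<close>
    obtain cc where cc: "comp (Base Z) (\<lambda>xs. [cc xs])"
      "\<And>xs ys. set xs \<subseteq> Base Z \<Longrightarrow> set ys \<subseteq> Base A \<Longrightarrow>
        app (cc xs) (code ys) = Some (code (F (map inl xs @ map inr ys)))"
      using comp_curry[OF F(1)[unfolded Q0(2)]] by blast
    have ccT: "cc xs \<in> T" if "set xs \<subseteq> Base Z" for xs
      unfolding T_def total_def using cc(2)[OF that] F(2) set_tag[OF that] by (auto simp: Q0(2))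
    have works: "works (fn z x) (tr x) [cc xs]" if x: "x \<in> Under Z" and xs: "xs \<in> RL Z x" for x xs
      unfolding works_def
    proof (intro ballI)
      fix y ys assume y: "y \<in> fib (fn z x)" and ys: "ys \<in> RL A y"
      have yA: "y \<in> Under A" "fn z x = fn f y"
        using y by (auto simp: fib_def)
      note xy = pr0[OF x yA]
      note sub = RL_Base[OF Z x xs] RL_Base[OF A yA(1) ys]
      have "app_all [cc xs] ys = F (map inl xs @ map inr ys)"
        using run[OF cc(2)[OF sub]] by (simp add: app_all_def)
      also have "\<dots> \<in> RL B (fn c0 (pr0 x y))"
        using xy xs ys set_tag[OF sub] by (intro F(3)) simp_all
      also have "fn c0 (pr0 x y) = tr x y"
        using fn_cmp[OF j(1) c] xy y by (simp add: c0_def tr_def)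
      finally show "app_all [cc xs] ys \<in> RL B (tr x y)" .
    qed
    \<comment> \<open>Any realizer of \<open>x\<close> supplies the list of programs that membership
      in \<open>W\<close> demands.\<close>
    have inW: "(fn z x, tr x) \<in> W" if x: "x \<in> Under Z" for x
    proof -
      obtain xs where xs: "xs \<in> RL Z x"
        using RL_obtain[OF Z x] .
      have "\<exists>N. set N \<subseteq> T \<and> works (fn z x) (tr x) N"
        using works[OF x xs] ccT[OF RL_Base[OF Z x xs]] by (intro exI[of _ "[cc xs]"]) simp
      moreover have "tr x y \<in> Under B \<and> fn g (tr x y) = fn z x" if y: "y \<in> fib (fn z x)" for y
        using fn_in[OF c pt(1)[OF x y]] cmp_eqD[OF gc c g ab(1) z pt(1)[OF x y]] pt(2)[OF x y] y
        by (simp add: tr_def)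
      ultimately show ?thesis
        using fn_in[OF z x] by (auto simp: W_def tr_def[of x])
    qed
    define h where "h = arr Z (\<lambda>x. enc W (fn z x, tr x)) E"
    have encE: "enc W (fn z x, tr x) \<in> Under E" "st (enc W (fn z x, tr x)) = fn z x"
      "fu (enc W (fn z x, tr x)) = tr x" if "x \<in> Under Z" for x
      using inW[OF that] dec_enc[OF sW inW[OF that]] by (simp_all add: E_def st_def fu_def)
    have h: "h \<in> hom H Z E"
      unfolding h_def
    proof (rule arr_homI[OF Z E encE(1), where F = "\<lambda>xs. map inl (G xs) @ map inr [cc xs]"])
      show "comp (Base Z) (\<lambda>xs. map inl (G xs) @ map inr [cc xs])"
        by (rule comp_tag[OF G(1) cc(1)])
      have sub: "set (map inl (G xs) @ map inr [cc xs]) \<subseteq> D" if "set xs \<subseteq> Base Z" for xs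
        unfolding D_def by (rule set_tag[OF G(2)[OF that]]) (simp add: ccT[OF that])
      then show "set (map inl (G xs) @ map inr [cc xs]) \<subseteq> Base E" if "set xs \<subseteq> Base Z" for xs
        using that by (simp add: E_def)
      show "map inl (G xs) @ map inr [cc xs] \<in> RL E (enc W (fn z x, tr x))" if "x \<in> Under Z" "xs \<in> RL Z x" for x xs
        unfolding stfu(3)[OF encE(1)[OF that(1)]] encE(2,3)[OF that(1)]
        using sub[OF RL_Base[OF Z that]] G(3)[OF that] works[OF that] rights_map(1)[of "[cc xs]"]
          lefts_map(2)[of "[cc xs]"]
        by (simp del: list.map)
    qed
    have fn_h: "st (fn h x) = fn z x" "fu (fn h x) = tr x" if "x \<in> Under Z" for x
      using that encE by (simp_all add: h_def)
    have eh: "Cmp H e h = z"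
      by (rule cmp_eqI[OF h e z]) (simp add: fn_e fn_in[OF h] fn_h)
    have "Cmp H e (Cmp H h a) = Cmp H f b"
      using H.cmp_assoc[OF ab(1) h e] eh ab(3) by simp
    then obtain u where u: "u \<in> hom H Q P" "Cmp H p u = Cmp H h a" "Cmp H q u = b"
      using is_pullback_obtain[OF pb e f cmp_H_hom[OF ab(1) h] ab(2)] by metis
    have "Cmp H eval u = c"
    proof (rule cmp_eqI[OF u(1) eval c])
      fix t assume t: "t \<in> Under Q"
      have "fn p (fn u t) = fn h (fn a t)"
        by (rule cmp_eqD[OF u(2) u(1) P(2) ab(1) h t])
      moreover have "fn q (fn u t) = fn b t"
        using fn_cmp[OF u(1) P(3) t] u(3) by simp
      ultimately have "fn eval (fn u t) = tr (fn a t) (fn b t)"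
        using fn_in[OF u(1) t] Qfib(1)[OF t] by (simp add: eval_def fn_h)
      also have "\<dots> = fn c t"
        using Qfib[OF t] pt_inv[OF t] by (simp add: tr_def)
      finally show "fn eval (fn u t) = fn c t" .
    qed
    then have "transposes H E e P p q eval Z z Q a b c h"
      unfolding transposes_def using h eh u by blast
    moreover have "h1 = h" if tr1: "transposes H E e P p q eval Z z Q a b c h1" for h1
    proof -
      obtain u1 where h1: "h1 \<in> hom H Z E" "Cmp H e h1 = z"
        and u1: "u1 \<in> hom H Q P" "Cmp H p u1 = Cmp H h1 a" "Cmp H q u1 = b" "Cmp H eval u1 = c"
        using tr1 unfolding transposes_def by blast
      show ?thesis
      proof (rule hom_eqI[OF h1(1) h])
        fix x assume x: "x \<in> Under Z"
        note h1E = fn_in[OF h1(1) x] and hE = fn_in[OF h x]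
        have st: "st (fn h1 x) = fn z x"
          using fn_cmp[OF h1(1) e x] h1(2) fn_e[OF h1E] by simp
        \<comment> \<open>The function part of a competing \<open>h1\<close> is recovered value by
          value: evaluation at the point of \<open>Q\<close> over \<open>x\<close> and
          \<open>y\<close> has to agree with \<open>c\<close> there.\<close>
        have "fu (fn h1 x) y = tr x y" if y: "y \<in> fib (fn z x)" for y
        proof -
          define t where "t = fn j (pr0 x y)"
          have t: "t \<in> Under Q" "fn a t = x" "fn b t = y"
            using pt[OF x y] by (simp_all add: t_def)
          have "fn p (fn u1 t) = fn h1 x"
            using cmp_eqD[OF u1(2) u1(1) P(2) ab(1) h1(1) t(1)] t(2) by simp
          moreover have "fn q (fn u1 t) = y"
            using fn_cmp[OF u1(1) P(3) t(1)] u1(3) t(3) by simp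
          ultimately have "fu (fn h1 x) y = fn eval (fn u1 t)"
            using fn_in[OF u1(1) t(1)] by (simp add: eval_def)
          also have "\<dots> = fn c t"
            using fn_cmp[OF u1(1) eval t(1)] u1(4) by simp
          also have "\<dots> = tr x y"
            using y by (simp add: tr_def t_def)
          finally show ?thesis .
        qed
        moreover have "fu (fn h1 x) \<in> extensional (fib (fn z x))"
          using stfu(2)[OF h1E] by (simp add: PiE_def st)
        moreover have "tr x \<in> extensional (fib (fn z x))"
          by (simp add: tr_def)
        ultimately have "fu (fn h1 x) = tr x"
          by (intro extensionalityI)
        then show "fn h1 x = fn h x"
          using st fn_h[OF x] by (intro E_eqI[OF h1E hE]) simp_all
      qed
    qed
    ultimately show ?thesis
      by (rule ex1I)
  qed
  ultimately have "is_local_exp H S f B g E e P p q eval"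
    unfolding is_local_exp_def using e pb eval by (intro conjI allI impI) simp_all
  then show thesis
    by (rule that)
qed

lemma has_local_exps_H: "has_local_exps H"
  unfolding has_local_exps_def
proof (intro allI ballI)
  fix S A B f g assume f: "f \<in> hom H A S" and g: "g \<in> hom H B S"
  obtain E e P p q eval where "is_local_exp H S f B g E e P p q eval"
    by (rule local_exp_H[OF f g])
  then show "\<exists>E e P p q ev. is_local_exp H S f B g E e P p q ev"
    by blast
qed

end

theorem theorem4p7:
  fixes app :: "'p \<Rightarrow> 'p \<Rightarrow> 'p option" and k s :: 'p
    and code :: "'p list \<Rightarrow> 'p" and U :: "'u set set"
  assumes "nontrivial_pca app k s"
    and "pca_coding app k s code"
    and "set_universe U"
  shows "category (HAsm U app code) \<and>
         locally_cartesian_closed (HAsm U app code) \<and>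
         regular_category (HAsm U app code) \<and>
         has_nno (HAsm U app code) \<and>
         has_stable_finite_colimits (HAsm U app code)"
proof -
  interpret nt: nontrivial_pca app k s
    by (rule assms(1))
  interpret pca_coding app k s code
    by (rule assms(2))
  interpret herbrand_universe app k s code U
    by unfold_locales (rule assms(3))
  have lim: "has_finite_limits H"
    by (rule H.has_finite_limitsI[OF terminal_H has_products_H has_equalizers_H])
  have colim: "has_finite_colimits H"
    by (rule H.has_finite_colimitsI[OF initial_H has_coproducts_H has_coequalizers_H])
  show ?thesis
    unfolding has_stable_finite_colimits_def
    by (intro conjI H.category_axioms has_nno_H colim
        H.locally_cartesian_closedI[OF has_local_exps_H has_pullbacks_H]
        H.regular_categoryI[OF has_local_exps_H has_products_H has_pullbacks_H lim has_coequalizers_H]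
        H.finite_colimits_stableI[OF has_local_exps_H has_products_H])
qed

end
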